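(* Let $\mathfrak{m}$ be a maximal ideal of $A$ such that $\mathfrak{a}_r\not\subseteq\mathfrak{m}$. Then the canonical $k_{\mathfrak{m}}$-homomorphism $$\frac{\mathrm{Der}_K(A_{\mathfrak{m}})}{\mathfrak{m}\,\mathrm{Der}_K(A_{\mathfrak{m}})}\to(\mathfrak{m}/\mathfrak{m}^2)^*,\qquad \delta+\mathfrak{m}\,\mathrm{Der}_K(A_{\mathfrak{m}})\mapsto\big(a+\mathfrak{m}^2\mapsto\delta(a)+\mathfrak{m}\big),$$ is an isomorphism. (So, at a simple point $x=x_{\mathfrak{m}}$ of the variety $V=\mathrm{Spec}(A)$ the tangent space $T(V)_x$ is canonically isomorphic to $\mathrm{Der}_K(A_{\mathfrak{m}})/\mathfrak{m}\,\mathrm{Der}_K(A_{\mathfrak{m}})$.)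
   Context: $K$ is a field of characteristic zero (not necessarily algebraically closed), $P_n=K[x_1,\ldots,x_n]$, $I=(f_1,\ldots,f_m)$ is a prime but not maximal ideal of $P_n$, and $A=P_n/I$, a domain with field of fractions $Q$. $\overline{J}=\left(\overline{\partial f_i/\partial x_j}\right)\in M_{m,n}(A)$ is the Jacobi matrix (entries reduced modulo $I$), $r$ is its rank over $Q$, and the Jacobian ideal $\mathfrak{a}_r$ is the ideal of $A$ generated by all $r\times r$ minors of $\overline{J}$. For a maximal ideal $\mathfrak{m}$ of $A$, $k_{\mathfrak{m}}=A_{\mathfrak{m}}/\mathfrak{m}A_{\mathfrak{m}}\simeq A/\mathfrak{m}$ is the residue field, $(\mathfrak{m}/\mathfrak{m}^2)^*=\mathrm{Hom}_{k_{\mathfrak{m}}}(\mathfrak{m}/\mathfrak{m}^2,k_{\mathfrak{m}})$, and $T(V)_x=\mathrm{Der}_K(A_{\mathfrak{m}},k_{\mathfrak{m}})$ is the tangent space at the point $x=x_{\mathfrak{m}}$; it is canonically isomorphic to $(\mathfrak{m}/\mathfrak{m}^2)^*$ via $\delta\mapsto(a+\mathfrak{m}^2\mapsto\delta(a))$. *)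

theory Defs
  imports
    "HOL-Library.Poly_Mapping"
    "HOL-Computational_Algebra.Polynomial_Factorial"
    "HOL-Algebra.QuotRing"
    "HOL-Algebra.Ideal_Product"
    "HOL-Algebra.Generated_Groups"
    "Jordan_Normal_Form.DL_Rank_Submatrix"
begin

hide_const (open) Multiset.mult
hide_const (open) Polynomial.smult
hide_const (open) Modules.module_hom

section \<open>Polynomials and the affine algebra\<close>

text \<open>Variables are numbered from 0, so the polynomial ring in \<open>n\<close> variables consists of the
  polynomials all of whose monomials only involve variables with index below \<open>n\<close>.\<close>

type_synonym 'k mpoly = "(nat \<Rightarrow>\<^sub>0 nat) \<Rightarrow>\<^sub>0 'k"

definition poly_ring :: "nat \<Rightarrow> 'k::comm_ring_1 mpoly ring" where
  "poly_ring n =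
    class_ring\<lparr>carrier := {p. \<forall>t\<in>Poly_Mapping.keys p. Poly_Mapping.keys t \<subseteq> {..<n}}\<rparr>"

definition const_poly :: "'k::comm_ring_1 \<Rightarrow> 'k mpoly" where
  "const_poly c = Poly_Mapping.single 0 c"

text \<open>The subtraction of exponents is truncated, but a monomial free of the \<open>j\<close>-th variable gets
  the coefficient 0.\<close>

definition partial_deriv :: "nat \<Rightarrow> 'k::comm_ring_1 mpoly \<Rightarrow> 'k mpoly" where
  "partial_deriv j p = (\<Sum>t\<in>Poly_Mapping.keys p.
     Poly_Mapping.single (t - Poly_Mapping.single j 1)
       (of_nat (Poly_Mapping.lookup t j) * Poly_Mapping.lookup p t))"

text \<open>The coordinate ring is carried by a type \<open>'a\<close> of class \<open>idom\<close>, identified with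
  \<open>poly_ring n Quot I\<close> by a ring isomorphism \<open>h\<close>.\<close>

definition quot_proj ::
  "nat \<Rightarrow> 'k::comm_ring_1 mpoly set \<Rightarrow> ('k mpoly set \<Rightarrow> 'a) \<Rightarrow> 'k mpoly \<Rightarrow> 'a" where
  "quot_proj n I h p = h (I +>\<^bsub>poly_ring n\<^esub> p)"

text \<open>Here \<open>p\<close> is the projection from polynomials to the coordinate ring.\<close>

definition jacobi_mat ::
  "('k::comm_ring_1 mpoly \<Rightarrow> 'a) \<Rightarrow> nat \<Rightarrow> nat \<Rightarrow> (nat \<Rightarrow> 'k mpoly) \<Rightarrow> 'a mat" where
  "jacobi_mat p m n f = mat m n (\<lambda>(i, j). p (partial_deriv j (f i)))"

definition frac_rank :: "'a::idom mat \<Rightarrow> nat" where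
  "frac_rank J = vec_space.rank (dim_row J) (map_mat to_fract J)"

text \<open>For \<open>r\<close> the rank over the field of fractions this is the Jacobian ideal.\<close>

definition minors_ideal :: "nat \<Rightarrow> 'a::comm_ring_1 mat \<Rightarrow> 'a set" where
  "minors_ideal r J = Idl\<^bsub>class_ring\<^esub>
     {det (submatrix J S T) | S T.
        S \<subseteq> {..<dim_row J} \<and> T \<subseteq> {..<dim_col J} \<and> card S = r \<and> card T = r}"

section \<open>Localization of a domain at a maximal ideal\<close>

definition loc_ring :: "'a::idom set \<Rightarrow> 'a fract ring" where
  "loc_ring M = class_ring\<lparr>carrier := {Fract a s | a s. s \<notin> M}\<rparr>"

definition loc_ideal :: "'a::idom set \<Rightarrow> 'a fract set" where
  "loc_ideal M = Idl\<^bsub>loc_ring M\<^esub> (to_fract ` M)"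

definition residue_field :: "'a::idom set \<Rightarrow> 'a fract set ring" where
  "residue_field M = loc_ring M Quot loc_ideal M"

section \<open>Modules\<close>

text \<open>The \<open>module\<close> record extends the \<open>ring\<close> record; its fields \<open>mult\<close> and \<open>one\<close> play no role for
  modules.\<close>

definition regular_module :: "('a, 'e) ring_scheme \<Rightarrow> ('a, 'a) module" where
  "regular_module R = \<lparr>carrier = carrier R, mult = mult R, one = one R,
     zero = zero R, add = add R, smult = mult R\<rparr>"

text \<open>The quotient of \<open>M\<close> by a submodule \<open>N\<close>, as a module over a ring whose elements are cosets of
  scalars: a coset acts through any scalar \<open>a\<close> with \<open>g a\<close> in it. As for \<^const>\<open>rcoset_mult\<close>, the
  union ranges over all choices of representatives.\<close>

definition quot_module ::
  "('a \<Rightarrow> 'c) \<Rightarrow> ('a, 'b, 'e) module_scheme \<Rightarrow> 'b set \<Rightarrow> ('c set, 'b set) module" where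
  "quot_module g M N = \<lparr>carrier = a_rcosets\<^bsub>M\<^esub> N, mult = undefined, one = undefined,
     zero = N, add = set_add M,
     smult = (\<lambda>C X. \<Union>a\<in>g -` C. \<Union>x\<in>X. N +>\<^bsub>M\<^esub> (a \<odot>\<^bsub>M\<^esub> x))\<rparr>"

text \<open>A set \<open>F\<close> of functions from \<open>D\<close> to a module, with the pointwise operations. Functions are
  extensional, that is, \<^const>\<open>undefined\<close> outside \<open>D\<close>.\<close>

definition fun_module ::
  "'d set \<Rightarrow> ('d \<Rightarrow> 'b) set \<Rightarrow> ('a, 'b, 'e) module_scheme \<Rightarrow> ('a, 'd \<Rightarrow> 'b) module" where
  "fun_module D F N = \<lparr>carrier = F, mult = undefined, one = undefined,
     zero = (\<lambda>x\<in>D. \<zero>\<^bsub>N\<^esub>), add = (\<lambda>f g. \<lambda>x\<in>D. f x \<oplus>\<^bsub>N\<^esub> g x),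
     smult = (\<lambda>c f. \<lambda>x\<in>D. c \<odot>\<^bsub>N\<^esub> f x)\<rparr>"

definition dual_module :: "'c ring \<Rightarrow> ('c, 'b) module \<Rightarrow> ('c, 'b \<Rightarrow> 'c) module" where
  "dual_module k V = fun_module (carrier V)
     (module_hom k V (regular_module k) \<inter> extensional (carrier V)) (regular_module k)"

definition module_iso ::
  "('a, 'e) ring_scheme \<Rightarrow> ('a, 'b, 'e1) module_scheme \<Rightarrow> ('a, 'd, 'e2) module_scheme
     \<Rightarrow> ('b \<Rightarrow> 'd) set" where
  "module_iso R M N = {f \<in> module_hom R M N. bij_betw f (carrier M) (carrier N)}"

section \<open>Derivations, cotangent and tangent space\<close>

text \<open>Derivations of \<open>R\<close> into the \<open>R\<close>-module \<open>N\<close> that are linear over \<open>'k\<close>, where the structure of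
  \<open>R\<close> as an algebra over \<open>'k\<close> is given by the map \<open>u\<close>.\<close>

definition derivations ::
  "('k \<Rightarrow> 'a) \<Rightarrow> ('a, 'e) ring_scheme \<Rightarrow> ('a, 'b, 'e1) module_scheme \<Rightarrow> ('a \<Rightarrow> 'b) set" where
  "derivations u R N = {d \<in> carrier R \<rightarrow>\<^sub>E carrier N.
     (\<forall>x\<in>carrier R. \<forall>y\<in>carrier R. d (x \<oplus>\<^bsub>R\<^esub> y) = d x \<oplus>\<^bsub>N\<^esub> d y) \<and>
     (\<forall>c. \<forall>x\<in>carrier R. d (u c \<otimes>\<^bsub>R\<^esub> x) = u c \<odot>\<^bsub>N\<^esub> d x) \<and>
     (\<forall>x\<in>carrier R. \<forall>y\<in>carrier R.
        d (x \<otimes>\<^bsub>R\<^esub> y) = (x \<odot>\<^bsub>N\<^esub> d y) \<oplus>\<^bsub>N\<^esub> (y \<odot>\<^bsub>N\<^esub> d x))}"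

definition der_module :: "('k \<Rightarrow> 'a fract) \<Rightarrow> 'a::idom set \<Rightarrow> ('a fract, 'a fract \<Rightarrow> 'a fract) module"
  where
  "der_module u M = fun_module (carrier (loc_ring M))
     (derivations u (loc_ring M) (regular_module (loc_ring M))) (regular_module (loc_ring M))"

definition ideal_der :: "('k \<Rightarrow> 'a fract) \<Rightarrow> 'a::idom set \<Rightarrow> ('a fract \<Rightarrow> 'a fract) set" where
  "ideal_der u M = generate (add_monoid (der_module u M))
     {to_fract a \<odot>\<^bsub>der_module u M\<^esub> d | a d. a \<in> M \<and> d \<in> carrier (der_module u M)}"

definition der_fibre ::
  "('k \<Rightarrow> 'a fract) \<Rightarrow> 'a::idom set \<Rightarrow> ('a fract set, ('a fract \<Rightarrow> 'a fract) set) module" where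
  "der_fibre u M = quot_module id (der_module u M) (ideal_der u M)"

text \<open>The residue field acts through its identification with the quotient of the domain itself by
  the maximal ideal, induced by \<^const>\<open>to_fract\<close>.\<close>

definition cotangent_space :: "'a::idom set \<Rightarrow> ('a fract set, 'a set) module" where
  "cotangent_space M =
     quot_module to_fract ((regular_module class_ring)\<lparr>carrier := M\<rparr>) (M \<cdot>\<^bsub>class_ring\<^esub> M)"

definition residue_module :: "'a::idom set \<Rightarrow> ('a fract, 'a fract set) module" where
  "residue_module M = \<lparr>carrier = carrier (residue_field M), mult = mult (residue_field M),
     one = one (residue_field M), zero = zero (residue_field M), add = add (residue_field M),
     smult = (\<lambda>a X. (loc_ideal M +>\<^bsub>loc_ring M\<^esub> a) \<otimes>\<^bsub>residue_field M\<^esub> X)\<rparr>"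

definition tangent_space ::
  "('k \<Rightarrow> 'a fract) \<Rightarrow> 'a::idom set \<Rightarrow> ('a fract set, 'a fract \<Rightarrow> 'a fract set) module" where
  "tangent_space u M = fun_module (carrier (loc_ring M))
     (derivations u (loc_ring M) (residue_module M)) (regular_module (residue_field M))"

end

theory Submission
  imports Defs "Jordan_Normal_Form.Char_Poly" "HOL-Algebra.Algebraic_Closure_Type"
begin

text \<open>Let \<open>L\<close> be the local ring of \<open>A\<close> at \<open>M\<close> and \<open>N\<close> its maximal ideal. A derivation of \<open>L\<close>, or of
  \<open>L\<close> into \<open>L / N\<close>, is determined by its values on the coordinates, which may be any vector in the kernel
  of the Jacobi matrix \<open>J\<close>, respectively of \<open>J\<close> modulo \<open>N\<close>. A maximal minor of \<open>J\<close> is a unit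
  of \<open>L\<close>, so there is a matrix \<open>B\<close> over \<open>L\<close> with \<open>J B J = J\<close>, and \<open>1 - B J\<close> projects onto the
  kernel of \<open>J\<close>. This projection lifts derivations into \<open>L / N\<close> to derivations of \<open>L\<close> and shows
  that a derivation with values in \<open>N\<close> lies in \<open>N Der(L)\<close>.

  The comparison of derivations into \<open>L / N\<close> with the dual of \<open>M / M\<^sup>2\<close> uses that every coordinate
  is algebraic over \<open>K\<close> modulo \<open>M\<close> (Zariski's lemma), with a separable minimal polynomial
  \<open>\<mu>\<^sub>i\<close>. A functional \<open>\<phi>\<close> on \<open>M / M\<^sup>2\<close> forces the value \<open>\<phi>(\<mu>\<^sub>i(x\<^sub>i)) / \<mu>\<^sub>i'(x\<^sub>i)\<close> at \<open>x\<^sub>i\<close>, and these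
  values do define a derivation extending \<open>\<phi>\<close>, because the quotient of the polynomial ring by all
  \<open>\<mu>\<^sub>i(x\<^sub>i)\<close> is von Neumann regular: over the algebraic closure each of its elements is a root of a
  product of distinct linear factors.\<close>

hide_const (open) Multiset.mult Polynomial.smult Modules.module_hom
  Polynomial_Divisibility.poly_ring Polynomials.lead_coeff Polynomials.degree
  up_ring.coeff up_ring.monom

section \<open>Zariski's lemma relative to a prime ideal\<close>

text \<open>The delicate point is surjectivity onto the dual of M / M^2. Let P be the preimage of M
  in the polynomial ring. The forced values at the coordinates are right for the elements
  \<mu>_i(x_i), but P may need further generators. Regularity repairs this: every g in P differs
  from some g^2 c, which lies in P^2, by an element of the ideal of the \<mu>_i(x_i). So P is this
  ideal plus P^2, and the defect of the candidate derivation is additive and vanishes modulo N on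
  both parts. The closure of K is only a device: there a split polynomial gives c explicitly, and
  the relation obtained is linear over K[x] in its cofactors, so a K-linear retraction of the
  closure onto K brings it back. The fields A / M and L / N are not types here, and subrings are
  plain sets. Field arguments are therefore rephrased as congruences between representatives. This
  is why Zariski's lemma is proved in Goldman's form: becoming a field after inverting one element
  can be stated with elements and congruences only, and it descends when a generator is
  removed.\<close>

locale subring_set =
  fixes R :: "'b::comm_ring_1 set"
  assumes one_closed [simp]: "1 \<in> R"
    and diff_closed [simp]: "\<And>x y. x \<in> R \<Longrightarrow> y \<in> R \<Longrightarrow> x - y \<in> R"
    and mult_closed [simp]: "\<And>x y. x \<in> R \<Longrightarrow> y \<in> R \<Longrightarrow> x * y \<in> R"
begin

lemma zero_closed [simp]: "0 \<in> R"
  using diff_closed[OF one_closed one_closed] by simp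

lemma uminus_closed [simp]: "x \<in> R \<Longrightarrow> - x \<in> R"
  using diff_closed[OF zero_closed] by force

lemma add_closed [simp]: "x \<in> R \<Longrightarrow> y \<in> R \<Longrightarrow> x + y \<in> R"
  using diff_closed[of x "- y"] by simp

lemma power_closed [simp]: "x \<in> R \<Longrightarrow> x ^ k \<in> R"
  by (induction k) auto

lemma sum_closed [simp]: "(\<And>i. i \<in> A \<Longrightarrow> g i \<in> R) \<Longrightarrow> sum g A \<in> R"
  by (induction A rule: infinite_finite_induct) auto

lemma prod_closed [simp]: "(\<And>i. i \<in> A \<Longrightarrow> g i \<in> R) \<Longrightarrow> prod g A \<in> R"
  by (induction A rule: infinite_finite_induct) auto

lemma det_closed:
  assumes "A \<in> carrier_mat d d" "\<And>i j. i < d \<Longrightarrow> j < d \<Longrightarrow> A $$ (i, j) \<in> R"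
  shows "det A \<in> R"
proof -
  have "signof p \<in> R" for p :: "nat \<Rightarrow> nat"
    by (auto simp: sign_def)
  then show ?thesis
    unfolding det_def'[OF assms(1)]
    by (intro sum_closed mult_closed prod_closed) (auto intro!: assms(2) dest: permutes_in_image)
qed

end

definition polys_over :: "'b::comm_ring_1 set \<Rightarrow> 'b poly set" where
  "polys_over R = {q. \<forall>i. coeff q i \<in> R}"

lemma (in subring_set) subring_polys_over: "subring_set (polys_over R)"
  by unfold_locales (auto simp: polys_over_def coeff_mult coeff_1)

lemma (in subring_set) poly_closed: "q \<in> polys_over R \<Longrightarrow> x \<in> R \<Longrightarrow> poly q x \<in> R"
  by (auto simp: polys_over_def poly_altdef)

lemma (in subring_set) pCons_closed [simp]:
  "c \<in> R \<Longrightarrow> q \<in> polys_over R \<Longrightarrow> pCons c q \<in> polys_over R"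
  by (auto simp: polys_over_def coeff_pCons split: nat.split)

section \<open>Generated subrings\<close>

inductive_set ring_gen :: "'b::comm_ring_1 set \<Rightarrow> 'b set" for S where
  one: "1 \<in> ring_gen S"
| base: "x \<in> S \<Longrightarrow> x \<in> ring_gen S"
| diff: "x \<in> ring_gen S \<Longrightarrow> y \<in> ring_gen S \<Longrightarrow> x - y \<in> ring_gen S"
| mult: "x \<in> ring_gen S \<Longrightarrow> y \<in> ring_gen S \<Longrightarrow> x * y \<in> ring_gen S"

lemma subring_ring_gen: "subring_set (ring_gen S)"
  by unfold_locales (auto intro: ring_gen.intros)

lemma ring_gen_mono: "S \<subseteq> T \<Longrightarrow> ring_gen S \<subseteq> ring_gen T"
proof
  fix x assume "S \<subseteq> T" "x \<in> ring_gen S"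
  show "x \<in> ring_gen T"
    using \<open>x \<in> ring_gen S\<close>
    by induction (use \<open>S \<subseteq> T\<close> in \<open>auto intro: ring_gen.intros\<close>)
qed

text \<open>Splits a finitely generated extension into steps from \<open>R\<close> to
  \<open>R[x]\<close>, with \<open>R[x]\<close> written as the set of polynomial values at
  \<open>x\<close>, the form in which the Goldman property is passed down.\<close>

lemma ring_gen_insert: "ring_gen (insert x S) = (\<lambda>q. poly q x) ` polys_over (ring_gen S)"
proof (intro equalityI subsetI)
  interpret subring_set "ring_gen S" by (rule subring_ring_gen)
  interpret P: subring_set "polys_over (ring_gen S)" by (rule subring_polys_over)
  fix z assume "z \<in> ring_gen (insert x S)"
  then show "z \<in> (\<lambda>q. poly q x) ` polys_over (ring_gen S)"
  proof induction
    case one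
    show ?case by (rule image_eqI[of _ _ 1]) auto
  next
    case (base y)
    then consider "y = x" | "y \<in> S" by auto
    then show ?case
    proof cases
      case 1
      then show ?thesis by (intro image_eqI[of _ _ "[:0, 1:]"]) auto
    next
      case 2
      then show ?thesis
        by (intro image_eqI[of _ _ "[:y:]"]) (auto simp: ring_gen.base polys_over_def coeff_pCons split: nat.split)
    qed
  next
    case (diff y z)
    then obtain p q where "y = poly p x" "z = poly q x"
      "p \<in> polys_over (ring_gen S)" "q \<in> polys_over (ring_gen S)" by auto
    then show ?case by (intro image_eqI[of _ _ "p - q"]) auto
  next
    case (mult y z)
    then obtain p q where "y = poly p x" "z = poly q x"
      "p \<in> polys_over (ring_gen S)" "q \<in> polys_over (ring_gen S)" by auto
    then show ?case by (intro image_eqI[of _ _ "p * q"]) auto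
  qed
next
  interpret T: subring_set "ring_gen (insert x S)" by (rule subring_ring_gen)
  fix z assume "z \<in> (\<lambda>q. poly q x) ` polys_over (ring_gen S)"
  then obtain q where q: "z = poly q x" "q \<in> polys_over (ring_gen S)" by auto
  have "q \<in> polys_over (ring_gen (insert x S))"
    using q(2) ring_gen_mono[of S "insert x S"] by (auto simp: polys_over_def)
  then show "z \<in> ring_gen (insert x S)"
    unfolding q(1) by (rule T.poly_closed) (simp add: ring_gen.base)
qed

section \<open>Congruences modulo an ideal; algebraic elements modulo a prime ideal\<close>

locale ideal_set =
  fixes N :: "'b::comm_ring_1 set"
  assumes zero_in [simp]: "0 \<in> N"
    and add_in: "\<And>x y. x \<in> N \<Longrightarrow> y \<in> N \<Longrightarrow> x + y \<in> N"
    and mult_in: "\<And>x y. x \<in> N \<Longrightarrow> y * x \<in> N"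
begin

lemma mult_in': "x \<in> N \<Longrightarrow> x * y \<in> N"
  using mult_in[of x y] by (simp add: mult.commute)

lemma uminus_in: "x \<in> N \<Longrightarrow> - x \<in> N"
  using mult_in[of x "- 1"] by simp

lemma diff_in: "x \<in> N \<Longrightarrow> y \<in> N \<Longrightarrow> x - y \<in> N"
  using add_in[of x "- y"] uminus_in by simp

lemma sum_in: "(\<And>i. i \<in> A \<Longrightarrow> g i \<in> N) \<Longrightarrow> sum g A \<in> N"
  by (induction A rule: infinite_finite_induct) (auto intro: add_in)

lemma cong_trans: "x - y \<in> N \<Longrightarrow> y - z \<in> N \<Longrightarrow> x - z \<in> N"
  using add_in[of "x - y" "y - z"] by simp

lemma cong_sym: "x - y \<in> N \<Longrightarrow> y - x \<in> N"
  using uminus_in[of "x - y"] by simp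

lemma cong_in: "x - y \<in> N \<Longrightarrow> x \<in> N \<longleftrightarrow> y \<in> N"
  using add_in[of "x - y" y] diff_in[of x "x - y"] by auto

lemma cong_add: "x - y \<in> N \<Longrightarrow> x' - y' \<in> N \<Longrightarrow> (x + x') - (y + y') \<in> N"
  using add_in[of "x - y" "x' - y'"] by (simp add: algebra_simps)

lemma cong_mult: "x - y \<in> N \<Longrightarrow> x' - y' \<in> N \<Longrightarrow> x * x' - y * y' \<in> N"
  using add_in[OF mult_in[of "x' - y'" x] mult_in[of "x - y" y']] by (simp add: algebra_simps)

lemma cong_mult_left: "x - y \<in> N \<Longrightarrow> z * x - z * y \<in> N"
  using mult_in[of "x - y" z] by (simp add: algebra_simps)

lemma cong_power: "x - y \<in> N \<Longrightarrow> x ^ k - y ^ k \<in> N"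
  by (induction k) (auto intro: cong_mult)

end

locale prime_set = ideal_set N for N :: "'b::comm_ring_1 set" +
  assumes one_notin: "1 \<notin> N"
    and prime_in: "\<And>x y. x * y \<in> N \<Longrightarrow> x \<in> N \<or> y \<in> N"
begin

lemma power_notin: "x \<notin> N \<Longrightarrow> x ^ k \<notin> N"
  by (induction k) (auto simp: one_notin dest: prime_in)

text \<open>The leading coefficient of \<open>q\<close> may vanish modulo \<open>N\<close>. Deleting
  all coefficients in \<open>N\<close> gives a representative whose degree is the degree modulo
  \<open>N\<close>, so that degree arguments apply.\<close>

lemma truncate_poly:
  assumes "subring_set R" "q \<in> polys_over R" "coeff q i \<notin> N"
  obtains q' where "q' \<in> polys_over R" "lead_coeff q' \<notin> N" "poly q x - poly q' x \<in> N"
proof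
  interpret subring_set R by fact
  define t where "t = (\<lambda>c. if c \<in> N then 0 else c)"
  define q' where "q' = map_poly t q"
  have t0: "t 0 = 0" by (simp add: t_def)
  have co: "coeff q' j = t (coeff q j)" for j
    by (simp add: q'_def coeff_map_poly t0)
  show "q' \<in> polys_over R"
    using assms(2) by (auto simp: polys_over_def co t_def)
  have "coeff q' i \<noteq> 0" using assms(3) by (auto simp: co t_def)
  then have "lead_coeff q' \<noteq> 0" by auto
  then show "lead_coeff q' \<notin> N" by (auto simp: co t_def split: if_splits)
  have "coeff q i - coeff q' i \<in> N" for i by (auto simp: co t_def)
  then have "poly (q - q') x \<in> N"
    unfolding poly_altdef by (auto intro!: sum_in mult_in')
  then show "poly q x - poly q' x \<in> N" by simp
qed

text \<open>The coefficient outside \<open>N\<close> makes \<open>q\<close> a nonzero polynomial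
  over the quotient: the class of \<open>x\<close> is algebraic over the image of
  \<open>R\<close>.\<close>

definition algebraic_mod :: "'b set \<Rightarrow> 'b \<Rightarrow> bool" where
  "algebraic_mod R x \<longleftrightarrow> (\<exists>q\<in>polys_over R. poly q x \<in> N \<and> (\<exists>i. coeff q i \<notin> N))"

text \<open>\<open>R / (R \<inter> N)\<close> becomes a field after inverting a single element.\<close>

definition goldman :: "'b set \<Rightarrow> bool" where
  "goldman R \<longleftrightarrow> (\<exists>s\<in>R. s \<notin> N \<and> (\<forall>r\<in>R. r \<notin> N \<longrightarrow> (\<exists>r'\<in>R. \<exists>j. r * r' - s ^ j \<in> N)))"

text \<open>A polynomial ring over a domain never becomes a field after inverting one element
  \<open>S\<close>. Indeed \<open>1 + x S\<close> is coprime to \<open>S\<close>; if it divided a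
  power of \<open>S\<close> it would be a unit, which its positive degree excludes.\<close>

lemma goldman_imp_algebraic:
  assumes R: "subring_set R" and g: "goldman ((\<lambda>q. poly q x) ` polys_over R)"
  shows "algebraic_mod R x"
proof (rule ccontr)
  assume "\<not> algebraic_mod R x"
  then have tr: "coeff q i \<in> N" if "q \<in> polys_over R" "poly q x \<in> N" for q i
    using that by (auto simp: algebraic_mod_def)
  interpret subring_set R by fact
  interpret P: subring_set "polys_over R" by (rule subring_polys_over)
  obtain S where S: "S \<in> polys_over R" "poly S x \<notin> N"
    and inv: "\<And>q. q \<in> polys_over R \<Longrightarrow> poly q x \<notin> N \<Longrightarrow>
      \<exists>q'\<in>polys_over R. \<exists>j. poly q x * poly q' x - poly S x ^ j \<in> N"
    using g by (auto simp: goldman_def)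
  have "\<exists>i. coeff S i \<notin> N"
    using S(2) unfolding poly_altdef by (metis (no_types, lifting) sum_in mult_in')
  then obtain S' where S': "S' \<in> polys_over R" "lead_coeff S' \<notin> N" "poly S x - poly S' x \<in> N"
    using truncate_poly[OF R S(1)] by metis
  define q where "q = pCons 1 S'"
  have q: "q \<in> polys_over R" using S'(1) by (simp add: q_def)
  have "coeff q 0 \<notin> N" by (simp add: q_def one_notin)
  then have "poly q x \<notin> N" using tr[OF q] by blast
  then obtain Q j where Q: "Q \<in> polys_over R" "poly q x * poly Q x - poly S x ^ j \<in> N"
    using inv[OF q] by auto
  define y where "y = x * poly S' x"
  have e: "poly q x * poly Q x * x ^ j - y ^ j \<in> N"
  proof -
    have "poly q x * poly Q x * x ^ j - poly S x ^ j * x ^ j \<in> N"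
      using mult_in'[OF Q(2), of "x ^ j"] by (simp add: algebra_simps)
    moreover have "poly S x ^ j * x ^ j - poly S' x ^ j * x ^ j \<in> N"
      using mult_in'[OF cong_power[OF S'(3), of j], of "x ^ j"] by (simp add: algebra_simps)
    ultimately show ?thesis
      using cong_trans by (fastforce simp: y_def power_mult_distrib mult.commute)
  qed
  \<comment> \<open>Modulo \<open>1 + x S'(x)\<close> the element \<open>x S'(x)\<close> is \<open>-1\<close>, so \<open>1 + x S'(x)\<close> divides \<open>1\<close>.\<close>
  have "\<exists>V\<in>polys_over R. (- y) ^ j - 1 = (1 + y) * poly V x" for j
  proof (induction j)
    case 0
    then show ?case by (intro bexI[of _ 0]) auto
  next
    case (Suc j)
    then obtain V where V: "V \<in> polys_over R" "(- y) ^ j - 1 = (1 + y) * poly V x" by auto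
    have "(- y) ^ Suc j - 1 = (- y) * ((- y) ^ j - 1) - (1 + y)" by (simp add: algebra_simps)
    also have "\<dots> = (1 + y) * poly (- (pCons 0 S') * V - 1) x"
      unfolding V(2) by (simp add: y_def algebra_simps)
    finally show ?case using V(1) S'(1) by (intro bexI[of _ "- (pCons 0 S') * V - 1"]) auto
  qed
  then obtain V where V: "V \<in> polys_over R" "(- y) ^ j - 1 = (1 + y) * poly V x" by auto
  define W where "W = (- 1) ^ j * Q * monom 1 j - V"
  have mon: "monom 1 j \<in> polys_over R" by (auto simp: polys_over_def)
  have W: "W \<in> polys_over R" unfolding W_def using mon V(1) Q(1) by auto
  have qy: "poly q x = 1 + y" by (simp add: q_def y_def)
  have "poly q x * poly W x - 1 =
      (- 1) ^ j * (poly q x * poly Q x * x ^ j - y ^ j) + ((- y) ^ j - 1 - (1 + y) * poly V x)"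
    unfolding W_def qy by (simp add: poly_monom poly_power algebra_simps power_minus[of y])
  also have "\<dots> \<in> N" using mult_in[OF e, of "(- 1) ^ j"] V(2) by simp
  finally have 1: "poly q x * poly W x - 1 \<in> N" .
  have "poly W x \<notin> N"
    using 1 cong_in one_notin mult_in by blast
  then have "\<exists>i. coeff W i \<notin> N"
    unfolding poly_altdef by (metis (no_types, lifting) sum_in mult_in')
  then obtain W' where W': "W' \<in> polys_over R" "lead_coeff W' \<notin> N" "poly W x - poly W' x \<in> N"
    using truncate_poly[OF R W] by metis
  \<comment> \<open>As \<open>x\<close> is transcendental, \<open>q W' = 1\<close> holds modulo
    \<open>N\<close> coefficient by coefficient. Since \<open>q\<close> has positive degree, the
    constant 1 does not contribute in the top degree, where the product of the two leading
    coefficients stands.\<close>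
  have "poly (q * W' - 1) x \<in> N"
    using cong_trans[OF cong_mult_left[OF cong_sym[OF W'(3)]] 1] by simp
  then have "coeff (q * W' - 1) (degree q + degree W') \<in> N"
    by (rule tr[rotated]) (use q W'(1) in auto)
  moreover have "S' \<noteq> 0" using S'(2) by auto
  then have "degree q = Suc (degree S')" "lead_coeff q = lead_coeff S'" by (auto simp: q_def)
  ultimately have "lead_coeff S' * lead_coeff W' \<in> N"
    by (simp add: coeff_mult_degree_sum coeff_1 del: coeff_pCons)
       (metis (no_types, lifting) \<open>degree q = Suc (degree S')\<close> \<open>lead_coeff q = lead_coeff S'\<close> add_Suc coeff_mult_degree_sum)
  then show False using S'(2) W'(2) prime_in by auto
qed


text \<open>Division with remainder by the relation for \<open>x\<close>. Its leading coefficient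
  \<open>a\<close> need not be a unit, so every step costs one factor \<open>a\<close>.\<close>

lemma reduce_degree:
  assumes R: "subring_set R" and a: "a \<in> R" and c: "\<And>i. c i \<in> R"
    and rel: "a * x ^ Suc e - (\<Sum>i<Suc e. c i * x ^ i) \<in> N" and q: "q \<in> polys_over R"
  shows "\<exists>l b. (\<forall>i. b i \<in> R) \<and> a ^ l * poly q x - (\<Sum>i<Suc e. b i * x ^ i) \<in> N"
  using q
proof (induction q)
  interpret subring_set R by fact
  case 0
  show ?case by (rule exI[of _ 0], rule exI[of _ "\<lambda>_. 0"]) auto
next
  interpret subring_set R by fact
  case (pCons c0 q)
  have c0: "c0 \<in> R" and "q \<in> polys_over R"
    using pCons.prems by (auto simp: polys_over_def coeff_pCons split: nat.splits)
  then obtain l b where b: "\<And>i. b i \<in> R"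
    and lb: "a ^ l * poly q x - (\<Sum>i<Suc e. b i * x ^ i) \<in> N"
    using pCons.IH by blast
  \<comment> \<open>The old remainder is multiplied by \<open>a * x\<close>, which shifts its
    coefficients. The overflowing term \<open>b e * a * x ^ Suc e\<close> is rewritten by
    \<open>rel\<close> and contributes \<open>b e * c i\<close>.\<close>
  define b' where "b' = (\<lambda>i. (if i = 0 then a ^ Suc l * c0 else a * b (i - 1)) + b e * c i)"
  have "a ^ Suc l * poly (pCons c0 q) x - (\<Sum>i<Suc e. b' i * x ^ i) =
      a * x * (a ^ l * poly q x - (\<Sum>i<Suc e. b i * x ^ i))
      + b e * (a * x ^ Suc e - (\<Sum>i<Suc e. c i * x ^ i))"
  proof -
    have "(\<Sum>i<Suc e. (if i = 0 then a ^ Suc l * c0 else a * b (i - 1)) * x ^ i)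
        = a ^ Suc l * c0 + (\<Sum>i<e. a * x * (b i * x ^ i))"
      by (subst sum.lessThan_Suc_shift) (simp add: mult_ac)
    then have "(\<Sum>i<Suc e. b' i * x ^ i) = a ^ Suc l * c0 + a * x * (\<Sum>i<e. b i * x ^ i)
        + b e * (\<Sum>i<Suc e. c i * x ^ i)"
      unfolding b'_def distrib_right sum.distrib sum_distrib_left by (simp only: mult.assoc)
    then show ?thesis by (simp add: algebra_simps)
  qed
  also have "\<dots> \<in> N" by (intro add_in mult_in lb rel)
  finally show ?case
    using a b c c0 by (intro exI[of _ "Suc l"] exI[of _ b']) (auto simp: b'_def)
qed

text \<open>The determinant trick: \<open>a ^ L * z\<close> acts on the span of \<open>1, \<dots>, x ^ e\<close> through a matrix
  over \<open>R\<close>.\<close>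

lemma integral_multiple:
  assumes R: "subring_set R" and a: "a \<in> R" and c: "\<And>i. c i \<in> R"
    and rel: "a * x ^ Suc e - (\<Sum>i<Suc e. c i * x ^ i) \<in> N" and q: "q \<in> polys_over R"
  shows "\<exists>L. \<exists>\<chi>\<in>polys_over R. monic \<chi> \<and> poly \<chi> (a ^ L * poly q x) \<in> N"
proof -
  interpret subring_set R by fact
  interpret P: subring_set "polys_over R" by (rule subring_polys_over)
  have mon: "monom 1 i \<in> polys_over R" for i by (auto simp: polys_over_def)
  have "\<forall>i. \<exists>l b. (\<forall>j. b j \<in> R) \<and>
      a ^ l * poly (q * monom 1 i) x - (\<Sum>j<Suc e. b j * x ^ j) \<in> N"
    by (intro allI reduce_degree[OF R a c rel] P.mult_closed q mon)
  then obtain l b where b: "\<And>i j. b i j \<in> R" and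
    lb: "\<And>i. a ^ l i * poly (q * monom 1 i) x - (\<Sum>j<Suc e. b i j * x ^ j) \<in> N"
    by metis
  \<comment> \<open>One exponent \<open>L\<close> serves all powers of \<open>x\<close> at once; row
    \<open>i\<close> of the matrix receives the missing factor \<open>a ^ (L - l i)\<close>.\<close>
  define d L y where "d = Suc e" and "L = (\<Sum>i<d. l i)" and "y = a ^ L * poly q x"
  have lL: "l i \<le> L" if "i < d" for i
    unfolding L_def by (rule member_le_sum) (use that in auto)
  define C where "C = mat d d (\<lambda>(i, j). a ^ (L - l i) * b i j)"
  define B where "B = y \<cdot>\<^sub>m 1\<^sub>m d - C"
  have C: "C \<in> carrier_mat d d" and B: "B \<in> carrier_mat d d" by (auto simp: C_def B_def)
  have row: "(\<Sum>j<d. B $$ (i, j) * x ^ j) \<in> N" if i: "i < d" for i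
  proof -
    have "(\<Sum>j<d. B $$ (i, j) * x ^ j) =
        (\<Sum>j<d. if i = j then y * x ^ j else 0) - (\<Sum>j<d. a ^ (L - l i) * (b i j * x ^ j))"
      unfolding sum_subtractf[symmetric] using i
      by (intro sum.cong) (auto simp: B_def C_def algebra_simps)
    also have "\<dots> = y * x ^ i - a ^ (L - l i) * (\<Sum>j<d. b i j * x ^ j)"
      using i by (simp add: sum_distrib_left)
    also have "y * x ^ i = a ^ (L - l i) * (a ^ l i * poly (q * monom 1 i) x)"
      using lL[OF i] by (simp add: y_def poly_monom mult.assoc[symmetric] power_add[symmetric])
    also have "\<dots> - a ^ (L - l i) * (\<Sum>j<d. b i j * x ^ j) =
        a ^ (L - l i) * (a ^ l i * poly (q * monom 1 i) x - (\<Sum>j<d. b i j * x ^ j))"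
      by (simp add: right_diff_distrib)
    also have "\<dots> \<in> N" by (intro mult_in) (use lb[of i] in \<open>simp add: d_def\<close>)
    finally show ?thesis .
  qed
  \<comment> \<open>\<open>B\<close> annihilates the vector of powers of \<open>x\<close> modulo
    \<open>N\<close>, hence so does \<open>adj_mat B * B\<close>, which is \<open>det B\<close>
    times the identity. The entry at index 0 of that vector is \<open>x ^ 0 = 1\<close>, so row 0
    isolates \<open>det B\<close>.\<close>
  have "det B = (\<Sum>j<d. (adj_mat B * B) $$ (0, j) * x ^ j)"
    using adj_mat(3)[OF B] by (simp add: d_def sum.lessThan_Suc_shift del: sum.lessThan_Suc)
  also have "\<dots> = (\<Sum>j<d. (\<Sum>k<d. adj_mat B $$ (0, k) * B $$ (k, j)) * x ^ j)"
    using adj_mat(1)[OF B] B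
    by (intro sum.cong) (auto simp: scalar_prod_def d_def atLeast0LessThan)
  also have "\<dots> = (\<Sum>k<d. adj_mat B $$ (0, k) * (\<Sum>j<d. B $$ (k, j) * x ^ j))"
    unfolding sum_distrib_right sum_distrib_left
    by (subst sum.swap) (simp add: mult.assoc)
  also have "\<dots> \<in> N" by (intro sum_in mult_in row) auto
  finally have "det B \<in> N" .
  moreover have "poly (char_poly C) y = det B"
    unfolding char_poly_def
    by (rule poly_det_cong[OF B]) (use C in \<open>auto simp: char_poly_matrix_def B_def\<close>)
  moreover have "char_poly C \<in> polys_over R"
    unfolding char_poly_def
  proof (rule P.det_closed[of _ d])
    show "char_poly_matrix C \<in> carrier_mat d d" using C by simp
    fix i j assume ij: "i < d" "j < d"
    have "a ^ (L - l i) * b i j \<in> R" using a b by simp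
    then show "char_poly_matrix C $$ (i, j) \<in> polys_over R"
      using ij C by (auto simp: char_poly_matrix_def C_def polys_over_def coeff_pCons split: nat.split)
  qed
  ultimately show ?thesis
    using degree_monic_char_poly[OF C] unfolding y_def by metis
qed

lemma algebraic_mod_relation:
  assumes R: "subring_set R" and "algebraic_mod R x"
  obtains a c e where "a \<in> R" "a \<notin> N" "\<And>i. c i \<in> R"
    "a * x ^ Suc e - (\<Sum>i<Suc e. c i * x ^ i) \<in> N"
proof -
  interpret subring_set R by fact
  obtain q i where q: "q \<in> polys_over R" "poly q x \<in> N" "coeff q i \<notin> N"
    using assms(2) by (auto simp: algebraic_mod_def)
  obtain q' where q': "q' \<in> polys_over R" "lead_coeff q' \<notin> N" "poly q x - poly q' x \<in> N"
    using truncate_poly[OF R q(1,3)] by blast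
  have 0: "poly q' x \<in> N" using q(2) q'(3) cong_in by blast
  \<comment> \<open>A constant would have its leading coefficient, which is outside
    \<open>N\<close>, as its value.\<close>
  then have "degree q' \<noteq> 0"
    using q'(2) by (metis coeff_pCons_0 degree_eq_zeroE poly_const_conv)
  then obtain e where e: "degree q' = Suc e" by (cases "degree q'") auto
  show thesis
  proof (rule that[of "lead_coeff q'" "\<lambda>i. - coeff q' i" e])
    have "lead_coeff q' * x ^ Suc e - (\<Sum>i<Suc e. - coeff q' i * x ^ i) = poly q' x"
      unfolding poly_altdef e by (simp add: sum_negf lessThan_Suc_atMost[symmetric])
    then show "lead_coeff q' * x ^ Suc e - (\<Sum>i<Suc e. - coeff q' i * x ^ i) \<in> N"
      using 0 by simp
  qed (use q' in \<open>auto simp: polys_over_def\<close>)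
qed

text \<open>After inverting \<open>a\<close>, the leading coefficient of a relation for
  \<open>x\<close>, the ring \<open>R[x]\<close> is integral over \<open>R\<close>; inverting a
  multiple \<open>b\<close> of \<open>S(x)\<close> in \<open>R\<close> inverts \<open>S(x)\<close>
  too. An inverse of an element of \<open>R\<close> that is integral over the localization of
  \<open>R\<close> at \<open>a b\<close> already lies in that localization. So \<open>a * b\<close>
  is the required element of \<open>R\<close>.\<close>

lemma goldman_descent:
  assumes R: "subring_set R" and g: "goldman ((\<lambda>q. poly q x) ` polys_over R)"
  shows "goldman R"
proof -
  interpret subring_set R by fact
  interpret P: subring_set "polys_over R" by (rule subring_polys_over)
  obtain a c e where a: "a \<in> R" "a \<notin> N" and c: "\<And>i. c i \<in> R"
    and rel: "a * x ^ Suc e - (\<Sum>i<Suc e. c i * x ^ i) \<in> N"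
    using algebraic_mod_relation[OF R goldman_imp_algebraic[OF R g]] by metis
  note int = integral_multiple[OF R a(1) c rel]
  have aP: "[:a:] \<in> polys_over R" using a(1) by simp
  obtain S where S: "S \<in> polys_over R" "poly S x \<notin> N"
    and inv: "\<And>q. q \<in> polys_over R \<Longrightarrow> poly q x \<notin> N \<Longrightarrow>
      \<exists>q'\<in>polys_over R. \<exists>j. poly q x * poly q' x - poly S x ^ j \<in> N"
    using g by (auto simp: goldman_def)
  text \<open>A nonzero multiple \<open>b\<close> of \<open>S(x)\<close> that lies in \<open>R\<close> is the lowest nonzero coefficient of an
    integral relation.\<close>
  obtain b Y where b: "b \<in> R" "b \<notin> N" and Y: "Y \<in> polys_over R" "poly S x * poly Y x - b \<in> N"
  proof -
    obtain L \<chi> where \<chi>: "\<chi> \<in> polys_over R" "monic \<chi>" "poly \<chi> (a ^ L * poly S x) \<in> N"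
      using int[OF S(1)] by auto
    have aS: "a ^ L * poly S x \<notin> N"
      using power_notin[OF a(2)] S(2) prime_in by blast
    have "\<exists>b\<in>R. b \<notin> N \<and> (\<exists>q\<in>polys_over R. b + a ^ L * poly S x * poly q (a ^ L * poly S x) \<in> N)"
      using \<chi>
    proof (induction \<chi>)
      case 0
      then have "(1::'b) = 0" by simp
      then show ?case by simp
    next
      case (pCons c0 q)
      have q: "c0 \<in> R" "q \<in> polys_over R"
        using pCons.prems by (auto simp: polys_over_def coeff_pCons split: nat.splits)
      show ?case
      proof (cases "c0 \<in> N")
        case False
        then show ?thesis using q pCons.prems by auto
      next
        case True
        then have "a ^ L * poly S x * poly q (a ^ L * poly S x) \<in> N"
          using pCons.prems(3) diff_in[OF pCons.prems(3) True] by simp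
        then have "poly q (a ^ L * poly S x) \<in> N" using prime_in aS by blast
        moreover have "q \<noteq> 0" using pCons.prems True one_notin by (auto split: if_splits)
        ultimately show ?thesis using pCons.IH q pCons.prems by auto
      qed
    qed
    then obtain b q where bq: "b \<in> R" "b \<notin> N" "q \<in> polys_over R"
      "b + a ^ L * poly S x * poly q (a ^ L * poly S x) \<in> N" by auto
    \<comment> \<open>The cofactor of \<open>S(x)\<close> has to be the value at \<open>x\<close> of
      a polynomial over \<open>R\<close>, hence the formal substitution into
      \<open>q\<close>.\<close>
    let ?T = "[:a:] ^ L * S"
    have pc: "pcompose q ?T \<in> polys_over R"
      using bq(3)
    proof (induction q)
      case (pCons c0 q)
      have "c0 \<in> R" "q \<in> polys_over R"
        using pCons.prems by (auto simp: polys_over_def coeff_pCons split: nat.splits)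
      then show ?case using pCons.IH aP S(1) by (auto simp: pcompose_pCons simp del: mult_pCons_left)
    qed auto
    show thesis
    proof (rule that[OF bq(1,2)])
      show "- ([:a:] ^ L * pcompose q ?T) \<in> polys_over R" using pc aP by auto
      have "poly S x * poly (- ([:a:] ^ L * pcompose q ?T)) x - b =
          - (b + a ^ L * poly S x * poly q (a ^ L * poly S x))"
        by (simp add: poly_pcompose poly_power algebra_simps)
      then show "poly S x * poly (- ([:a:] ^ L * pcompose q ?T)) x - b \<in> N"
        using uminus_in[OF bq(4)] by (simp only:)
    qed
  qed
  have "\<exists>r'\<in>R. \<exists>j. r * r' - (a * b) ^ j \<in> N" if r: "r \<in> R" "r \<notin> N" for r
  proof -
    obtain Q j where Q: "Q \<in> polys_over R" "r * poly Q x - poly S x ^ j \<in> N"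
      using inv[of "[:r:]"] r by auto
    \<comment> \<open>\<open>z\<close> plays the part of \<open>b ^ j / r\<close>.\<close>
    define z where "z = poly (Q * Y ^ j) x"
    have rz: "r * z - b ^ j \<in> N"
    proof -
      have "r * poly Q x * poly Y x ^ j - poly S x ^ j * poly Y x ^ j \<in> N"
        using mult_in'[OF Q(2), of "poly Y x ^ j"] by (simp add: algebra_simps)
      moreover have "poly S x ^ j * poly Y x ^ j - b ^ j \<in> N"
        using cong_power[OF Y(2), of j] by (simp add: power_mult_distrib)
      ultimately show ?thesis
        unfolding z_def using cong_trans by (fastforce simp: poly_power mult.assoc)
    qed
    obtain L \<chi> where \<chi>: "\<chi> \<in> polys_over R" "monic \<chi>" "poly \<chi> (a ^ L * z) \<in> N"
      using int[of "Q * Y ^ j"] Q(1) Y(1) unfolding z_def by auto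
    \<comment> \<open>Multiplying the integral equation by \<open>r ^ d\<close> turns
      \<open>a ^ L * z\<close> into \<open>r * (a ^ L * z)\<close>, which is congruent to
      \<open>w\<close> in \<open>R\<close>. All terms but the leading one keep a factor
      \<open>r\<close>, so \<open>r\<close> divides \<open>w ^ d\<close> modulo
      \<open>N\<close>.\<close>
    define w d where "w = a ^ L * b ^ j" and "d = degree \<chi>"
    have w: "w \<in> R" using a b by (simp add: w_def)
    have rzw: "r * (a ^ L * z) - w \<in> N"
      using cong_mult_left[OF rz, of "a ^ L"] by (simp add: w_def algebra_simps)
    have "r ^ d * poly \<chi> (a ^ L * z) = (\<Sum>i\<le>d. coeff \<chi> i * r ^ (d - i) * (r * (a ^ L * z)) ^ i)"
      unfolding poly_altdef sum_distrib_left d_def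
    proof (intro sum.cong refl)
      fix i assume "i \<in> {..degree \<chi>}"
      then have "r ^ degree \<chi> = r ^ (degree \<chi> - i) * r ^ i" by (simp add: power_add[symmetric])
      then show "r ^ degree \<chi> * (coeff \<chi> i * (a ^ L * z) ^ i) =
          coeff \<chi> i * r ^ (degree \<chi> - i) * (r * (a ^ L * z)) ^ i"
        by (simp add: power_mult_distrib mult_ac)
    qed
    moreover have "(\<Sum>i\<le>d. coeff \<chi> i * r ^ (d - i) * (r * (a ^ L * z)) ^ i)
        - (\<Sum>i\<le>d. coeff \<chi> i * r ^ (d - i) * w ^ i) \<in> N"
      unfolding sum_subtractf[symmetric]
      by (intro sum_in cong_mult_left cong_power rzw)
    ultimately have "(\<Sum>i\<le>d. coeff \<chi> i * r ^ (d - i) * w ^ i) \<in> N"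
      using mult_in[OF \<chi>(3), of "r ^ d"] cong_in by metis
    also have "(\<Sum>i\<le>d. coeff \<chi> i * r ^ (d - i) * w ^ i) =
        r * (\<Sum>i<d. coeff \<chi> i * r ^ (d - Suc i) * w ^ i) + w ^ d"
      unfolding lessThan_Suc_atMost[symmetric] sum_distrib_left
      using \<chi>(2) by (auto simp: d_def Suc_diff_Suc[symmetric] mult_ac intro!: sum.cong)
    finally have rel': "r * (\<Sum>i<d. coeff \<chi> i * r ^ (d - Suc i) * w ^ i) + w ^ d \<in> N" .
    define r' where "r' = - (\<Sum>i<d. coeff \<chi> i * r ^ (d - Suc i) * w ^ i)"
    have r'R: "r' \<in> R"
      using \<chi>(1) r(1) w unfolding r'_def by (auto simp: polys_over_def)
    have "r * r' - w ^ d \<in> N" using uminus_in[OF rel'] by (simp add: r'_def)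
    \<comment> \<open>\<open>w ^ d\<close> is \<open>a ^ (L * d) * b ^ (j * d)\<close>; the extra
      factor equalizes the two exponents, so that a power of \<open>a * b\<close> appears.\<close>
    then have "r * r' * (a ^ (j * d) * b ^ (L * d)) - w ^ d * (a ^ (j * d) * b ^ (L * d)) \<in> N"
      using mult_in' by (simp add: left_diff_distrib[symmetric])
    also have "w ^ d * (a ^ (j * d) * b ^ (L * d)) = (a * b) ^ ((L + j) * d)"
      by (simp add: w_def power_mult_distrib power_mult[symmetric] power_add distrib_left distrib_right mult_ac)
    finally show ?thesis
      using r'R a b
      by (intro bexI[of _ "r' * (a ^ (j * d) * b ^ (L * d))"] exI[of _ "(L + j) * d"])
         (auto simp: mult_ac)
  qed
  then show ?thesis
    unfolding goldman_def using a b prime_in by (intro bexI[of _ "a * b"]) auto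
qed

text \<open>The whole ring modulo \<open>N\<close> is a field, so it has the Goldman property with
  \<open>s = 1\<close>. Removing the generators in \<open>Z\<close> one at a time, but keeping
  \<open>x\<close>, leaves \<open>R[x]\<close> for \<open>R = ring_gen S\<close>, and there the
  property forces \<open>x\<close> to be algebraic.\<close>

theorem zariski_algebraic:
  assumes max: "\<And>r. r \<notin> N \<Longrightarrow> \<exists>r'. r * r' - 1 \<in> N"
    and fin: "finite Z" and gen: "ring_gen (S \<union> Z) = UNIV" and x: "x \<in> Z"
  shows "algebraic_mod (ring_gen S) x"
proof -
  have "goldman UNIV"
    unfolding goldman_def using max one_notin by (intro bexI[of _ 1]) auto
  have "goldman (ring_gen (S \<union> ({x} \<union> Y)))
      \<Longrightarrow> goldman (ring_gen (insert x S))" if "finite Y" for Y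
    using that
  proof (induction Y rule: finite_induct)
    case (insert y Y)
    then have "goldman (ring_gen (insert y (S \<union> ({x} \<union> Y))))" by simp
    then have "goldman (ring_gen (S \<union> ({x} \<union> Y)))"
      unfolding ring_gen_insert by (rule goldman_descent[OF subring_ring_gen])
    then show ?case by (rule insert.IH)
  qed simp
  from this[of Z] have "goldman (ring_gen (insert x S))"
    using gen x fin \<open>goldman UNIV\<close> by (simp add: insert_absorb)
  then show ?thesis
    unfolding ring_gen_insert by (rule goldman_imp_algebraic[OF subring_ring_gen])
qed

end

section \<open>Evaluation and differentiation of polynomials\<close>

text \<open>The set of variables is a parameter so that one induction rule serves both for the
  polynomials in the first \<open>n\<close> variables and, with \<open>UNIV\<close>, for all
  polynomials.\<close>

definition mpolys :: "nat set \<Rightarrow> 'k::comm_ring_1 mpoly set" where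
  "mpolys V = {p. \<forall>t\<in>Poly_Mapping.keys p. Poly_Mapping.keys t \<subseteq> V}"

definition mvar :: "nat \<Rightarrow> 'k::comm_ring_1 mpoly" where
  "mvar i = Poly_Mapping.single (Poly_Mapping.single i 1) 1"

lemma const_poly_simps [simp]:
  "const_poly 0 = 0" "const_poly 1 = 1"
  "const_poly (a + b) = const_poly a + const_poly b"
  "const_poly (a - b) = const_poly a - const_poly b"
  "const_poly (a * b) = const_poly a * const_poly b"
  by (simp_all add: const_poly_def single_add single_diff mult_single)

lemma single_eq_const_mult:
  "Poly_Mapping.single t (c::'k::comm_ring_1) = const_poly c * Poly_Mapping.single t 1"
  by (simp add: const_poly_def mult_single)

lemma mpoly_expand: "(p::'k::comm_ring_1 mpoly) = (\<Sum>t\<in>Poly_Mapping.keys p. Poly_Mapping.single t (Poly_Mapping.lookup p t))"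
  by (rule poly_mapping_eqI) (auto simp: lookup_sum lookup_single when_def in_keys_iff)

lemma subring_mpolys: "subring_set (mpolys V :: 'k::comm_ring_1 mpoly set)"
proof
  show "1 \<in> (mpolys V :: 'k mpoly set)" by (auto simp: mpolys_def)
  show "p - q \<in> mpolys V" if pq: "p \<in> mpolys V" "q \<in> mpolys V" for p q :: "'k mpoly"
  proof -
    have "t \<in> Poly_Mapping.keys p \<or> t \<in> Poly_Mapping.keys q" if "t \<in> Poly_Mapping.keys (p - q)" for t
      using that by (auto simp: in_keys_iff lookup_minus)
    then show ?thesis using pq unfolding mpolys_def by blast
  qed
  show "p * q \<in> mpolys V" if pq: "p \<in> mpolys V" "q \<in> mpolys V" for p q :: "'k mpoly"
  proof -
    have "Poly_Mapping.keys (s + t) \<subseteq> V"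
      if st: "s \<in> Poly_Mapping.keys p" "t \<in> Poly_Mapping.keys q" for s t
    proof -
      have "Poly_Mapping.keys s \<subseteq> V" "Poly_Mapping.keys t \<subseteq> V"
        using st pq unfolding mpolys_def by blast+
      then show ?thesis using keys_add[of s t] by blast
    qed
    then show ?thesis using keys_mult[of p q] unfolding mpolys_def by blast
  qed
qed

lemma const_poly_mpolys [simp]: "const_poly c \<in> mpolys V"
  by (auto simp: const_poly_def mpolys_def)

lemma mvar_mpolys: "i \<in> V \<Longrightarrow> mvar i \<in> mpolys V"
  by (auto simp: mvar_def mpolys_def)

text \<open>Identities for evaluations and derivations pass to sums and products, so they need
  checking only on constants and variables. The memberships of \<open>p\<close> and \<open>q\<close>
  stay available because the projection to the coordinate ring is a homomorphism only on
  \<open>mpolys {..<n}\<close>.\<close>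

lemma mpoly_induct [consumes 1, case_names const var add mult]:
  fixes p :: "'k::comm_ring_1 mpoly"
  assumes p: "p \<in> mpolys V"
    and c: "\<And>c. P (const_poly c)"
    and v: "\<And>i. i \<in> V \<Longrightarrow> P (mvar i)"
    and a: "\<And>p q. p \<in> mpolys V \<Longrightarrow> q \<in> mpolys V \<Longrightarrow> P p \<Longrightarrow> P q \<Longrightarrow> P (p + q)"
    and m: "\<And>p q. p \<in> mpolys V \<Longrightarrow> q \<in> mpolys V \<Longrightarrow> P p \<Longrightarrow> P q \<Longrightarrow> P (p * q)"
  shows "P p"
proof -
  interpret subring_set "mpolys V :: 'k mpoly set" by (rule subring_mpolys)
  have pow: "P (mvar i ^ k)" if "i \<in> V" for i k
    using that by (induction k) (auto intro!: m v mvar_mpolys power_closed simp del: power_closed simp: c[of 1, simplified])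
  have mon: "Poly_Mapping.keys t \<subseteq> V \<Longrightarrow>
      P (Poly_Mapping.single t 1) \<and> Poly_Mapping.single t (1::'k) \<in> mpolys V" for t
  proof (induction t rule: update_induct)
    case const
    show ?case using c[of 1] by simp
  next
    case (update t i k)
    \<comment> \<open>The variable \<open>i\<close> is new to \<open>t\<close>, so updating its
      exponent is adding a power of it.\<close>
    have "Poly_Mapping.update i k t = t + Poly_Mapping.single i k"
      by (rule poly_mapping_eqI)
         (use update(1) in \<open>auto simp: lookup_update lookup_add lookup_single when_def in_keys_iff\<close>)
    moreover have "mvar i ^ k = Poly_Mapping.single (Poly_Mapping.single i k) (1::'k)"
      by (induction k) (auto simp: mvar_def mult_single single_add[symmetric])
    ultimately have "Poly_Mapping.single (Poly_Mapping.update i k t) (1::'k) =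
        Poly_Mapping.single t 1 * mvar i ^ k" by (simp add: mult_single)
    moreover have "i \<in> V" "Poly_Mapping.keys t \<subseteq> V"
      using update(1,2,4) by (auto simp: keys_update)
    moreover have "mvar i ^ k \<in> (mpolys V :: 'k mpoly set)" if "i \<in> V"
      using that by (intro power_closed mvar_mpolys)
    ultimately show ?case using update.IH pow[of i k] by (auto intro!: m)
  qed
  have "P (\<Sum>t\<in>A. Poly_Mapping.single t (Poly_Mapping.lookup p t)) \<and>
      (\<Sum>t\<in>A. Poly_Mapping.single t (Poly_Mapping.lookup p t)) \<in> mpolys V"
    if "finite A" "A \<subseteq> Poly_Mapping.keys p" for A
    using that
  proof (induction A rule: finite_induct)
    case empty
    then show ?case using c[of 0] by simp
  next
    case (insert t A)
    have "Poly_Mapping.keys t \<subseteq> V" using insert.prems p by (auto simp: mpolys_def)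
    then have "P (Poly_Mapping.single t (Poly_Mapping.lookup p t)) \<and>
        Poly_Mapping.single t (Poly_Mapping.lookup p t) \<in> mpolys V"
      using mon[of t] c[of "Poly_Mapping.lookup p t"]
      by (subst (1 2) single_eq_const_mult) (auto intro!: m)
    then show ?case using insert by (auto intro!: a)
  qed
  from this[of "Poly_Mapping.keys p"] show ?thesis using mpoly_expand[of p] by simp
qed

lemma mpolys_UNIV [simp]: "p \<in> mpolys UNIV"
  by (simp add: mpolys_def)

section \<open>Evaluation homomorphisms\<close>

definition mon_eval :: "(nat \<Rightarrow> 'b::comm_ring_1) \<Rightarrow> (nat \<Rightarrow>\<^sub>0 nat) \<Rightarrow> 'b" where
  "mon_eval \<xi> t = (\<Prod>i\<in>Poly_Mapping.keys t. \<xi> i ^ Poly_Mapping.lookup t i)"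

definition mpoly_eval ::
  "('k::comm_ring_1 \<Rightarrow> 'b::comm_ring_1) \<Rightarrow> (nat \<Rightarrow> 'b) \<Rightarrow> 'k mpoly \<Rightarrow> 'b" where
  "mpoly_eval \<kappa> \<xi> p = (\<Sum>t\<in>Poly_Mapping.keys p. \<kappa> (Poly_Mapping.lookup p t) * mon_eval \<xi> t)"

lemma mon_eval_superset:
  "finite A \<Longrightarrow> Poly_Mapping.keys t \<subseteq> A \<Longrightarrow> mon_eval \<xi> t = (\<Prod>i\<in>A. \<xi> i ^ Poly_Mapping.lookup t i)"
  unfolding mon_eval_def by (rule prod.mono_neutral_left) (auto simp: in_keys_iff)

lemma mon_eval_add: "mon_eval \<xi> (s + t) = mon_eval \<xi> s * mon_eval \<xi> t"
proof -
  let ?A = "Poly_Mapping.keys s \<union> Poly_Mapping.keys t"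
  have "mon_eval \<xi> r = (\<Prod>i\<in>?A. \<xi> i ^ Poly_Mapping.lookup r i)" if "r \<in> {s, t, s + t}" for r
    using that keys_add[of s t] by (intro mon_eval_superset) auto
  then show ?thesis
    by (simp add: lookup_add power_add prod.distrib)
qed

context
  fixes \<kappa> :: "'k::comm_ring_1 \<Rightarrow> 'b::comm_ring_1"
  assumes \<kappa>: "comm_ring_hom \<kappa>"
begin

interpretation \<kappa>: comm_ring_hom \<kappa> by (rule \<kappa>)

lemma mpoly_eval_superset:
  "finite A \<Longrightarrow> Poly_Mapping.keys p \<subseteq> A \<Longrightarrow>
    mpoly_eval \<kappa> \<xi> p = (\<Sum>t\<in>A. \<kappa> (Poly_Mapping.lookup p t) * mon_eval \<xi> t)"
  unfolding mpoly_eval_def by (rule sum.mono_neutral_left) (auto simp: in_keys_iff)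

lemma mpoly_eval_single: "mpoly_eval \<kappa> \<xi> (Poly_Mapping.single t c) = \<kappa> c * mon_eval \<xi> t"
  by (subst mpoly_eval_superset[of "{t}"]) auto

lemma mpoly_eval_const: "mpoly_eval \<kappa> \<xi> (const_poly c) = \<kappa> c"
  by (simp add: const_poly_def mpoly_eval_single mon_eval_def)

lemma mpoly_eval_var: "mpoly_eval \<kappa> \<xi> (mvar i) = \<xi> i"
  by (simp add: mvar_def mpoly_eval_single mon_eval_def)

lemma mpoly_eval_add: "mpoly_eval \<kappa> \<xi> (p + q) = mpoly_eval \<kappa> \<xi> p + mpoly_eval \<kappa> \<xi> q"
proof -
  let ?A = "Poly_Mapping.keys p \<union> Poly_Mapping.keys q"
  have "mpoly_eval \<kappa> \<xi> r = (\<Sum>t\<in>?A. \<kappa> (Poly_Mapping.lookup r t) * mon_eval \<xi> t)"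
    if "r \<in> {p, q, p + q}" for r
    using that keys_add[of p q] by (intro mpoly_eval_superset) auto
  then show ?thesis
    by (simp add: lookup_add \<kappa>.hom_add distrib_right sum.distrib)
qed

lemma mpoly_eval_sum: "mpoly_eval \<kappa> \<xi> (\<Sum>i\<in>A. g i) = (\<Sum>i\<in>A. mpoly_eval \<kappa> \<xi> (g i))"
  by (induction A rule: infinite_finite_induct)
     (auto simp: mpoly_eval_add mpoly_eval_const[of _ 0, simplified])

lemma mpoly_eval_mult: "mpoly_eval \<kappa> \<xi> (p * q) = mpoly_eval \<kappa> \<xi> p * mpoly_eval \<kappa> \<xi> q"
  by (subst mpoly_expand[of p], subst mpoly_expand[of q], subst sum_product)
     (simp add: mpoly_eval_sum mult_single mpoly_eval_single mon_eval_add \<kappa>.hom_mult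
       mpoly_eval_def[of \<kappa> \<xi> p] mpoly_eval_def[of \<kappa> \<xi> q] sum_product mult_ac)

lemma comm_ring_hom_mpoly_eval: "comm_ring_hom (mpoly_eval \<kappa> \<xi>)"
  by unfold_locales
     (auto simp: mpoly_eval_add mpoly_eval_mult mpoly_eval_const[of _ 0, simplified]
       mpoly_eval_const[of _ 1, simplified])

end

section \<open>Formal partial derivatives\<close>

lemma partial_deriv_superset:
  "finite A \<Longrightarrow> Poly_Mapping.keys p \<subseteq> A \<Longrightarrow> partial_deriv j p = (\<Sum>t\<in>A.
     Poly_Mapping.single (t - Poly_Mapping.single j 1)
       (of_nat (Poly_Mapping.lookup t j) * Poly_Mapping.lookup p t))"
  unfolding partial_deriv_def by (rule sum.mono_neutral_left) (auto simp: in_keys_iff)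

lemma partial_deriv_single: "partial_deriv j (Poly_Mapping.single t c) =
   Poly_Mapping.single (t - Poly_Mapping.single j 1) (of_nat (Poly_Mapping.lookup t j) * c)"
  by (subst partial_deriv_superset[of "{t}"]) auto

lemma partial_deriv_const: "partial_deriv j (const_poly c) = 0"
  by (simp add: const_poly_def partial_deriv_single)

lemma partial_deriv_var: "partial_deriv j (mvar i) = (if i = j then 1 else 0)"
  by (auto simp: mvar_def partial_deriv_single lookup_single when_def)

lemma partial_deriv_add: "partial_deriv j (p + q) = partial_deriv j p + partial_deriv j q"
proof -
  let ?A = "Poly_Mapping.keys p \<union> Poly_Mapping.keys q"
  have "partial_deriv j r = (\<Sum>t\<in>?A. Poly_Mapping.single (t - Poly_Mapping.single j 1)
       (of_nat (Poly_Mapping.lookup t j) * Poly_Mapping.lookup r t))"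
    if "r \<in> {p, q, p + q}" for r
    using that keys_add[of p q] by (intro partial_deriv_superset) auto
  then show ?thesis
    by (simp add: lookup_add distrib_left single_add sum.distrib)
qed

lemma partial_deriv_sum: "partial_deriv j (\<Sum>i\<in>A. g i) = (\<Sum>i\<in>A. partial_deriv j (g i))"
  by (induction A rule: infinite_finite_induct)
     (auto simp: partial_deriv_add partial_deriv_const[of _ 0, simplified])

lemma partial_deriv_mult:
  "partial_deriv j (p * q) = p * partial_deriv j q + q * partial_deriv j p"
proof -
  let ?e = "Poly_Mapping.single j (1::nat)"
  \<comment> \<open>Truncated subtraction of exponents commutes with addition only if the
    \<open>j\<close>-th exponent of \<open>t\<close> is positive; otherwise the coefficient is 0 and
    both sides vanish.\<close>
  have shift: "Poly_Mapping.single (s + t - ?e) (of_nat (Poly_Mapping.lookup t j) * c) =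
      Poly_Mapping.single (s + (t - ?e)) (of_nat (Poly_Mapping.lookup t j) * c)" for s t and c :: 'a
  proof (cases "Poly_Mapping.lookup t j = 0")
    case False
    have "s + t - ?e = s + (t - ?e)"
      by (rule poly_mapping_eqI)
         (use False in \<open>auto simp: lookup_minus lookup_add lookup_single when_def\<close>)
    then show ?thesis by simp
  qed simp
  have single: "partial_deriv j (Poly_Mapping.single s a * Poly_Mapping.single t b) =
      Poly_Mapping.single s a * partial_deriv j (Poly_Mapping.single t b) +
      Poly_Mapping.single t b * partial_deriv j (Poly_Mapping.single s a)" for s t and a b :: 'a
    using shift[of s t "a * b"] shift[of t s "a * b"]
    by (simp add: partial_deriv_single mult_single lookup_add distrib_right distrib_left single_add mult_ac
        add.commute[of t s])
  let ?sp = "\<lambda>s. Poly_Mapping.single s (Poly_Mapping.lookup p s)"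
  let ?sq = "\<lambda>t. Poly_Mapping.single t (Poly_Mapping.lookup q t)"
  have "partial_deriv j (p * q) =
      (\<Sum>s\<in>Poly_Mapping.keys p. \<Sum>t\<in>Poly_Mapping.keys q. partial_deriv j (?sp s * ?sq t))"
    by (subst mpoly_expand[of p], subst mpoly_expand[of q]) (simp add: sum_product partial_deriv_sum)
  also have "\<dots> = (\<Sum>s\<in>Poly_Mapping.keys p. ?sp s) * (\<Sum>t\<in>Poly_Mapping.keys q. partial_deriv j (?sq t))
      + (\<Sum>t\<in>Poly_Mapping.keys q. ?sq t) * (\<Sum>s\<in>Poly_Mapping.keys p. partial_deriv j (?sp s))"
    unfolding single sum.distrib sum_product
    by (subst (3) sum.swap) simp
  also have "\<dots> = p * partial_deriv j q + q * partial_deriv j p"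
    unfolding partial_deriv_sum[symmetric] mpoly_expand[symmetric] ..
  finally show ?thesis .
qed

lemma partial_deriv_mpolys: "p \<in> mpolys V \<Longrightarrow> partial_deriv j p \<in> mpolys V"
proof (induction p rule: mpoly_induct)
  interpret subring_set "mpolys V" by (rule subring_mpolys)
  {
    case (const c)
    then show ?case by (simp add: partial_deriv_const)
  next
    case (var i)
    then show ?case by (simp add: partial_deriv_var)
  next
    case (add p q)
    then show ?case by (simp add: partial_deriv_add)
  next
    case (mult p q)
    then show ?case by (simp add: partial_deriv_mult)
  }
qed

section \<open>Derivations modulo a submodule\<close>

text \<open>\<open>D\<close> represents a derivation into the quotient by \<open>N\<close>, on which
  \<open>L\<close> acts through \<open>e\<close>. With \<open>e\<close> the identity on the local
  ring, \<open>N\<close> may be \<open>{0}\<close> or the maximal ideal; with \<open>e\<close> the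
  evaluation of polynomials, the locale also covers the derivations of the polynomial ring from
  which those of the coordinate ring are built.\<close>

locale der_mod = subring_set L
  for L :: "'c::comm_ring_1 set" +
  fixes e :: "'c \<Rightarrow> 'b::comm_ring_1" and N :: "'b set" and D :: "'c \<Rightarrow> 'b"
  assumes e_one: "e 1 = 1"
    and e_add: "\<And>x y. x \<in> L \<Longrightarrow> y \<in> L \<Longrightarrow> e (x + y) = e x + e y"
    and e_mult: "\<And>x y. x \<in> L \<Longrightarrow> y \<in> L \<Longrightarrow> e (x * y) = e x * e y"
    and N_zero: "0 \<in> N"
    and N_add: "\<And>x y. x \<in> N \<Longrightarrow> y \<in> N \<Longrightarrow> x + y \<in> N"
    and N_mult: "\<And>x y. x \<in> L \<Longrightarrow> y \<in> N \<Longrightarrow> e x * y \<in> N"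
    and D_add: "\<And>x y. x \<in> L \<Longrightarrow> y \<in> L \<Longrightarrow> D (x + y) - (D x + D y) \<in> N"
    and D_mult: "\<And>x y. x \<in> L \<Longrightarrow> y \<in> L \<Longrightarrow> D (x * y) - (e x * D y + e y * D x) \<in> N"
begin

lemma N_uminus: "x \<in> N \<Longrightarrow> - x \<in> N"
proof -
  have "e (- 1) + 1 = e 0" "e 0 + e 0 = e 0"
    using e_add[of "- 1" 1] e_add[of 0 0] e_one by auto
  then have "e (- 1) = - 1" by (simp add: add_eq_0_iff2)
  then show "x \<in> N \<Longrightarrow> - x \<in> N" using N_mult[of "- 1" x] by simp
qed

text \<open>The chain rule in one variable. Applied to \<mu>_j it ties the value of \<open>D\<close>
  at a coordinate to its value at an element of the maximal ideal.\<close>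

lemma D_poly:
  fixes \<kappa> :: "'k::field \<Rightarrow> 'c"
  assumes \<kappa>: "comm_ring_hom \<kappa>" and \<kappa>L: "\<And>c. \<kappa> c \<in> L" and \<kappa>D: "\<And>c. D (\<kappa> c) \<in> N" and x: "x \<in> L"
  shows "D (poly (map_poly \<kappa> q) x) - e (poly (map_poly \<kappa> (pderiv q)) x) * D x \<in> N"
proof (induction q)
  interpret \<kappa>: comm_ring_hom \<kappa> by (rule \<kappa>)
  case 0
  have "D 0 \<in> N" using \<kappa>D[of 0] by (simp add: \<kappa>.hom_zero)
  moreover have "e 0 = 0" using e_add[of 0 0] by simp
  ultimately show ?case by (simp add: \<kappa>.hom_zero)
next
  interpret \<kappa>: comm_ring_hom \<kappa> by (rule \<kappa>)
  interpret map: map_poly_comm_ring_hom \<kappa> ..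
  case (pCons a q)
  have PL: "poly (map_poly \<kappa> p) x \<in> L" for p
    by (rule poly_closed[OF _ x]) (auto simp: polys_over_def coeff_map_poly \<kappa>L)
  have e: "e (poly (map_poly \<kappa> (pderiv (pCons a q))) x) =
      e (poly (map_poly \<kappa> q) x) + e x * e (poly (map_poly \<kappa> (pderiv q)) x)"
    using PL x by (simp add: pderiv_pCons map.hom_add \<kappa>.map_poly_pCons_hom e_add e_mult \<kappa>.hom_zero)
  let ?p = "poly (map_poly \<kappa> q) x"
  have "D (poly (map_poly \<kappa> (pCons a q)) x) - e (poly (map_poly \<kappa> (pderiv (pCons a q))) x) * D x =
      (D (\<kappa> a + x * ?p) - (D (\<kappa> a) + D (x * ?p))) + D (\<kappa> a)
      + (D (x * ?p) - (e x * D ?p + e ?p * D x))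
      + e x * (D ?p - e (poly (map_poly \<kappa> (pderiv q)) x) * D x)"
    unfolding e by (simp add: \<kappa>.map_poly_pCons_hom algebra_simps)
  also have "\<dots> \<in> N"
    by (intro N_add D_add D_mult N_mult pCons.IH) (use \<kappa>L \<kappa>D x PL in auto)
  finally show ?case .
qed

lemma D_mpoly_eval:
  assumes \<kappa>: "comm_ring_hom \<kappa>" and \<kappa>L: "\<And>c. \<kappa> c \<in> L" and \<kappa>D: "\<And>c. D (\<kappa> c) \<in> N"
    and \<xi>: "\<And>i. i < n \<Longrightarrow> \<xi> i \<in> L" and g: "g \<in> mpolys {..<n}"
  shows "D (mpoly_eval \<kappa> \<xi> g) - (\<Sum>j<n. e (mpoly_eval \<kappa> \<xi> (partial_deriv j g)) * D (\<xi> j)) \<in> N"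
proof -
  interpret \<kappa>: comm_ring_hom \<kappa> by (rule \<kappa>)
  note ev = mpoly_eval_const[OF \<kappa>] mpoly_eval_var[OF \<kappa>] mpoly_eval_add[OF \<kappa>] mpoly_eval_mult[OF \<kappa>]
  have evL: "mpoly_eval \<kappa> \<xi> g \<in> L" if "g \<in> mpolys {..<n}" for g
    using that by (induction g rule: mpoly_induct) (auto simp: ev \<kappa>L \<xi>)
  have e0: "e 0 = 0" using e_add[of 0 0] by simp
  have ev0: "mpoly_eval \<kappa> \<xi> 0 = 0" "mpoly_eval \<kappa> \<xi> 1 = 1"
    using ev(1)[of _ 0] ev(1)[of _ 1] by (simp_all add: \<kappa>.hom_zero \<kappa>.hom_one)
  let ?S = "\<lambda>g. \<Sum>j<n. e (mpoly_eval \<kappa> \<xi> (partial_deriv j g)) * D (\<xi> j)"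
  show ?thesis
    using g
  proof (induction g rule: mpoly_induct)
    case (const c)
    then show ?case by (simp add: ev partial_deriv_const ev0 e0 \<kappa>D)
  next
    case (var i)
    then have "?S (mvar i) = (\<Sum>j<n. if i = j then D (\<xi> j) else 0)"
      by (intro sum.cong) (auto simp: partial_deriv_var ev0 e0 e_one)
    then show ?case using var by (simp add: ev N_zero)
  next
    case (add p q)
    have S: "?S (p + q) = ?S p + ?S q"
      using add(1,2) unfolding sum.distrib[symmetric]
      by (intro sum.cong)
         (auto simp: partial_deriv_add ev e_add evL partial_deriv_mpolys distrib_right)
    have "D (mpoly_eval \<kappa> \<xi> (p + q)) - ?S (p + q) =
        (D (mpoly_eval \<kappa> \<xi> p + mpoly_eval \<kappa> \<xi> q) - (D (mpoly_eval \<kappa> \<xi> p) + D (mpoly_eval \<kappa> \<xi> q)))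
        + (D (mpoly_eval \<kappa> \<xi> p) - ?S p) + (D (mpoly_eval \<kappa> \<xi> q) - ?S q)"
      unfolding S by (simp add: ev algebra_simps)
    also have "\<dots> \<in> N" by (intro N_add D_add add.IH evL add(1,2))
    finally show ?case .
  next
    case (mult p q)
    let ?p = "mpoly_eval \<kappa> \<xi> p" and ?q = "mpoly_eval \<kappa> \<xi> q"
    have S: "?S (p * q) = e ?p * ?S q + e ?q * ?S p"
      using mult(1,2) unfolding sum_distrib_left sum.distrib[symmetric]
      by (intro sum.cong)
         (auto simp: partial_deriv_mult ev e_add e_mult evL partial_deriv_mpolys distrib_right mult.assoc)
    have "D (mpoly_eval \<kappa> \<xi> (p * q)) - ?S (p * q) =
        (D (?p * ?q) - (e ?p * D ?q + e ?q * D ?p)) + e ?p * (D ?q - ?S q) + e ?q * (D ?p - ?S p)"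
      unfolding S by (simp add: ev algebra_simps)
    also have "\<dots> \<in> N" by (intro N_add D_mult N_mult mult.IH evL mult(1,2))
    finally show ?case .
  qed
qed

end

section \<open>Separable equations and idempotence\<close>

lemma diff_dvd_poly_diff: "(u - v) dvd (poly p u - poly p v)" for u v :: "'b::comm_ring_1"
proof (induction p)
  case (pCons a p)
  have "poly (pCons a p) u - poly (pCons a p) v = u * (poly p u - poly p v) + (u - v) * poly p v"
    by (simp add: algebra_simps)
  then show ?case using pCons.IH by (metis dvd_add dvd_mult dvd_triv_left)
qed simp

lemma diff_dvd_prod_diff:
  "(u - v) dvd ((\<Prod>a\<in>S. u - c a) - (\<Prod>a\<in>S. v - c a))" for u v :: "'b::comm_ring_1"
  using diff_dvd_poly_diff[of u v "\<Prod>a\<in>S. [:- c a, 1:]"] by (simp add: poly_prod)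

section \<open>Roots of products of distinct linear factors modulo an ideal\<close>

context ideal_set
begin

text \<open>The roots are distinct because \<open>S\<close> is a set: over a field, multiplication
  by \<open>g\<close> on the quotient is diagonalizable, with eigenvalues in
  \<open>S\<close>.\<close>

definition split_mod :: "('k \<Rightarrow> 'b) \<Rightarrow> 'b \<Rightarrow> bool" where
  "split_mod \<kappa> g \<longleftrightarrow> (\<exists>S. finite S \<and> (\<Prod>a\<in>S. g - \<kappa> a) \<in> N)"

context
  fixes \<kappa> :: "'k::field \<Rightarrow> 'b"
  assumes \<kappa>: "comm_ring_hom \<kappa>"
begin

interpretation \<kappa>: comm_ring_hom \<kappa> by (rule \<kappa>)

lemma cancel_unit: "c \<noteq> 0 \<Longrightarrow> \<kappa> c * z \<in> N \<Longrightarrow> z \<in> N"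
  using mult_in[of "\<kappa> c * z" "\<kappa> (inverse c)"]
  by (simp add: mult.assoc[symmetric] \<kappa>.hom_mult[symmetric])

text \<open>The factors are pairwise coprime, since their differences are images of nonzero
  constants and hence units. So divisibility by each of them modulo \<open>N\<close> gives
  divisibility by their product.\<close>

lemma chinese_remainder_split:
  assumes "finite S" "\<And>a. a \<in> S \<Longrightarrow> \<exists>y. z - y * (g - \<kappa> a) \<in> N"
  shows "\<exists>y. z - y * (\<Prod>a\<in>S. g - \<kappa> a) \<in> N"
  using assms
proof (induction S rule: finite_induct)
  case empty
  then show ?case by (intro exI[of _ z]) simp
next
  case (insert b S)
  let ?P = "\<lambda>x. \<Prod>a\<in>S. x - \<kappa> a"
  obtain y where y: "z - y * ?P g \<in> N" using insert by auto
  obtain w where w: "z - w * (g - \<kappa> b) \<in> N" using insert.prems by auto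
  obtain k where k: "?P g - ?P (\<kappa> b) = (g - \<kappa> b) * k"
    using diff_dvd_prod_diff[of g "\<kappa> b" \<kappa> S] by (auto elim: dvdE)
  \<comment> \<open>\<open>u\<close> is the value of the product over \<open>S\<close> at
    \<open>b\<close>, which is nonzero because \<open>b\<close> is not in \<open>S\<close>.\<close>
  define u where "u = (\<Prod>a\<in>S. b - a)"
  have u: "u \<noteq> 0" "\<kappa> u = ?P (\<kappa> b)"
    using insert.hyps by (auto simp: u_def \<kappa>.hom_prod \<kappa>.hom_minus)
  \<comment> \<open>From \<open>?P g = \<kappa> u + (g - \<kappa> b) * k\<close> and the two
    expressions for \<open>z\<close> one gets \<open>\<kappa> u * y\<close> congruent to
    \<open>(w - y * k) * (g - \<kappa> b)\<close>. Dividing by the unit \<open>\<kappa> u\<close>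
    shows that \<open>y\<close> is divisible by the new factor.\<close>
  define y' where "y' = \<kappa> (inverse u) * (w - y * k)"
  have "\<kappa> u * y' = w - y * k"
    using u(1) by (simp add: y'_def mult.assoc[symmetric] \<kappa>.hom_mult[symmetric])
  have "\<kappa> u * (y - y' * (g - \<kappa> b)) = y * ?P (\<kappa> b) - (w - y * k) * (g - \<kappa> b)"
  proof -
    have "\<kappa> u * (y - y' * (g - \<kappa> b)) = y * \<kappa> u - (\<kappa> u * y') * (g - \<kappa> b)"
      by (simp add: algebra_simps)
    then show ?thesis unfolding \<open>\<kappa> u * y' = w - y * k\<close> by (simp only: u(2))
  qed
  also have "\<dots> = y * (?P (\<kappa> b) + (g - \<kappa> b) * k) - w * (g - \<kappa> b)"
    by (simp add: algebra_simps)
  also have "?P (\<kappa> b) + (g - \<kappa> b) * k = ?P g" using k by (simp add: algebra_simps)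
  also have "y * ?P g - w * (g - \<kappa> b) = (z - w * (g - \<kappa> b)) - (z - y * ?P g)" by simp
  also have "\<dots> \<in> N" by (rule diff_in[OF w y])
  finally have "y - y' * (g - \<kappa> b) \<in> N" using cancel_unit u(1) by blast
  then have "(y - y' * (g - \<kappa> b)) * ?P g \<in> N" by (rule mult_in')
  then have "z - y' * ((g - \<kappa> b) * ?P g) \<in> N"
    using add_in[OF y] by (fastforce simp: algebra_simps)
  then show ?case using insert.hyps by auto
qed

lemma split_mod_const: "split_mod \<kappa> (\<kappa> c)"
  unfolding split_mod_def by (intro exI[of _ "{c}"]) auto

text \<open>A candidate equation for \<open>x\<close> may be tested on each eigenspace of
  \<open>g\<close> separately, that is, modulo \<open>g - \<kappa> a\<close> for each root
  \<open>a\<close>; the Chinese remainder theorem glues the results.\<close>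

lemma split_modI:
  assumes "finite S" "(\<Prod>a\<in>S. g - \<kappa> a) \<in> N"
    and "finite U" "\<And>a. a \<in> S \<Longrightarrow> \<exists>z'. (g - \<kappa> a) dvd ((\<Prod>c\<in>U. x - \<kappa> c) - z') \<and> z' \<in> N"
  shows "split_mod \<kappa> x"
proof -
  let ?z = "\<Prod>c\<in>U. x - \<kappa> c"
  have "\<exists>y. ?z - y * (g - \<kappa> a) \<in> N" if a: "a \<in> S" for a
  proof -
    obtain z' k where k: "?z - z' = (g - \<kappa> a) * k" "z' \<in> N"
      using assms(4)[OF a] by (auto elim: dvdE)
    then have "?z - k * (g - \<kappa> a) = z'" by (simp add: algebra_simps)
    then show ?thesis using k(2) by (intro exI[of _ k]) simp
  qed
  then obtain y where "?z - y * (\<Prod>a\<in>S. g - \<kappa> a) \<in> N"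
    using chinese_remainder_split[OF assms(1)] by blast
  then have "?z \<in> N" using add_in mult_in[OF assms(2), of y] by fastforce
  then show ?thesis using assms(3) by (auto simp: split_mod_def)
qed

lemma prod_superset_in:
  assumes "finite U" "V \<subseteq> U" "prod f V \<in> N"
  shows "prod f U \<in> N"
  using prod.subset_diff[OF assms(2,1), of f] mult_in[OF assms(3)] by simp

lemma split_mod_add:
  assumes "split_mod \<kappa> g" "split_mod \<kappa> h"
  shows "split_mod \<kappa> (g + h)"
proof -
  obtain S T where S: "finite S" "(\<Prod>a\<in>S. g - \<kappa> a) \<in> N" and T: "finite T" "(\<Prod>b\<in>T. h - \<kappa> b) \<in> N"
    using assms by (auto simp: split_mod_def)
  let ?U = "(\<lambda>(a, b). a + b) ` (S \<times> T)"
  show ?thesis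
  proof (rule split_modI[OF S])
    show "finite ?U" using S T by auto
    then have "finite ?U" .
    fix a assume a: "a \<in> S"
    \<comment> \<open>Modulo \<open>g - \<kappa> a\<close> the sum becomes
      \<open>\<kappa> a + h\<close>, whose roots are those of \<open>h\<close> translated by
      \<open>a\<close>.\<close>
    have sub: "(+) a ` T \<subseteq> ?U" using a by force
    have "(\<Prod>c\<in>(+) a ` T. (\<kappa> a + h) - \<kappa> c) = (\<Prod>b\<in>T. h - \<kappa> b)"
      by (subst prod.reindex) (auto simp: \<kappa>.hom_add)
    then have "(\<Prod>c\<in>?U. (\<kappa> a + h) - \<kappa> c) \<in> N"
      using T(2) by (intro prod_superset_in[OF \<open>finite ?U\<close> sub]) (simp only:)
    moreover have "g - \<kappa> a dvd (\<Prod>c\<in>?U. g + h - \<kappa> c) - (\<Prod>c\<in>?U. (\<kappa> a + h) - \<kappa> c)"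
      using diff_dvd_prod_diff[of "g + h" "\<kappa> a + h" \<kappa> ?U] by simp
    ultimately show "\<exists>z'. g - \<kappa> a dvd (\<Prod>c\<in>?U. g + h - \<kappa> c) - z' \<and> z' \<in> N" by blast
  qed
qed

lemma split_mod_mult:
  assumes "split_mod \<kappa> g" "split_mod \<kappa> h"
  shows "split_mod \<kappa> (g * h)"
proof -
  obtain S T where S: "finite S" "(\<Prod>a\<in>S. g - \<kappa> a) \<in> N" and T: "finite T" "(\<Prod>b\<in>T. h - \<kappa> b) \<in> N"
    using assms by (auto simp: split_mod_def)
  let ?U = "(\<lambda>(a, b). a * b) ` (S \<times> T)"
  show ?thesis
  proof (rule split_modI[OF S])
    show "finite ?U" using S T by auto
    then have "finite ?U" .
    fix a assume a: "a \<in> S"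
    have sub: "(*) a ` T \<subseteq> ?U" using a by force
    have "(\<Prod>c\<in>(*) a ` T. \<kappa> a * h - \<kappa> c) \<in> N"
    \<comment> \<open>For \<open>a = 0\<close> scaling is not injective: the roots collapse to 0,
      where the single factor is 0. If \<open>T\<close> is empty, then 1 lies in \<open>N\<close> by
      the assumption on \<open>h\<close>.\<close>
    proof (cases "a = 0")
      case True
      then show ?thesis
        using T(2) by (cases "T = {}") (auto simp: \<kappa>.hom_zero image_constant_conv)
    next
      case False
      have "(\<Prod>c\<in>(*) a ` T. \<kappa> a * h - \<kappa> c) = (\<Prod>b\<in>T. \<kappa> a * (h - \<kappa> b))"
        using False by (subst prod.reindex) (auto simp: inj_on_def \<kappa>.hom_mult right_diff_distrib)
      also have "\<dots> \<in> N" using T(2) by (simp add: prod.distrib mult_in)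
      finally show ?thesis .
    qed
    then have "(\<Prod>c\<in>?U. \<kappa> a * h - \<kappa> c) \<in> N"
      by (rule prod_superset_in[OF \<open>finite ?U\<close> sub])
    moreover have "g - \<kappa> a dvd g * h - \<kappa> a * h" by (simp add: left_diff_distrib[symmetric])
    then have "g - \<kappa> a dvd (\<Prod>c\<in>?U. g * h - \<kappa> c) - (\<Prod>c\<in>?U. \<kappa> a * h - \<kappa> c)"
      using diff_dvd_prod_diff[of "g * h" "\<kappa> a * h" \<kappa> ?U] dvd_trans by blast
    ultimately show "\<exists>z'. g - \<kappa> a dvd (\<Prod>c\<in>?U. g * h - \<kappa> c) - z' \<and> z' \<in> N" by blast
  qed
qed

text \<open>The root 0 is at most simple, so \<open>g * P(g)\<close> lies in \<open>N\<close> for a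
  polynomial \<open>P\<close> with \<open>P(0)\<close> a unit. Solving for the linear term expresses
  \<open>g\<close> as a multiple of its square.\<close>

lemma split_mod_regular:
  assumes "split_mod \<kappa> g"
  shows "\<exists>c. g - g\<^sup>2 * c \<in> N"
proof -
  obtain S where S: "finite S" "(\<Prod>a\<in>S. g - \<kappa> a) \<in> N"
    using assms by (auto simp: split_mod_def)
  let ?P = "\<lambda>x. \<Prod>a\<in>S - {0}. x - \<kappa> a"
  have "g * ?P g \<in> N"
  proof (cases "0 \<in> S")
    case True
    then show ?thesis using S prod.remove[of S 0 "\<lambda>a. g - \<kappa> a"] by (simp add: \<kappa>.hom_zero)
  qed (use S mult_in in auto)
  define u where "u = (\<Prod>a\<in>S - {0}. - a)"
  have u: "u \<noteq> 0" "\<kappa> u = ?P 0"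
    using S by (auto simp: u_def \<kappa>.hom_prod \<kappa>.hom_uminus)
  obtain k where "?P g - ?P 0 = (g - 0) * k"
    using diff_dvd_prod_diff[of g 0 \<kappa> "S - {0}"] by (auto elim: dvdE)
  then have "?P g = \<kappa> u + g * k" using u(2) by (simp add: algebra_simps)
  then have "g * \<kappa> u + g * g * k \<in> N"
    using \<open>g * ?P g \<in> N\<close> by (simp add: algebra_simps)
  moreover have inv: "\<kappa> u * \<kappa> (inverse u) = 1"
    using u(1) by (simp add: \<kappa>.hom_mult[symmetric])
  have "\<kappa> u * (g - g\<^sup>2 * (- \<kappa> (inverse u) * k)) = g * \<kappa> u + g * g * (\<kappa> u * \<kappa> (inverse u)) * k"
    by (simp add: power2_eq_square algebra_simps)
  then have "\<kappa> u * (g - g\<^sup>2 * (- \<kappa> (inverse u) * k)) = g * \<kappa> u + g * g * k"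
    unfolding inv by simp
  ultimately have "\<kappa> u * (g - g\<^sup>2 * (- \<kappa> (inverse u) * k)) \<in> N" by simp
  then show ?thesis using cancel_unit u(1) by blast
qed

end

end

text \<open>Completing \<open>{1}\<close> to a basis gives a projection onto the base field. It is
  not multiplicative in general, but linearity is what the descent uses.\<close>

lemma alg_closure_retraction:
  obtains lam :: "'k::field alg_closure \<Rightarrow> 'k" where
    "\<And>x y. lam (x + y) = lam x + lam y" "\<And>c x. lam (to_ac c * x) = c * lam x" "lam 1 = 1"
proof -
  interpret vector_space_pair "\<lambda>c (x :: 'k alg_closure). to_ac c * x" "(*) :: 'k \<Rightarrow> 'k \<Rightarrow> 'k"
    by unfold_locales (auto simp: algebra_simps)
  have ind: "vs1.independent {1}" by (simp add: vs1.dependent_single)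
  let ?f = "construct {1} (\<lambda>_. 1)"
  interpret l: Vector_Spaces.linear "\<lambda>c (x :: 'k alg_closure). to_ac c * x" "(*) :: 'k \<Rightarrow> 'k \<Rightarrow> 'k" ?f
    by (rule linear_construct[OF ind])
  show thesis
    by (rule that[of ?f]) (use construct_basis[OF ind, of 1] in \<open>auto simp: l.add l.scale\<close>)
qed

text \<open>The Bezout relation survives the passage to the closure, so no root is shared with the
  derivative. All multiplicities are then at most 1, and the multiset of roots is a set.\<close>

lemma coprime_pderiv_roots:
  fixes \<mu> :: "'k::field_char_0 poly"
  assumes "r * \<mu> + s * pderiv \<mu> = 1"
  obtains S c where "finite S" "c \<noteq> 0" "map_poly to_ac \<mu> = Polynomial.smult c (\<Prod>a\<in>S. [:- a, 1:])"
proof -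
  interpret ac: field_hom "to_ac :: 'k \<Rightarrow> 'k alg_closure" by unfold_locales auto
  interpret map: map_poly_comm_ring_hom "to_ac :: 'k \<Rightarrow> 'k alg_closure" ..
  let ?p = "map_poly to_ac \<mu>"
  have mu0: "\<mu> \<noteq> 0" using assms by auto
  have "map_poly to_ac (r * \<mu> + s * pderiv \<mu>) = 1" using assms by simp
  then have "map_poly to_ac r * ?p + map_poly to_ac s * map_poly to_ac (pderiv \<mu>) = 1"
    by (simp add: map.hom_mult map.hom_add)
  moreover have "map_poly to_ac (pderiv \<mu>) = pderiv ?p"
    by (rule poly_eqI) (simp add: coeff_map_poly coeff_pderiv)
  ultimately have "poly ?p a \<noteq> 0 \<or> poly (pderiv ?p) a \<noteq> 0" for a
    by (metis add_0 mult_zero_right one_neq_zero poly_1 poly_add poly_mult)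
  then have sq: "rsquarefree ?p" by (auto simp: rsquarefree_roots)
  have p0: "?p \<noteq> 0" using mu0 by (simp add: map_poly_eq_0_iff)
  obtain A where A: "?p = Polynomial.smult (lead_coeff ?p) (\<Prod>x\<in>#A. [:-x, 1:])"
    using alg_closed_imp_factorization[OF p0] by blast
  have cnt: "count A a = order a ?p" for a
  proof -
    have "order a ?p = order a (\<Prod>x\<in>#A. [:-x, 1:])"
      using p0 by (subst A) (simp add: order_smult)
    also have "\<dots> = count A a"
    proof (induction A)
      case (add x A)
      have "(\<Prod>x\<in>#A. [:-x, 1:]) \<noteq> (0 :: 'k alg_closure poly)" by (auto simp: prod_mset_zero_iff)
      then show ?case using add by (auto simp: order_mult order_linear' simp del: mult_pCons_left)
    qed (auto simp: order_1)
    finally show ?thesis by simp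
  qed
  have "count A a \<le> 1" for a
    using sq unfolding rsquarefree_def cnt by (metis le_numeral_extra(4) zero_le_one)
  then have "A = mset_set (set_mset A)"
    by (intro multiset_eqI) (metis (mono_tags, lifting) One_nat_def count_eq_zero_iff count_mset_set(1,3) finite_set_mset le_Suc_eq le_zero_eq)
  then have "(\<Prod>x\<in>#A. [:-x, 1:]) = (\<Prod>x\<in>set_mset A. [:-x, 1:])"
    by (metis prod_unfold_prod_mset)
  then show thesis using that[of "set_mset A" "lead_coeff ?p"] A p0 by auto
qed

text \<open>The elements that split modulo the ideal of all \<mu>_i(x_i) contain the constants and
  the variables and are closed under sums and products, so they comprise the image of
  \<open>g\<close>. The cofactors may involve further variables; evaluation and the derivations used
  later are defined on them as well.\<close>

theorem separable_regular:
  fixes \<mu> :: "nat \<Rightarrow> 'k::field_char_0 poly"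
  assumes cop: "\<And>i. i < n \<Longrightarrow> \<exists>r s. r * \<mu> i + s * pderiv (\<mu> i) = 1" and g: "g \<in> mpolys {..<n}"
  shows "\<exists>c b. g - g\<^sup>2 * c = (\<Sum>i<n. b i * poly (map_poly const_poly (\<mu> i)) (mvar i))"
proof -
  define lift :: "'k mpoly \<Rightarrow> 'k alg_closure mpoly" where
    "lift = mpoly_eval (\<lambda>c. const_poly (to_ac c)) mvar"
  have k1: "comm_ring_hom (\<lambda>c::'k. const_poly (to_ac c))" by unfold_locales auto
  interpret lift: comm_ring_hom lift
    unfolding lift_def by (rule comm_ring_hom_mpoly_eval[OF k1])
  have k2: "comm_ring_hom (const_poly :: 'k alg_closure \<Rightarrow> _)" by unfold_locales auto
  define G where "G = (\<lambda>i. poly (map_poly const_poly (\<mu> i)) (mvar i))"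
  define W where "W = {\<Sum>i<n. b i * lift (G i) | b. True}"
  interpret W: ideal_set W
  proof
    show "0 \<in> W" unfolding W_def by (auto intro!: exI[of _ "\<lambda>_. 0"])
    show "x + y \<in> W" if xy: "x \<in> W" "y \<in> W" for x y
    proof -
      obtain b c where "x = (\<Sum>i<n. b i * lift (G i))" "y = (\<Sum>i<n. c i * lift (G i))"
        using xy by (auto simp: W_def)
      then have "x + y = (\<Sum>i<n. (b i + c i) * lift (G i))"
        by (simp add: distrib_right sum.distrib)
      then show ?thesis unfolding W_def by (intro CollectI exI[of _ "\<lambda>i. b i + c i"]) simp
    qed
    show "y * x \<in> W" if "x \<in> W" for x y
    proof -
      obtain b where "x = (\<Sum>i<n. b i * lift (G i))" using \<open>x \<in> W\<close> by (auto simp: W_def)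
      then have "y * x = (\<Sum>i<n. (y * b i) * lift (G i))" by (simp add: sum_distrib_left mult.assoc)
      then show ?thesis unfolding W_def by (intro CollectI exI[of _ "\<lambda>i. y * b i"]) simp
    qed
  qed
  have split_var: "W.split_mod const_poly (mvar i)" if i: "i < n" for i
  proof -
    obtain S c where S: "finite S" "c \<noteq> 0" "map_poly to_ac (\<mu> i) = Polynomial.smult c (\<Prod>a\<in>S. [:- a, 1:])"
      using coprime_pderiv_roots cop[OF i] by metis
    interpret c: comm_ring_hom "const_poly :: 'k alg_closure \<Rightarrow> _" by (rule k2)
    interpret mc: map_poly_comm_ring_hom "const_poly :: 'k alg_closure \<Rightarrow> _" ..
    have "lift (poly (map_poly const_poly q) (mvar i)) =
        poly (map_poly const_poly (map_poly to_ac q)) (mvar i)" for q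
    proof (induction q)
      case (pCons a q)
      then show ?case
        by (simp add: map_poly_pCons lift.hom_add lift.hom_mult)
           (simp add: lift_def mpoly_eval_const[OF k1] mpoly_eval_var[OF k1])
    qed (simp add: lift.hom_zero)
    then have "lift (G i) = poly (map_poly const_poly (Polynomial.smult c (\<Prod>a\<in>S. [:- a, 1:]))) (mvar i)"
      unfolding G_def S(3)[symmetric] by simp
    also have "\<dots> = const_poly c * (\<Prod>a\<in>S. mvar i - const_poly a)"
      by (simp add: c.map_poly_hom_smult mc.hom_prod poly_prod map_poly_pCons c.hom_uminus)
    finally have e: "lift (G i) = const_poly c * (\<Prod>a\<in>S. mvar i - const_poly a)" .
    have "lift (G i) = (\<Sum>j<n. (if j = i then 1 else 0) * lift (G j))"
      using i by (simp add: mult_delta_left)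
    then have "lift (G i) \<in> W" unfolding W_def by (intro CollectI exI[of _ "\<lambda>j. if j = i then 1 else 0"]) simp
    then have "(\<Prod>a\<in>S. mvar i - const_poly a) \<in> W"
      using W.cancel_unit[OF k2 S(2)] e by metis
    then show ?thesis unfolding W.split_mod_def using S(1) by blast
  qed
  have "W.split_mod const_poly (lift g)"
    using g
  proof (induction g rule: mpoly_induct)
    case (const c)
    then show ?case
      using W.split_mod_const[OF k2] by (simp add: lift_def mpoly_eval_const[OF k1])
  next
    case (var i)
    then show ?case using split_var
      by (simp add: lift_def mpoly_eval_var[OF k1])
  qed (simp_all add: lift.hom_add lift.hom_mult W.split_mod_add[OF k2] W.split_mod_mult[OF k2])
  then obtain c where "lift g - (lift g)\<^sup>2 * c \<in> W"
    using W.split_mod_regular[OF k2] by blast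
  then obtain b where cb: "lift g - (lift g)\<^sup>2 * c = (\<Sum>i<n. b i * lift (G i))"
    by (auto simp: W_def)
  text \<open>The relation over the algebraic closure descends along a linear retraction, applied to the
    coefficients.\<close>
  obtain lam :: "'k alg_closure \<Rightarrow> 'k" where la: "\<And>x y. lam (x + y) = lam x + lam y"
    and lm: "\<And>c x. lam (to_ac c * x) = c * lam x" and l1: "lam 1 = 1"
    using alg_closure_retraction by metis
  have l0: "lam 0 = 0" using la[of 0 0] by simp
  define Lam where "Lam = (\<lambda>q :: 'k alg_closure mpoly. Poly_Mapping.map lam q)"
  have look: "Poly_Mapping.lookup (Lam q) t = lam (Poly_Mapping.lookup q t)" for q t
    by (simp add: Lam_def Poly_Mapping.map.rep_eq l0 when_def)
  have Ladd: "Lam (p + q) = Lam p + Lam q" for p q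
    by (rule poly_mapping_eqI) (simp add: look lookup_add la)
  have Lsum: "Lam (sum p A) = (\<Sum>i\<in>A. Lam (p i))" for p and A :: "'i set"
    by (induction A rule: infinite_finite_induct)
       (auto simp: Ladd intro!: poly_mapping_eqI simp: look l0)
  have Lsingle: "Lam (Poly_Mapping.single t a) = Poly_Mapping.single t (lam a)" for t a
    by (rule poly_mapping_eqI) (simp add: look lookup_single when_def l0)
  have Ls: "Lam (Poly_Mapping.single s (to_ac a) * q) = Poly_Mapping.single s a * Lam q" for s a q
    by (subst (1 2) mpoly_expand[of q])
       (simp add: sum_distrib_left Lsum mult_single Lsingle lm)
  \<comment> \<open>\<open>Lam\<close> is linear over polynomials with coefficients in the base
    field. In the relation to be descended only \<open>c\<close> and the \<open>b i\<close> have
    coefficients in the closure.\<close>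
  have Lmult: "Lam (lift p * q) = p * Lam q" for p q
    using mpolys_UNIV[of p]
  proof (induction p arbitrary: q rule: mpoly_induct)
    case (const c)
    show ?case using Ls[of 0 c q] by (simp add: lift_def mpoly_eval_const[OF k1] flip: const_poly_def)
  next
    case (var i)
    show ?case using Ls[of "Poly_Mapping.single i 1" 1 q]
      unfolding to_ac_1 mvar_def[symmetric] by (simp add: lift_def mpoly_eval_var[OF k1])
  next
    case (add p p')
    then show ?case by (simp add: lift.hom_add distrib_right Ladd)
  next
    case (mult p p')
    then show ?case by (simp add: lift.hom_mult mult.assoc)
  qed
  have L1: "Lam 1 = 1" using Lsingle[of 0 1] l1 by simp
  have Llift: "Lam (lift p) = p" for p using Lmult[of p 1] L1 by simp
  have "Lam (lift g) = Lam ((lift g)\<^sup>2 * c + (\<Sum>i<n. b i * lift (G i)))"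
    using cb by (simp add: algebra_simps)
  also have "(lift g)\<^sup>2 * c + (\<Sum>i<n. b i * lift (G i)) =
      lift (g\<^sup>2) * c + (\<Sum>i<n. lift (G i) * b i)"
    by (simp add: lift.hom_power mult.commute)
  finally have "g = g\<^sup>2 * Lam c + (\<Sum>i<n. Lam (b i) * G i)"
    unfolding Llift Ladd Lmult Lsum by (simp add: mult.commute)
  then show ?thesis unfolding G_def
    by (intro exI[of _ "Lam c"] exI[of _ "\<lambda>i. Lam (b i)"]) (simp add: algebra_simps)
qed

section \<open>A generalized inverse of a matrix from a nonvanishing maximal minor\<close>

text \<open>The minor makes the columns indexed by \<open>T\<close> independent. There are
  \<open>rank A\<close> of them, so no further column can lie outside their span.\<close>

lemma (in vec_space) cols_span_of_minor:
  assumes A: "A \<in> carrier_mat n nc" and det: "det (submatrix A S T) \<noteq> 0"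
    and T: "T \<subseteq> {..<nc}" "card T = rank A" and j: "j < nc"
  shows "\<exists>v. col A j = submatrix A UNIV T *\<^sub>v v \<and> v \<in> carrier_vec (rank A)"
proof -
  let ?A = "submatrix A UNIV T"
  have "{j. j < nc \<and> j \<in> T} = T" using T(1) by auto
  then have dimA: "?A \<in> carrier_mat n (rank A)"
    using A T(2) by (intro carrier_matI) (simp_all add: dim_submatrix)
  have square: "dim_row (submatrix A S T) = dim_col (submatrix A S T)"
    using det unfolding det_def by metis
  \<comment> \<open>Independence and rank refer to the set of columns, so repetitions must be
    excluded first; one would make the minor vanish.\<close>
  have "distinct (cols (submatrix ?A S UNIV))"
    using vec_space.non_distinct_low_rank[of "submatrix A S T" "dim_row (submatrix A S T)"]
      vec_space.low_rank_det_zero[of "submatrix A S T" "dim_row (submatrix A S T)"] det square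
    unfolding submatrix_split[symmetric] by (metis carrier_matI less_irrefl)
  then have dist: "distinct (cols ?A)" by (rule distinct_cols_submatrix_UNIV)
  have "card {j. j < rank A \<and> j \<in> UNIV} \<le> rank ?A"
    using rank_gt_minor[OF dimA, of S UNIV] det unfolding submatrix_split[symmetric] .
  then have "rank ?A = rank A" using rank_le_nc[OF dimA] by simp
  then have ind: "lin_indpt (set (cols ?A))"
    by (rule full_rank_lin_indpt[OF dimA _ dist])
  have carr: "set (cols ?A) \<subseteq> carrier_vec n" using cols_dim dimA by blast
  have "col A j \<in> set (cols A)" using j A by (auto simp: cols_def)
  have cj: "col A j \<in> carrier_vec n" using j A by auto
  have "col A j \<in> span (set (cols ?A))"
  proof (rule ccontr)
    assume notin: "col A j \<notin> span (set (cols ?A))"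
    then have "col A j \<notin> set (cols ?A)" using span_mem carr by blast
    then have "lin_indpt (set (cols ?A) \<union> {col A j})"
      using lin_dep_iff_in_span[of "set (cols ?A)" "col A j"] carr ind cj notin by auto
    then have "card (set (cols ?A) \<union> {col A j}) \<le> rank A"
      using \<open>col A j \<in> set (cols A)\<close> cols_submatrix_subset
      by (intro rank_ge_card_indpt[OF A]) auto
    moreover have "card (set (cols ?A) \<union> {col A j}) = Suc (rank A)"
      using \<open>col A j \<notin> set (cols ?A)\<close> distinct_card[OF dist] dimA by auto
    ultimately show False by simp
  qed
  then obtain a where "lincomb a (set (cols ?A)) = col A j"
    using finite_in_span[of "set (cols ?A)"] carr by auto
  then show ?thesis
    using mat_mult_eq_lincomb[OF dimA dist, of a] by (metis vec_carrier)
qed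

lemma sum_swap4:
  "(\<Sum>k\<in>K. \<Sum>l\<in>L. \<Sum>a\<in>A. \<Sum>b\<in>B. F k l a b) = (\<Sum>a\<in>A. \<Sum>b\<in>B. \<Sum>k\<in>K. \<Sum>l\<in>L. F k l a b)"
proof -
  have "(\<Sum>k\<in>K. \<Sum>l\<in>L. \<Sum>a\<in>A. \<Sum>b\<in>B. F k l a b) = (\<Sum>k\<in>K. \<Sum>a\<in>A. \<Sum>l\<in>L. \<Sum>b\<in>B. F k l a b)"
    by (rule sum.cong[OF refl]) (rule sum.swap)
  also have "\<dots> = (\<Sum>a\<in>A. \<Sum>k\<in>K. \<Sum>l\<in>L. \<Sum>b\<in>B. F k l a b)" by (rule sum.swap)
  also have "\<dots> = (\<Sum>a\<in>A. \<Sum>k\<in>K. \<Sum>b\<in>B. \<Sum>l\<in>L. F k l a b)"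
    by (rule sum.cong[OF refl], rule sum.cong[OF refl]) (rule sum.swap)
  also have "\<dots> = (\<Sum>a\<in>A. \<Sum>b\<in>B. \<Sum>k\<in>K. \<Sum>l\<in>L. F k l a b)"
    by (rule sum.cong[OF refl]) (rule sum.swap)
  finally show ?thesis .
qed

text \<open>Write \<open>D\<close> for the submatrix of the minor. Over the field of fractions
  \<open>J = J_T V\<close>, with \<open>J_T\<close> the columns in \<open>T\<close>, hence
  \<open>J_S = D V\<close> for the rows in \<open>S\<close>. For \<open>B\<close> the adjugate of
  \<open>D\<close>, placed in rows \<open>T\<close> and columns \<open>S\<close>, this gives
  \<open>J B J = J_T adj(D) D V = det(D) J\<close>. Keeping the factor \<open>det(D)\<close> leaves
  \<open>B\<close> with entries in the domain itself.\<close>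

lemma generalized_inverse:
  fixes J :: "'a::idom mat"
  assumes J: "J \<in> carrier_mat m n" and det: "det (submatrix J S T) \<noteq> 0"
    and S: "S \<subseteq> {..<m}" "card S = frac_rank J" and T: "T \<subseteq> {..<n}" "card T = frac_rank J"
  obtains B where "\<And>i j. i < m \<Longrightarrow> j < n \<Longrightarrow>
    (\<Sum>k<n. \<Sum>l<m. J $$ (i, k) * B k l * J $$ (l, j)) = det (submatrix J S T) * J $$ (i, j)"
proof -
  define r where "r = frac_rank J"
  define F where "F = map_mat to_fract J"
  interpret tf: inj_comm_ring_hom "to_fract :: 'a \<Rightarrow> 'a fract" by unfold_locales auto
  interpret vec_space "TYPE('a fract)" m .
  have F: "F \<in> carrier_mat m n" using J by (auto simp: F_def)
  have r: "rank F = r" using J by (simp add: r_def frac_rank_def F_def)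
  have Tset: "{j. j < n \<and> j \<in> T} = T" and Sset: "{j. j < m \<and> j \<in> S} = S"
    using S(1) T(1) by auto
  have pT: "pick T a < n" if "a < r" for a
    using pick_le[of a n T] that T(2) by (simp add: Tset r_def)
  have pS: "pick S b < m" if "b < r" for b
    using pick_le[of b m S] that S(2) by (simp add: Sset r_def)
  define D where "D = submatrix J S T"
  have D: "D \<in> carrier_mat r r"
    using J S(2) T(2) by (intro carrier_matI) (simp_all add: D_def dim_submatrix Sset Tset r_def)
  have Dix: "D $$ (b, a) = J $$ (pick S b, pick T a)" if "b < r" "a < r" for a b
    unfolding D_def using that S(2) T(2)
    by (intro submatrix_index) (simp_all add: carrier_matD[OF J] Sset Tset r_def)
  have "submatrix F S T = map_mat to_fract D"
  proof (rule eq_matI)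
    fix i j assume "i < dim_row (map_mat to_fract D)" "j < dim_col (map_mat to_fract D)"
    then have ij: "i < r" "j < r" using D by auto
    then have "submatrix F S T $$ (i, j) = F $$ (pick S i, pick T j)"
      using F S(2) T(2) by (intro submatrix_index) (simp_all add: Sset Tset r_def)
    then show "submatrix F S T $$ (i, j) = map_mat to_fract D $$ (i, j)"
      using ij D J pS pT by (auto simp: Dix F_def)
  qed (use D F S(2) T(2) in \<open>simp_all add: dim_submatrix Sset Tset r_def\<close>)
  then have "det (submatrix F S T) \<noteq> 0" using det by (simp add: D_def)
  then have "\<forall>j. \<exists>v. j < n \<longrightarrow> col F j = submatrix F UNIV T *\<^sub>v v \<and> v \<in> carrier_vec r"
    using cols_span_of_minor[OF F _ T(1)] T(2) r by (auto simp: r_def)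
  then obtain v where v: "\<And>j. j < n \<Longrightarrow> col F j = submatrix F UNIV T *\<^sub>v v j \<and> v j \<in> carrier_vec r"
    by metis
  have dimF: "submatrix F UNIV T \<in> carrier_mat m r"
    using T(2) by (intro carrier_matI) (simp_all add: dim_submatrix carrier_matD[OF F] Tset r_def)
  have span: "to_fract (J $$ (i, j)) = (\<Sum>a<r. to_fract (J $$ (i, pick T a)) * v j $ a)"
    if ij: "i < m" "j < n" for i j
  proof -
    have "to_fract (J $$ (i, j)) = col F j $ i" using ij J by (auto simp: F_def)
    also have "\<dots> = (submatrix F UNIV T *\<^sub>v v j) $ i" using v[OF ij(2)] by metis
    also have "\<dots> = (\<Sum>a<r. submatrix F UNIV T $$ (i, a) * v j $ a)"
      using ij(1) carrier_matD[OF dimF] carrier_vecD[of "v j" r] v[OF ij(2)]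
      by (auto simp: scalar_prod_def atLeast0LessThan intro!: sum.cong)
    also have "\<dots> = (\<Sum>a<r. to_fract (J $$ (i, pick T a)) * v j $ a)"
    proof (intro sum.cong refl)
      fix a assume "a \<in> {..<r}"
      then have "submatrix F UNIV T $$ (i, a) = F $$ (pick UNIV i, pick T a)"
        using F T(2) ij by (intro submatrix_index) (simp_all add: Tset r_def)
      then show "submatrix F UNIV T $$ (i, a) * v j $ a = to_fract (J $$ (i, pick T a)) * v j $ a"
        using ij J pT \<open>a \<in> {..<r}\<close> by (auto simp: F_def pick_UNIV)
    qed
    finally show ?thesis .
  qed
  have adj: "(\<Sum>b<r. adj_mat D $$ (a, b) * D $$ (b, c)) = (if a = c then det D else 0)"
    if "a < r" "c < r" for a c
  proof -
    have "(\<Sum>b<r. adj_mat D $$ (a, b) * D $$ (b, c)) = (adj_mat D * D) $$ (a, c)"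
      using that D adj_mat(1)[OF D] by (auto simp: scalar_prod_def atLeast0LessThan)
    then show ?thesis using that adj_mat(3)[OF D] by auto
  qed
  define B where "B = (\<lambda>k l. \<Sum>a<r. \<Sum>b<r.
    if pick T a = k then if pick S b = l then adj_mat D $$ (a, b) else 0 else 0)"
  show thesis
  proof (rule that[of B])
    fix i j assume ij: "i < m" "j < n"
    have "(\<Sum>k<n. \<Sum>l<m. J $$ (i, k) * B k l * J $$ (l, j)) =
        (\<Sum>k<n. \<Sum>l<m. \<Sum>a<r. \<Sum>b<r. if pick T a = k then if pick S b = l then
          J $$ (i, k) * adj_mat D $$ (a, b) * J $$ (l, j) else 0 else 0)"
      unfolding B_def sum_distrib_left sum_distrib_right
      by (intro sum.cong refl) auto
    also have "\<dots> = (\<Sum>a<r. \<Sum>b<r. \<Sum>k<n. \<Sum>l<m. if pick T a = k then if pick S b = l then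
          J $$ (i, k) * adj_mat D $$ (a, b) * J $$ (l, j) else 0 else 0)"
      by (rule sum_swap4)
    also have "\<dots> = (\<Sum>a<r. \<Sum>b<r. J $$ (i, pick T a) * adj_mat D $$ (a, b) * J $$ (pick S b, j))"
    proof (intro sum.cong refl)
      fix a b assume ab: "a \<in> {..<r}" "b \<in> {..<r}"
      have "(\<Sum>k<n. \<Sum>l<m. if pick T a = k then if pick S b = l then
          J $$ (i, k) * adj_mat D $$ (a, b) * J $$ (l, j) else 0 else 0) =
        (\<Sum>k<n. if pick T a = k then \<Sum>l<m. if pick S b = l then
          J $$ (i, k) * adj_mat D $$ (a, b) * J $$ (l, j) else 0 else 0)"
        by (intro sum.cong refl) auto
      also have "\<dots> = J $$ (i, pick T a) * adj_mat D $$ (a, b) * J $$ (pick S b, j)"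
        using ab pT pS by simp
      finally show "(\<Sum>k<n. \<Sum>l<m. if pick T a = k then if pick S b = l then
          J $$ (i, k) * adj_mat D $$ (a, b) * J $$ (l, j) else 0 else 0) =
        J $$ (i, pick T a) * adj_mat D $$ (a, b) * J $$ (pick S b, j)" .
    qed
    finally have 1: "(\<Sum>k<n. \<Sum>l<m. J $$ (i, k) * B k l * J $$ (l, j)) =
      (\<Sum>a<r. \<Sum>b<r. J $$ (i, pick T a) * adj_mat D $$ (a, b) * J $$ (pick S b, j))" .
    \<comment> \<open>The coefficients \<open>v\<close> exist only over the field of fractions, so
      the identity is verified there and pulled back by injectivity of
      \<open>to_fract\<close>.\<close>
    have "to_fract (\<Sum>a<r. \<Sum>b<r. J $$ (i, pick T a) * adj_mat D $$ (a, b) * J $$ (pick S b, j)) =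
      (\<Sum>a<r. \<Sum>b<r. \<Sum>c<r. to_fract (J $$ (i, pick T a)) *
        to_fract (adj_mat D $$ (a, b) * D $$ (b, c)) * v j $ c)"
      unfolding tf.hom_sum
    proof (intro sum.cong refl)
      fix a b assume ab: "a \<in> {..<r}" "b \<in> {..<r}"
      then have "to_fract (J $$ (pick S b, j)) = (\<Sum>c<r. to_fract (D $$ (b, c)) * v j $ c)"
        using span[OF pS ij(2), of b] by (auto simp: Dix intro!: sum.cong)
      then show "to_fract (J $$ (i, pick T a) * adj_mat D $$ (a, b) * J $$ (pick S b, j)) =
        (\<Sum>c<r. to_fract (J $$ (i, pick T a)) *
        to_fract (adj_mat D $$ (a, b) * D $$ (b, c)) * v j $ c)"
        by (simp add: tf.hom_mult sum_distrib_left mult.assoc)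
    qed
    also have "\<dots> = (\<Sum>a<r. \<Sum>c<r. to_fract (J $$ (i, pick T a)) *
        to_fract (\<Sum>b<r. adj_mat D $$ (a, b) * D $$ (b, c)) * v j $ c)"
    proof (rule sum.cong[OF refl])
      fix a
      show "(\<Sum>b<r. \<Sum>c<r. to_fract (J $$ (i, pick T a)) *
          to_fract (adj_mat D $$ (a, b) * D $$ (b, c)) * v j $ c) =
        (\<Sum>c<r. to_fract (J $$ (i, pick T a)) *
          to_fract (\<Sum>b<r. adj_mat D $$ (a, b) * D $$ (b, c)) * v j $ c)"
        unfolding tf.hom_sum sum_distrib_left sum_distrib_right by (rule sum.swap)
    qed
    also have "\<dots> = (\<Sum>a<r. \<Sum>c<r. if a = c then to_fract (J $$ (i, pick T a)) *
        to_fract (det D) * v j $ c else 0)"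
      by (intro sum.cong refl) (auto simp: adj)
    also have "\<dots> = to_fract (det D) * (\<Sum>a<r. to_fract (J $$ (i, pick T a)) * v j $ a)"
      by (simp add: sum_distrib_left mult_ac)
    also have "\<dots> = to_fract (det D * J $$ (i, j))"
      using span[OF ij] by (simp add: tf.hom_mult)
    finally show "(\<Sum>k<n. \<Sum>l<m. J $$ (i, k) * B k l * J $$ (l, j)) =
      det (submatrix J S T) * J $$ (i, j)"
      unfolding 1 D_def[symmetric] by (simp only: to_fract_eq_iff)
  qed
qed

section \<open>Derivations of a local ring of an affine variety\<close>

lemma ring_gen_subring: "subring_set R \<Longrightarrow> ring_gen R = R"
proof -
  assume "subring_set R"
  then interpret subring_set R .
  have "x \<in> R" if "x \<in> ring_gen R" for x using that by induction auto
  then show ?thesis by (auto intro: ring_gen.base)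
qed

lemma min_degree_poly:
  assumes "P q" "(q::'k::field poly) \<noteq> 0"
  obtains p where "P p" "p \<noteq> 0" "\<And>q. P q \<Longrightarrow> q \<noteq> 0 \<Longrightarrow> degree p \<le> degree q"
proof -
  have "\<exists>p. (P p \<and> p \<noteq> 0) \<and> (\<forall>q. P q \<and> q \<noteq> 0 \<longrightarrow> degree p \<le> degree q)"
    using ex_has_least_nat[of "\<lambda>p. P p \<and> p \<noteq> 0" q degree] assms by auto
  then show thesis using that by blast
qed

text \<open>An element of least degree in the ideal generated by \<open>p\<close> and
  \<open>q\<close> divides both, because remainders stay in the ideal.\<close>

lemma poly_common_divisor:
  fixes p q :: "'k::field poly"
  assumes "p \<noteq> 0"
  obtains d r s where "d \<noteq> 0" "d = r * p + s * q" "d dvd p" "d dvd q"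
proof -
  have "\<exists>r s. p = r * p + s * q" by (rule exI[of _ 1], rule exI[of _ 0]) simp
  then obtain d where d: "\<exists>r s. d = r * p + s * q" "d \<noteq> 0"
    and min: "\<And>e. \<exists>r s. e = r * p + s * q \<Longrightarrow> e \<noteq> 0 \<Longrightarrow> degree d \<le> degree e"
    using min_degree_poly[of "\<lambda>d. \<exists>r s. d = r * p + s * q" p] assms by metis
  obtain r s where rs: "d = r * p + s * q" using d by auto
  have dv: "d dvd a * p + b * q" for a b
  proof -
    let ?x = "a * p + b * q"
    have "?x mod d = ?x - ?x div d * d" by (simp add: minus_div_mult_eq_mod)
    also have "?x - c * d = (a - c * r) * p + (b - c * s) * q" for c
      by (simp add: rs algebra_simps)
    finally have "\<exists>r s. ?x mod d = r * p + s * q" by blast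
    then have "?x mod d = 0"
      using min degree_mod_less[OF d(2), of ?x] by (meson leD)
    then show ?thesis by (simp add: mod_eq_0_iff_dvd)
  qed
  show thesis using that[OF d(2) rs] dv[of 1 0] dv[of 0 1] by simp
qed

text \<open>The coordinate ring enters through the evaluation map only: \<open>surj\<close> and
  \<open>ker\<close> present it as a quotient of the polynomial ring by the \<open>f i\<close>. The
  rank hypothesis is condensed into \<open>ginv\<close>, in which \<open>B\<close> is
  \<open>\<Delta>\<close> times a generalized inverse of the Jacobi matrix.\<close>

locale affine_local = prime_set M for M :: "'a::idom set" +
  fixes n m :: nat and \<kappa> :: "'k::field_char_0 \<Rightarrow> 'a" and \<xi> :: "nat \<Rightarrow> 'a" and f :: "nat \<Rightarrow> 'k mpoly"
    and B :: "nat \<Rightarrow> nat \<Rightarrow> 'a" and \<Delta> :: 'a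
  assumes max: "\<And>r. r \<notin> M \<Longrightarrow> \<exists>r'. r * r' - 1 \<in> M"
    and hom: "comm_ring_hom \<kappa>"
    and surj: "\<And>a. \<exists>g\<in>mpolys {..<n}. mpoly_eval \<kappa> \<xi> g = a"
    and f_in: "\<And>i. i < m \<Longrightarrow> f i \<in> mpolys {..<n}"
    and f_zero: "\<And>i. i < m \<Longrightarrow> mpoly_eval \<kappa> \<xi> (f i) = 0"
    and ker: "\<And>g. g \<in> mpolys {..<n} \<Longrightarrow> mpoly_eval \<kappa> \<xi> g = 0 \<Longrightarrow> \<exists>b. g = (\<Sum>i<m. b i * f i)"
    and minor: "\<Delta> \<notin> M"
    and ginv: "\<And>i j. i < m \<Longrightarrow> j < n \<Longrightarrow>
      (\<Sum>k<n. \<Sum>l<m. mpoly_eval \<kappa> \<xi> (partial_deriv k (f i)) * B k l * mpoly_eval \<kappa> \<xi> (partial_deriv j (f l)))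
      = \<Delta> * mpoly_eval \<kappa> \<xi> (partial_deriv j (f i))"
begin

interpretation \<kappa>: comm_ring_hom \<kappa> by (rule hom)
interpretation ev: comm_ring_hom "mpoly_eval \<kappa> \<xi>" by (rule comm_ring_hom_mpoly_eval[OF hom])

abbreviation ev where "ev \<equiv> mpoly_eval \<kappa> \<xi>"

lemmas ev_simps = mpoly_eval_const[OF hom] mpoly_eval_var[OF hom]

lemma \<kappa>_notin: "c \<noteq> 0 \<Longrightarrow> \<kappa> c \<notin> M"
  using mult_in[of "\<kappa> c" "\<kappa> (inverse c)"] one_notin by (auto simp: \<kappa>.hom_mult[symmetric])

lemma inj_\<kappa>: "inj \<kappa>"
proof (rule injI)
  fix c d assume "\<kappa> c = \<kappa> d"
  then have "\<kappa> (c - d) = 0" by (simp add: \<kappa>.hom_minus)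
  then show "c = d" using \<kappa>_notin[of "c - d"] by auto
qed

section \<open>Separable equations for the coordinates modulo the maximal ideal\<close>

lemma algebraic_coordinate:
  assumes j: "j < n"
  obtains q where "q \<noteq> 0" "poly (map_poly \<kappa> q) (\<xi> j) \<in> M"
proof -
  have R: "subring_set (range \<kappa>)"
  proof
    show "1 \<in> range \<kappa>" using \<kappa>.hom_one by (metis rangeI)
    show "x - y \<in> range \<kappa>" if "x \<in> range \<kappa>" "y \<in> range \<kappa>" for x y
      using that by (auto simp: \<kappa>.hom_minus[symmetric])
    show "x * y \<in> range \<kappa>" if "x \<in> range \<kappa>" "y \<in> range \<kappa>" for x y
      using that by (auto simp: \<kappa>.hom_mult[symmetric])
  qed
  let ?G = "ring_gen (range \<kappa> \<union> \<xi> ` {..<n})"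
  interpret G: subring_set ?G by (rule subring_ring_gen)
  have "ev g \<in> ?G" if "g \<in> mpolys {..<n}" for g
    using that
    by (induction g rule: mpoly_induct)
       (auto simp: ev_simps ev.hom_add ev.hom_mult intro: ring_gen.base)
  then have "?G = UNIV" using surj by (metis UNIV_eq_I)
  then have "algebraic_mod (ring_gen (range \<kappa>)) (\<xi> j)"
    using j by (intro zariski_algebraic[OF max, of "\<xi> ` {..<n}"]) auto
  then obtain q i where q: "q \<in> polys_over (range \<kappa>)" "poly q (\<xi> j) \<in> M" "coeff q i \<notin> M"
    unfolding ring_gen_subring[OF R] by (auto simp: algebraic_mod_def)
  have inv0: "inv_into UNIV \<kappa> 0 = 0" using inv_f_f[OF inj_\<kappa>, of 0] by (simp add: \<kappa>.hom_zero)
  have "map_poly \<kappa> (map_poly (inv_into UNIV \<kappa>) q) = q"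
  proof (rule poly_eqI)
    fix i
    have "coeff q i \<in> range \<kappa>" using q(1) by (simp add: polys_over_def)
    then show "coeff (map_poly \<kappa> (map_poly (inv_into UNIV \<kappa>) q)) i = coeff q i"
      by (simp add: coeff_map_poly inv0 \<kappa>.hom_zero f_inv_into_f)
  qed
  moreover from this have "map_poly (inv_into UNIV \<kappa>) q \<noteq> 0" using q(3) by auto
  ultimately show thesis using that q(2) by metis
qed

text \<open>Take \<mu> of least degree. In characteristic zero its derivative is nonzero of smaller
  degree, so a common divisor \<open>d\<close> of both does not vanish at the coordinate. The
  cofactor of \<open>d\<close> in \<mu> then vanishes, and minimality forces \<open>d\<close> to be
  constant.\<close>

lemma separable_coordinate:
  assumes j: "j < n"
  shows "\<exists>\<mu>. (\<exists>r s. r * \<mu> + s * pderiv \<mu> = 1) \<and> poly (map_poly \<kappa> \<mu>) (\<xi> j) \<in> M \<and>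
    poly (map_poly \<kappa> (pderiv \<mu>)) (\<xi> j) \<notin> M"
proof -
  interpret mp: map_poly_comm_ring_hom \<kappa> ..
  let ?e = "\<lambda>q. poly (map_poly \<kappa> q) (\<xi> j)"
  obtain q where "q \<noteq> 0" "?e q \<in> M" using algebraic_coordinate[OF j] .
  then obtain \<mu> where \<mu>: "?e \<mu> \<in> M" "\<mu> \<noteq> 0"
    and min: "\<And>q. ?e q \<in> M \<Longrightarrow> q \<noteq> 0 \<Longrightarrow> degree \<mu> \<le> degree q"
    using min_degree_poly[of "\<lambda>q. ?e q \<in> M" q] by metis
  have deg: "degree \<mu> > 0"
  proof (rule ccontr)
    assume "\<not> degree \<mu> > 0"
    then obtain c where "\<mu> = [:c:]" using degree_eq_zeroE by blast
    then show False using \<mu> \<kappa>_notin[of c] by (auto simp: map_poly_pCons \<kappa>.hom_zero)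
  qed
  then have p0: "pderiv \<mu> \<noteq> 0" by (simp add: pderiv_eq_0_iff)
  obtain d r s where d: "d \<noteq> 0" "d = r * \<mu> + s * pderiv \<mu>" "d dvd \<mu>" "d dvd pderiv \<mu>"
    using poly_common_divisor[OF \<mu>(2)] by metis
  have "degree d \<le> degree (pderiv \<mu>)" using dvd_imp_degree_le[OF d(4) p0] .
  then have "degree d < degree \<mu>" using deg by (simp add: degree_pderiv)
  then have "?e d \<notin> M" using min d(1) by (meson leD)
  obtain e where e: "\<mu> = d * e" using d(3) by (auto elim: dvdE)
  then have "?e d * ?e e \<in> M" using \<mu>(1) by (simp add: mp.hom_mult)
  then have "?e e \<in> M" using prime_in \<open>?e d \<notin> M\<close> by blast
  moreover have "e \<noteq> 0" using e \<mu>(2) by auto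
  ultimately have "degree \<mu> \<le> degree e" using min by blast
  then have "degree d = 0" using e d(1) \<open>e \<noteq> 0\<close> by (simp add: degree_mult_eq)
  then obtain c where c: "d = [:c:]" "c \<noteq> 0" using d(1) degree_eq_zeroE by (metis pCons_0_0)
  have bez: "(Polynomial.smult (inverse c) r) * \<mu> + (Polynomial.smult (inverse c) s) * pderiv \<mu> = 1"
  proof -
    have "(Polynomial.smult (inverse c) r) * \<mu> + (Polynomial.smult (inverse c) s) * pderiv \<mu> = Polynomial.smult (inverse c) d"
      by (simp add: d(2) smult_add_right)
    then show ?thesis using c by (simp add: one_pCons)
  qed
  have "?e (pderiv \<mu>) \<notin> M"
  proof
    assume a: "?e (pderiv \<mu>) \<in> M"
    have "?e (Polynomial.smult (inverse c) r) * ?e \<mu> + ?e (Polynomial.smult (inverse c) s) * ?e (pderiv \<mu>) = 1"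
      using arg_cong[OF bez, of ?e] by (simp only: mp.hom_add mp.hom_mult mp.hom_one poly_add poly_mult poly_1)
    then show False using add_in[OF mult_in[OF \<mu>(1)] mult_in[OF a]] one_notin by metis
  qed
  then show ?thesis using bez \<mu>(1) by blast
qed

section \<open>The local ring and its maximal ideal inside the field of fractions\<close>

definition L :: "'a fract set" where "L = {Fract a s | a s. s \<notin> M}"
definition N :: "'a fract set" where "N = {Fract a s | a s. a \<in> M \<and> s \<notin> M}"

lemma notin_M_nonzero: "s \<notin> M \<Longrightarrow> s \<noteq> 0" by auto

text \<open>Membership is expressed by clearing one denominator, which keeps the closure proofs free
  of division.\<close>

lemma L_I: "s \<notin> M \<Longrightarrow> x * to_fract s = to_fract a \<Longrightarrow> x \<in> L"
proof -
  assume "s \<notin> M" "x * to_fract s = to_fract a"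
  then have "x = Fract a s"
    by (simp add: Fract_conv_to_fract nonzero_eq_divide_eq notin_M_nonzero)
  then show "x \<in> L" using \<open>s \<notin> M\<close> unfolding L_def by blast
qed

lemma L_E:
  assumes "x \<in> L" obtains a s where "s \<notin> M" "x * to_fract s = to_fract a"
proof -
  obtain a s where "x = Fract a s" "s \<notin> M" using assms by (auto simp: L_def)
  then show thesis
    by (intro that[of s a]) (simp_all add: Fract_conv_to_fract notin_M_nonzero)
qed

lemma N_I: "s \<notin> M \<Longrightarrow> a \<in> M \<Longrightarrow> x * to_fract s = to_fract a \<Longrightarrow> x \<in> N"
proof -
  assume "s \<notin> M" "a \<in> M" "x * to_fract s = to_fract a"
  then have "x = Fract a s"
    by (simp add: Fract_conv_to_fract nonzero_eq_divide_eq notin_M_nonzero)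
  then show "x \<in> N" using \<open>s \<notin> M\<close> \<open>a \<in> M\<close> unfolding N_def by blast
qed

lemma N_E:
  assumes "x \<in> N" obtains a s where "s \<notin> M" "a \<in> M" "x * to_fract s = to_fract a"
proof -
  obtain a s where "x = Fract a s" "a \<in> M" "s \<notin> M" using assms by (auto simp: N_def)
  then show thesis
    by (intro that[of s a]) (simp_all add: Fract_conv_to_fract notin_M_nonzero)
qed

lemma mult_notin: "s \<notin> M \<Longrightarrow> t \<notin> M \<Longrightarrow> s * t \<notin> M"
  using prime_in by blast

lemma to_fract_L [simp]: "to_fract a \<in> L"
  by (rule L_I[of 1 _ a]) (auto simp: one_notin)

lemma inverse_L: "s \<notin> M \<Longrightarrow> inverse (to_fract s) \<in> L"
  by (rule L_I[of s _ 1]) (simp_all add: notin_M_nonzero)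

lemma subring_L: "subring_set L"
proof
  show "1 \<in> L" using to_fract_L[of 1] by simp
  fix x y assume "x \<in> L" "y \<in> L"
  then obtain a s b t where "s \<notin> M" "x * to_fract s = to_fract a" "t \<notin> M" "y * to_fract t = to_fract b"
    by (elim L_E)
  note st = this
  show "x - y \<in> L"
  proof (rule L_I[of "s * t"])
    show "s * t \<notin> M" using st mult_notin by blast
    have "(x - y) * to_fract (s * t) = (x * to_fract s) * to_fract t - (y * to_fract t) * to_fract s"
      by (simp add: algebra_simps)
    then show "(x - y) * to_fract (s * t) = to_fract (a * t - b * s)"
      unfolding st by simp
  qed
  show "x * y \<in> L"
  proof (rule L_I[of "s * t"])
    show "s * t \<notin> M" using st mult_notin by blast
    have "(x * y) * to_fract (s * t) = (x * to_fract s) * (y * to_fract t)"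
      by (simp add: algebra_simps)
    then show "(x * y) * to_fract (s * t) = to_fract (a * b)"
      unfolding st by simp
  qed
qed

sublocale L: subring_set L by (rule subring_L)

lemma N_subset_L: "x \<in> N \<Longrightarrow> x \<in> L"
  by (elim N_E) (rule L_I)

lemma N_zero [simp]: "0 \<in> N"
  by (rule N_I[of 1 0]) (auto simp: one_notin)

lemma N_add: "x \<in> N \<Longrightarrow> y \<in> N \<Longrightarrow> x + y \<in> N"
proof -
  assume "x \<in> N" "y \<in> N"
  then obtain a s b t where st: "s \<notin> M" "a \<in> M" "x * to_fract s = to_fract a"
    "t \<notin> M" "b \<in> M" "y * to_fract t = to_fract b"
    by (elim N_E)
  show "x + y \<in> N"
  proof (rule N_I[of "s * t"])
    show "s * t \<notin> M" using st mult_notin by blast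
    have "(x + y) * to_fract (s * t) = (x * to_fract s) * to_fract t + (y * to_fract t) * to_fract s"
      by (simp add: algebra_simps)
    then show "(x + y) * to_fract (s * t) = to_fract (a * t + b * s)"
      unfolding st by simp
    show "a * t + b * s \<in> M" using st by (intro add_in mult_in')
  qed
qed

lemma N_mult: "x \<in> L \<Longrightarrow> y \<in> N \<Longrightarrow> x * y \<in> N"
proof -
  assume "x \<in> L" "y \<in> N"
  then obtain a s b t where st: "s \<notin> M" "x * to_fract s = to_fract a"
    "t \<notin> M" "b \<in> M" "y * to_fract t = to_fract b"
    by (elim N_E L_E)
  show "x * y \<in> N"
  proof (rule N_I[of "s * t"])
    show "s * t \<notin> M" using st mult_notin by blast
    have "(x * y) * to_fract (s * t) = (x * to_fract s) * (y * to_fract t)"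
      by (simp add: algebra_simps)
    then show "(x * y) * to_fract (s * t) = to_fract (a * b)"
      unfolding st by simp
    show "a * b \<in> M" using st by (intro mult_in)
  qed
qed

lemma N_uminus: "x \<in> N \<Longrightarrow> - x \<in> N"
  using N_mult[of "- 1" x] by simp

lemma N_diff: "x \<in> N \<Longrightarrow> y \<in> N \<Longrightarrow> x - y \<in> N"
  using N_add[of x "- y"] N_uminus by simp

lemma N_sum: "(\<And>i. i \<in> A \<Longrightarrow> g i \<in> N) \<Longrightarrow> sum g A \<in> N"
  by (induction A rule: infinite_finite_induct) (auto intro: N_add)

lemma to_fract_N_iff: "to_fract a \<in> N \<longleftrightarrow> a \<in> M"
proof
  assume "to_fract a \<in> N"
  then obtain b s where "s \<notin> M" "b \<in> M" "to_fract a * to_fract s = to_fract b" by (elim N_E)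
  then have "a * s \<in> M" by (simp flip: to_fract_mult)
  then show "a \<in> M" using prime_in \<open>s \<notin> M\<close> by blast
next
  assume "a \<in> M" then show "to_fract a \<in> N" by (intro N_I[of 1 a]) (auto simp: one_notin)
qed

text \<open>The cases of interest are \<open>U = {0}\<close> and \<open>U = N\<close>. Derivations into \<open>L / N\<close> are handled through
  representatives of their values.\<close>

definition derK :: "'a fract set \<Rightarrow> ('a fract \<Rightarrow> 'a fract) \<Rightarrow> bool" where
  "derK U d \<longleftrightarrow> der_mod L (\<lambda>x. x) U d \<and> (\<forall>c. d (to_fract (\<kappa> c)) \<in> U)"

lemma derK_diff:
  assumes "derK U d" "derK U d'"
  shows "derK U (\<lambda>x. d x - d' x)"
proof -
  interpret d: der_mod L "\<lambda>x. x" U d using assms by (simp add: derK_def)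
  interpret d': der_mod L "\<lambda>x. x" U d' using assms by (simp add: derK_def)
  have U: "x - y \<in> U" if "x \<in> U" "y \<in> U" for x y
    using d.N_add[of x "- y"] d.N_uminus that by simp
  have "der_mod L (\<lambda>x. x) U (\<lambda>x. d x - d' x)"
  proof
    fix x y assume xy: "x \<in> L" "y \<in> L"
    show "d (x + y) - d' (x + y) - (d x - d' x + (d y - d' y)) \<in> U"
      using U[OF d.D_add[OF xy] d'.D_add[OF xy]] by (simp add: algebra_simps)
    show "d (x * y) - d' (x * y) - (x * (d y - d' y) + y * (d x - d' x)) \<in> U"
      using U[OF d.D_mult[OF xy] d'.D_mult[OF xy]] by (simp add: algebra_simps)
  qed (use d.N_zero d.N_add d.N_mult in auto)
  then show ?thesis using assms U by (auto simp: derK_def)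
qed

lemma derK_chain:
  assumes "derK U d" "g \<in> mpolys {..<n}"
  shows "d (to_fract (ev g)) - (\<Sum>j<n. to_fract (ev (partial_deriv j g)) * d (to_fract (\<xi> j))) \<in> U"
proof -
  interpret d: der_mod L "\<lambda>x. x" U d using assms by (simp add: derK_def)
  have h: "comm_ring_hom (\<lambda>c. to_fract (\<kappa> c))"
    by unfold_locales (auto simp: \<kappa>.hom_add \<kappa>.hom_mult \<kappa>.hom_one \<kappa>.hom_zero)
  have tf: "mpoly_eval (\<lambda>c. to_fract (\<kappa> c)) (\<lambda>j. to_fract (\<xi> j)) g = to_fract (ev g)" for g
    using mpolys_UNIV[of g]
    by (induction g rule: mpoly_induct)
       (simp_all add: mpoly_eval_const[OF h] mpoly_eval_var[OF h] mpoly_eval_add[OF h]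
         mpoly_eval_mult[OF h] ev_simps ev.hom_add ev.hom_mult)
  show ?thesis
    using d.D_mpoly_eval[OF h, of n "\<lambda>j. to_fract (\<xi> j)" g] assms
    unfolding tf derK_def by auto
qed

text \<open>The chain rule settles elements of the coordinate ring. For a fraction
  \<open>x = a / s\<close> the product rule gives \<open>s * d x = d a - x * d s\<close> modulo
  \<open>U\<close>, and \<open>s\<close> is a unit of \<open>L\<close>.\<close>

lemma derK_determined:
  assumes d: "derK U d" and z: "\<And>j. j < n \<Longrightarrow> d (to_fract (\<xi> j)) \<in> U" and x: "x \<in> L"
  shows "d x \<in> U"
proof -
  interpret d: der_mod L "\<lambda>x. x" U d using d by (simp add: derK_def)
  have sumU: "sum g A \<in> U" if "\<And>i. i \<in> A \<Longrightarrow> g i \<in> U" for g and A :: "nat set"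
    using that by (induction A rule: infinite_finite_induct) (auto intro: d.N_add d.N_zero)
  have A: "d (to_fract a) \<in> U" for a
  proof -
    obtain g where g: "g \<in> mpolys {..<n}" "ev g = a" using surj by metis
    have "(\<Sum>j<n. to_fract (ev (partial_deriv j g)) * d (to_fract (\<xi> j))) \<in> U"
      by (intro sumU d.N_mult z) auto
    then show ?thesis using d.N_add[OF derK_chain[OF d g(1)]] g(2) by fastforce
  qed
  obtain a s where s: "s \<notin> M" "x * to_fract s = to_fract a" using x by (elim L_E)
  have "x * d (to_fract s) + to_fract s * d x \<in> U"
    using d.N_add[OF d.N_uminus[OF d.D_mult[OF x to_fract_L[of s]]] A[of a]] by (simp add: s(2))
  then have "to_fract s * d x \<in> U"
    using d.N_add[OF _ d.N_uminus[OF d.N_mult[OF x A[of s]]]] by fastforce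
  then have "inverse (to_fract s) * (to_fract s * d x) \<in> U"
    using inverse_L[OF s(1)] by (rule d.N_mult[rotated])
  then show ?thesis using s(1) by (simp add: mult.assoc[symmetric]) (metis left_inverse mult_1 notin_M_nonzero to_fract_eq_0_iff)
qed

text \<open>The source of injectivity. Since \<mu>(\<xi>_j) lies in \<open>M\<close>, applying
  \<open>d\<close> to it shows that \<mu>'(\<xi>_j) times the value at the coordinate lies in
  \<open>N\<close>, and \<mu>'(\<xi>_j) is a unit of \<open>L\<close>.\<close>

lemma derK_vanishing_on_ideal:
  assumes d: "derK N d" and z: "\<And>a. a \<in> M \<Longrightarrow> d (to_fract a) \<in> N" and x: "x \<in> L"
  shows "d x \<in> N"
proof (rule derK_determined[OF d _ x])
  interpret d: der_mod L "\<lambda>x. x" N d using d by (simp add: derK_def)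
  fix j assume j: "j < n"
  have h: "comm_ring_hom (\<lambda>c. to_fract (\<kappa> c))"
    by unfold_locales (auto simp: \<kappa>.hom_add \<kappa>.hom_mult \<kappa>.hom_one \<kappa>.hom_zero)
  obtain \<mu> where \<mu>: "poly (map_poly \<kappa> \<mu>) (\<xi> j) \<in> M" "poly (map_poly \<kappa> (pderiv \<mu>)) (\<xi> j) \<notin> M"
    using separable_coordinate[OF j] by blast
  have tf: "poly (map_poly (\<lambda>c. to_fract (\<kappa> c)) q) (to_fract (\<xi> j)) = to_fract (poly (map_poly \<kappa> q) (\<xi> j))" for q
    by (induction q) (simp_all add: map_poly_pCons \<kappa>.hom_zero)
  have "d (to_fract (poly (map_poly \<kappa> \<mu>) (\<xi> j))) -
      to_fract (poly (map_poly \<kappa> (pderiv \<mu>)) (\<xi> j)) * d (to_fract (\<xi> j)) \<in> N"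
    using d.D_poly[OF h, of "to_fract (\<xi> j)" \<mu>] d unfolding tf derK_def by auto
  then have "to_fract (poly (map_poly \<kappa> (pderiv \<mu>)) (\<xi> j)) * d (to_fract (\<xi> j)) \<in> N"
    using N_diff[OF z[OF \<mu>(1)]] by fastforce
  then have "inverse (to_fract (poly (map_poly \<kappa> (pderiv \<mu>)) (\<xi> j))) *
      (to_fract (poly (map_poly \<kappa> (pderiv \<mu>)) (\<xi> j)) * d (to_fract (\<xi> j))) \<in> N"
    by (rule N_mult[OF inverse_L[OF \<mu>(2)]])
  then show "d (to_fract (\<xi> j)) \<in> N"
    using notin_M_nonzero[OF \<mu>(2)] by (simp add: mult.assoc[symmetric])
qed

text \<open>The derivation of the polynomial ring with value \<open>v j\<close> at the
  \<open>j\<close>-th variable. On the relations, \<open>\<delta> v (f i)\<close> is the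
  \<open>i\<close>-th entry of the Jacobi matrix times \<open>v\<close>.\<close>

definition \<delta> :: "(nat \<Rightarrow> 'a fract) \<Rightarrow> 'k mpoly \<Rightarrow> 'a fract" where
  "\<delta> v g = (\<Sum>j<n. to_fract (ev (partial_deriv j g)) * v j)"

lemma \<delta>_L: "(\<And>j. j < n \<Longrightarrow> v j \<in> L) \<Longrightarrow> \<delta> v g \<in> L"
  unfolding \<delta>_def by (intro L.sum_closed L.mult_closed) auto

lemma \<delta>_add: "\<delta> v (g + h) = \<delta> v g + \<delta> v h"
  by (simp add: \<delta>_def partial_deriv_add ev.hom_add distrib_right sum.distrib)

lemma \<delta>_mult: "\<delta> v (g * h) = to_fract (ev g) * \<delta> v h + to_fract (ev h) * \<delta> v g"
  by (simp add: \<delta>_def partial_deriv_mult ev.hom_add ev.hom_mult distrib_right sum.distrib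
      sum_distrib_left mult.assoc)

lemma \<delta>_const: "\<delta> v (const_poly c) = 0"
  by (simp add: \<delta>_def partial_deriv_const ev.hom_zero)

lemma \<delta>_var: "j < n \<Longrightarrow> \<delta> v (mvar j) = v j"
proof -
  assume "j < n"
  have "\<delta> v (mvar j) = (\<Sum>i<n. if i = j then v i else 0)"
    unfolding \<delta>_def by (intro sum.cong) (auto simp: partial_deriv_var ev.hom_one ev.hom_zero)
  then show ?thesis using \<open>j < n\<close> by simp
qed

lemma \<delta>_zero: "\<delta> v 0 = 0"
  using \<delta>_const[of v 0] by simp

lemma \<delta>_diff: "\<delta> v (g - h) = \<delta> v g - \<delta> v h"
  using \<delta>_add[of v "g - h" h] by simp

lemma \<delta>_sum: "\<delta> v (sum g A) = (\<Sum>i\<in>A. \<delta> v (g i))"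
  by (induction A rule: infinite_finite_induct) (auto simp: \<delta>_add \<delta>_zero)

lemma \<delta>_upoly:
  assumes j: "j < n"
  shows "\<delta> v (poly (map_poly const_poly q) (mvar j)) =
    to_fract (poly (map_poly \<kappa> (pderiv q)) (\<xi> j)) * v j"
proof -
  interpret D: der_mod UNIV "\<lambda>g. to_fract (ev g)" "{0}" "\<delta> v"
    by unfold_locales (auto simp: \<delta>_add \<delta>_mult ev.hom_one ev.hom_add ev.hom_mult)
  have h: "comm_ring_hom (const_poly :: 'k \<Rightarrow> _)" by unfold_locales auto
  have "\<delta> v (poly (map_poly const_poly q) (mvar j)) =
      to_fract (ev (poly (map_poly const_poly (pderiv q)) (mvar j))) * \<delta> v (mvar j)"
    using D.D_poly[OF h, of "mvar j" q] \<delta>_const by simp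
  moreover have "ev (poly (map_poly const_poly p) (mvar j)) = poly (map_poly \<kappa> p) (\<xi> j)" for p
    by (induction p) (simp_all add: map_poly_pCons \<kappa>.hom_zero ev.hom_zero ev.hom_add ev.hom_mult ev_simps)
  ultimately show ?thesis using \<delta>_var[OF j] by simp
qed

text \<open>As \<open>\<delta> v\<close> and evaluation both kill the \<open>f i\<close>, the
  product rule makes \<open>\<delta> v\<close> vanish on the whole ideal. It therefore descends to
  the coordinate ring, and the quotient rule extends it to fractions.\<close>

lemma exists_derivation:
  assumes vL: "\<And>j. j < n \<Longrightarrow> v j \<in> L" and Jv: "\<And>i. i < m \<Longrightarrow> \<delta> v (f i) = 0"
  obtains d where "derK {0} d" "\<And>x. x \<in> L \<Longrightarrow> d x \<in> L" "\<And>j. j < n \<Longrightarrow> d (to_fract (\<xi> j)) = v j"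
proof -
  have \<delta>0: "\<delta> v g = 0" if g: "g \<in> mpolys {..<n}" "ev g = 0" for g
  proof -
    obtain b where "g = (\<Sum>i<m. b i * f i)" using ker[OF g] by blast
    then show ?thesis using Jv f_zero by (simp add: \<delta>_sum \<delta>_mult)
  qed
  interpret P: subring_set "mpolys {..<n} :: 'k mpoly set" by (rule subring_mpolys)
  define D0 where "D0 = (\<lambda>a. \<delta> v (SOME g. g \<in> mpolys {..<n} \<and> ev g = a))"
  have D0: "D0 (ev g) = \<delta> v g" if g: "g \<in> mpolys {..<n}" for g
  proof -
    define h where "h = (SOME h. h \<in> mpolys {..<n} \<and> ev h = ev g)"
    have h: "h \<in> mpolys {..<n} \<and> ev h = ev g"
      unfolding h_def by (rule someI[of _ g]) (use g in simp)
    then have "\<delta> v (h - g) = 0" using g by (intro \<delta>0) (auto simp: ev.hom_minus)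
    then show ?thesis by (simp add: D0_def h_def[symmetric] \<delta>_diff)
  qed
  have D0_add: "D0 (a + b) = D0 a + D0 b" and D0_mult: "D0 (a * b) = to_fract a * D0 b + to_fract b * D0 a" for a b
  proof -
    obtain g h where gh: "g \<in> mpolys {..<n}" "ev g = a" "h \<in> mpolys {..<n}" "ev h = b"
      using surj by metis
    show "D0 (a + b) = D0 a + D0 b"
      using D0[of "g + h"] D0[of g] D0[of h] gh by (simp add: ev.hom_add \<delta>_add)
    show "D0 (a * b) = to_fract a * D0 b + to_fract b * D0 a"
      using D0[of "g * h"] D0[of g] D0[of h] gh by (simp add: ev.hom_mult \<delta>_mult)
  qed
  have D0_const: "D0 (\<kappa> c) = 0" for c using D0[of "const_poly c"] by (simp add: ev_simps \<delta>_const)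
  have D0_L: "D0 a \<in> L" for a using \<delta>_L[OF vL] by (simp add: D0_def)
  define d where "d = (\<lambda>x. SOME y. \<exists>a s. s \<noteq> 0 \<and> x * to_fract s = to_fract a \<and>
    y * to_fract s = D0 a - x * D0 s)"
  have d: "d x * to_fract s = D0 a - x * D0 s" if s: "s \<noteq> 0" "x * to_fract s = to_fract a" for x a s
  proof -
    have "((D0 a - x * D0 s) / to_fract s) * to_fract s = D0 a - x * D0 s" using s(1) by simp
    then have "\<exists>y. \<exists>a s. s \<noteq> 0 \<and> x * to_fract s = to_fract a \<and> y * to_fract s = D0 a - x * D0 s"
      using s by blast
    then have "\<exists>a s. s \<noteq> 0 \<and> x * to_fract s = to_fract a \<and> d x * to_fract s = D0 a - x * D0 s"
      unfolding d_def by (rule someI_ex)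
    then obtain b t where t: "t \<noteq> 0" "x * to_fract t = to_fract b" "d x * to_fract t = D0 b - x * D0 t"
      by blast
    have "to_fract (a * t) = to_fract (b * s)"
      by (simp only: to_fract_mult s(2)[symmetric] t(2)[symmetric]) (simp add: mult_ac)
    then have "a * t = b * s" by (simp only: to_fract_eq_iff)
    then have "D0 (a * t) = D0 (b * s)" by simp
    then have "(x * to_fract s) * D0 t + to_fract t * D0 a = (x * to_fract t) * D0 s + to_fract s * D0 b"
      unfolding D0_mult s(2) t(2) .
    then have "to_fract t * (D0 a - x * D0 s) = to_fract s * (D0 b - x * D0 t)"
      by (simp add: algebra_simps)
    also have "\<dots> = to_fract t * (d x * to_fract s)" by (simp add: t(3)[symmetric])
    finally show ?thesis using t(1) by simp
  qed
  have rep: "\<exists>a s. s \<noteq> 0 \<and> x * to_fract s = to_fract a" for x :: "'a fract"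
  proof (cases x)
    case (Fract a b)
    then have "x * to_fract b = to_fract a" by (simp add: Fract_conv_to_fract)
    then show ?thesis using Fract by blast
  qed
  have d_add: "d (x + y) = d x + d y" and d_mult: "d (x * y) = x * d y + y * d x" for x y
  proof -
    obtain a s b t where s: "s \<noteq> 0" "x * to_fract s = to_fract a" and t: "t \<noteq> 0" "y * to_fract t = to_fract b"
      using rep by metis
    have st: "s * t \<noteq> 0" using s t by simp
    note ds = d[OF s] and dt = d[OF t]
    have "(x + y) * to_fract (s * t) = to_fract (a * t + b * s)"
      by (simp add: s(2)[symmetric] t(2)[symmetric]) (simp add: algebra_simps)
    note d[OF st this]
    also have "D0 (a * t + b * s) - (x + y) * D0 (s * t) =
        to_fract t * (D0 a - x * D0 s) + to_fract s * (D0 b - y * D0 t)"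
      by (simp add: D0_add D0_mult s(2)[symmetric] t(2)[symmetric]) (simp add: algebra_simps)
    also have "\<dots> = (d x + d y) * to_fract (s * t)"
      by (simp add: ds[symmetric] dt[symmetric]) (simp add: algebra_simps)
    finally show "d (x + y) = d x + d y" using st by simp
    have "(x * y) * to_fract (s * t) = to_fract (a * b)"
      by (simp add: s(2)[symmetric] t(2)[symmetric])
    note d[OF st this]
    also have "D0 (a * b) - (x * y) * D0 (s * t) =
        x * to_fract s * (D0 b - y * D0 t) + y * to_fract t * (D0 a - x * D0 s)"
      by (simp add: D0_mult s(2)[symmetric] t(2)[symmetric]) (simp add: algebra_simps)
    also have "\<dots> = (x * d y + y * d x) * to_fract (s * t)"
      by (simp add: ds[symmetric] dt[symmetric]) (simp add: algebra_simps)
    finally show "d (x * y) = x * d y + y * d x" using st by simp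
  qed
  have D01: "D0 1 = 0" using D0_const[of 1] by (simp add: \<kappa>.hom_one)
  have d_to_fract: "d (to_fract a) = D0 a" for a using d[of 1 "to_fract a" a] D01 by simp
  have "der_mod L (\<lambda>x. x) {0} d"
    by unfold_locales (auto simp: d_add d_mult)
  then have "derK {0} d" by (simp add: derK_def d_to_fract D0_const)
  moreover have "d x \<in> L" if x: "x \<in> L" for x
  proof -
    obtain a s where s: "s \<notin> M" "x * to_fract s = to_fract a" using x by (elim L_E)
    have "d x = (D0 a - x * D0 s) * inverse (to_fract s)"
      using d[OF notin_M_nonzero[OF s(1)] s(2)] notin_M_nonzero[OF s(1)] by (simp add: field_simps)
    then show ?thesis using D0_L x inverse_L[OF s(1)] by simp
  qed
  moreover have "d (to_fract (\<xi> j)) = v j" if "j < n" for j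
    using D0[of "mvar j"] that by (simp add: d_to_fract ev_simps \<delta>_var mvar_mpolys)
  ultimately show thesis using that by blast
qed

text \<open>The kernel of the Jacobi matrix is a direct summand of \<open>L\<^sup>n\<close>: the generalized inverse of the
  matrix provides a projection onto it.\<close>

definition proj :: "(nat \<Rightarrow> 'a fract) \<Rightarrow> nat \<Rightarrow> 'a fract" where
  "proj v k = v k - (\<Sum>l<m. to_fract (B k l) * inverse (to_fract \<Delta>) * \<delta> v (f l))"

lemma proj_L: "(\<And>j. j < n \<Longrightarrow> v j \<in> L) \<Longrightarrow> k < n \<Longrightarrow> proj v k \<in> L"
  unfolding proj_def by (intro L.diff_closed L.sum_closed L.mult_closed \<delta>_L inverse_L minor) auto

text \<open>With \<open>C\<close> for \<open>B\<close> divided by \<open>\<Delta>\<close>,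
  \<open>ginv\<close> reads \<open>J C J = J\<close>, that is,
  \<open>J (1 - C J) = 0\<close>.\<close>

lemma proj_kernel:
  assumes i: "i < m"
  shows "\<delta> (proj v) (f i) = 0"
proof -
  let ?J = "\<lambda>i j. to_fract (ev (partial_deriv j (f i)))" and ?I = "inverse (to_fract \<Delta>)"
  have \<Delta>: "?I * to_fract \<Delta> = 1" using minor by (simp add: notin_M_nonzero)
  have "(\<Sum>k<n. ?J i k * (\<Sum>l<m. to_fract (B k l) * ?I * \<delta> v (f l))) =
      (\<Sum>k<n. \<Sum>l<m. \<Sum>j<n. ?I * (?J i k * to_fract (B k l) * ?J l j * v j))"
    unfolding \<delta>_def sum_distrib_left
    by (rule sum.cong[OF refl], rule sum.cong[OF refl], rule sum.cong[OF refl]) (simp add: mult_ac)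
  also have "\<dots> = (\<Sum>k<n. \<Sum>j<n. \<Sum>l<m. ?I * (?J i k * to_fract (B k l) * ?J l j * v j))"
    by (rule sum.cong[OF refl]) (rule sum.swap)
  also have "\<dots> = (\<Sum>j<n. \<Sum>k<n. \<Sum>l<m. ?I * (?J i k * to_fract (B k l) * ?J l j * v j))"
    by (rule sum.swap)
  also have "\<dots> = (\<Sum>j<n. ?I * to_fract (\<Sum>k<n. \<Sum>l<m. ev (partial_deriv k (f i)) * B k l *
      ev (partial_deriv j (f l))) * v j)"
    by (simp add: sum_distrib_left sum_distrib_right mult_ac)
  also have "\<dots> = (\<Sum>j<n. ?J i j * v j)"
  proof (intro sum.cong refl)
    fix j assume "j \<in> {..<n}"
    then have "?I * to_fract (\<Sum>k<n. \<Sum>l<m. ev (partial_deriv k (f i)) * B k l * ev (partial_deriv j (f l)))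
        = (?I * to_fract \<Delta>) * ?J i j"
      using ginv[OF i, of j] by (simp only: lessThan_iff to_fract_mult mult.assoc)
    then show "?I * to_fract (\<Sum>k<n. \<Sum>l<m. ev (partial_deriv k (f i)) * B k l *
        ev (partial_deriv j (f l))) * v j = ?J i j * v j"
      unfolding \<Delta> by simp
  qed
  finally show ?thesis
    by (simp add: \<delta>_def[of "proj v"] proj_def right_diff_distrib sum_subtractf)
qed

lemma proj_sum: "proj (\<lambda>k. \<Sum>t\<in>A. c t * y t k) k = (\<Sum>t\<in>A. c t * proj (y t) k)"
proof -
  have \<delta>: "\<delta> (\<lambda>k. \<Sum>t\<in>A. c t * y t k) g = (\<Sum>t\<in>A. c t * \<delta> (y t) g)" for g
    unfolding \<delta>_def sum_distrib_left by (subst sum.swap) (simp add: mult_ac)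
  have "(\<Sum>l<m. to_fract (B k l) * inverse (to_fract \<Delta>) * (\<Sum>t\<in>A. c t * \<delta> (y t) (f l))) =
      (\<Sum>t\<in>A. c t * (\<Sum>l<m. to_fract (B k l) * inverse (to_fract \<Delta>) * \<delta> (y t) (f l)))"
    unfolding sum_distrib_left by (subst sum.swap) (simp add: mult_ac)
  then show ?thesis
    by (simp add: proj_def \<delta> right_diff_distrib sum_subtractf)
qed

lemma proj_fixed: "(\<And>l. l < m \<Longrightarrow> \<delta> v (f l) = 0) \<Longrightarrow> proj v k = v k"
  by (simp add: proj_def)

lemma proj_cong:
  assumes "\<And>l. l < m \<Longrightarrow> \<delta> v (f l) \<in> N"
  shows "v k - proj v k \<in> N"
  using assms by (auto simp: proj_def intro!: N_sum N_mult L.mult_closed inverse_L minor)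

lemma lift_derivation:
  assumes v: "\<And>j. j < n \<Longrightarrow> v j \<in> L" and Jv: "\<And>l. l < m \<Longrightarrow> \<delta> v (f l) \<in> N"
  obtains d where "derK {0} d" "\<And>x. x \<in> L \<Longrightarrow> d x \<in> L"
    "\<And>j. j < n \<Longrightarrow> v j - d (to_fract (\<xi> j)) \<in> N"
proof (rule exists_derivation[of "proj v", OF proj_L[OF v] proj_kernel])
  fix d assume "derK {0} d" "\<And>x. x \<in> L \<Longrightarrow> d x \<in> L" "\<And>j. j < n \<Longrightarrow> d (to_fract (\<xi> j)) = proj v j"
  then show thesis using that[of d] proj_cong[OF Jv] by simp
qed

lemma derK_weaken: "derK {0} d \<Longrightarrow> derK N d"
  unfolding derK_def der_mod_def der_mod_axioms_def by (auto simp: N_add N_mult)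

text \<open>Apply \<open>d\<close> to \<open>f i\<close>, which is zero in the coordinate ring. Only
  the classes of the values at the coordinates matter, so \<open>v\<close> may consist of any
  representatives.\<close>

lemma derK_relations:
  assumes "derK U d" "\<And>j. j < n \<Longrightarrow> v j - d (to_fract (\<xi> j)) \<in> U" "i < m"
  shows "\<delta> v (f i) \<in> U"
proof -
  interpret d: der_mod L "\<lambda>x. x" U d using assms by (simp add: derK_def)
  have sumU: "sum g A \<in> U" if "\<And>i. i \<in> A \<Longrightarrow> g i \<in> U" for g and A :: "nat set"
    using that by (induction A rule: infinite_finite_induct) (auto intro: d.N_add d.N_zero)
  have "d 0 \<in> U" using assms(1) \<kappa>.hom_zero unfolding derK_def by (metis to_fract_0)
  then have "(\<Sum>j<n. to_fract (ev (partial_deriv j (f i))) * d (to_fract (\<xi> j))) \<in> U"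
    using d.N_add[OF d.N_uminus[OF derK_chain[OF assms(1) f_in[OF assms(3)]]] \<open>d 0 \<in> U\<close>]
    by (simp add: f_zero[OF assms(3)])
  moreover have "(\<Sum>j<n. to_fract (ev (partial_deriv j (f i))) * (v j - d (to_fract (\<xi> j)))) \<in> U"
    by (intro sumU d.N_mult assms(2)) auto
  ultimately show ?thesis
    using d.N_add[of "\<Sum>j<n. to_fract (ev (partial_deriv j (f i))) * d (to_fract (\<xi> j))"]
    by (fastforce simp: \<delta>_def right_diff_distrib sum_subtractf)
qed

text \<open>The vector of values at the coordinates has entries \<open>a j * y j\<close> with
  \<open>a j\<close> in \<open>M\<close>. It is fixed by the projection, which is linear, so it is
  the sum of the \<open>a j\<close> times the projections of the vectors with the single entry
  \<open>y j\<close>. Each of these comes from a derivation.\<close>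

lemma derivation_in_ideal:
  assumes d: "derK {0} d" and dN: "\<And>x. x \<in> L \<Longrightarrow> d x \<in> N"
  obtains a D where "\<And>j. j < n \<Longrightarrow> a j \<in> M" "\<And>j. j < n \<Longrightarrow> derK {0} (D j)"
    "\<And>j x. j < n \<Longrightarrow> x \<in> L \<Longrightarrow> D j x \<in> L"
    "\<And>x. x \<in> L \<Longrightarrow> d x = (\<Sum>j<n. to_fract (a j) * D j x)"
proof -
  define v where "v j = d (to_fract (\<xi> j))" for j
  have "\<exists>a y. a \<in> M \<and> y \<in> L \<and> v j = to_fract a * y" for j
  proof -
    obtain a s where s: "s \<notin> M" "a \<in> M" "v j * to_fract s = to_fract a"
      using dN[OF to_fract_L[of "\<xi> j"]] unfolding v_def by (elim N_E)
    then have "v j = to_fract a * inverse (to_fract s)"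
      using notin_M_nonzero[OF s(1)] by (simp add: field_simps)
    then show ?thesis using s inverse_L by blast
  qed
  then obtain a y where ay: "\<And>j. a j \<in> M" "\<And>j. y j \<in> L" "\<And>j. v j = to_fract (a j) * y j"
    by metis
  define w where "w j = proj (\<lambda>k. if k = j then y j else 0)" for j
  have "\<exists>D. derK {0} D \<and> (\<forall>x\<in>L. D x \<in> L) \<and> (\<forall>k<n. D (to_fract (\<xi> k)) = w j k)" for j
  proof -
    have "w j k \<in> L" if "k < n" for k
      unfolding w_def by (rule proj_L) (use ay that in auto)
    moreover have "\<delta> (w j) (f i) = 0" if "i < m" for i
      unfolding w_def by (rule proj_kernel[OF that])
    ultimately show ?thesis by (rule exists_derivation[of "w j"]) blast+
  qed
  then obtain D where D: "\<And>j. derK {0} (D j)" "\<And>j x. x \<in> L \<Longrightarrow> D j x \<in> L"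
    "\<And>j k. k < n \<Longrightarrow> D j (to_fract (\<xi> k)) = w j k"
    by metis
  have w: "v k = (\<Sum>j<n. to_fract (a j) * w j k)" if k: "k < n" for k
  proof -
    let ?v = "\<lambda>k. \<Sum>j<n. to_fract (a j) * (if k = j then y j else 0)"
    have vv: "?v k = v k" if "k < n" for k
    proof -
      have "?v k = (\<Sum>j<n. if k = j then v j else 0)"
        by (intro sum.cong) (auto simp: ay(3))
      then show ?thesis using that by simp
    qed
    then have "\<delta> ?v g = \<delta> v g" for g unfolding \<delta>_def by (intro sum.cong) auto
    moreover have "\<delta> v (f i) = 0" if "i < m" for i
      using derK_relations[OF d, of v i] that by (simp add: v_def)
    ultimately have "proj ?v k = ?v k" by (intro proj_fixed) auto
    then show ?thesis using vv[OF k] unfolding proj_sum w_def by simp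
  qed
  have "derK {0} (\<lambda>x. \<Sum>j<n. to_fract (a j) * D j x)"
  proof -
    have D': "der_mod L (\<lambda>x. x) {0} (D j)" and "\<And>c. D j (to_fract (\<kappa> c)) = 0" for j
      using D(1) by (auto simp: derK_def)
    have add: "D j (x + z) = D j x + D j z" if "x \<in> L" "z \<in> L" for j x z
      using der_mod.D_add[OF D' that] by simp
    have mult: "D j (x * z) = x * D j z + z * D j x" if "x \<in> L" "z \<in> L" for j x z
      using der_mod.D_mult[OF D' that] by simp
    have "der_mod L (\<lambda>x. x) {0} (\<lambda>x. \<Sum>j<n. to_fract (a j) * D j x)"
      by unfold_locales
        (auto simp: add mult distrib_left sum.distrib sum_distrib_left mult_ac)
    then show ?thesis using \<open>\<And>j c. D j (to_fract (\<kappa> c)) = 0\<close> by (simp add: derK_def)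
  qed
  note diff = derK_diff[OF d this]
  have "d x = (\<Sum>j<n. to_fract (a j) * D j x)" if "x \<in> L" for x
    using derK_determined[OF diff _ that] w by (simp add: v_def D(3))
  then show thesis using that[of a D] ay D by blast
qed

text \<open>The source of surjectivity; \<open>\<phi>\<close> is a functional on M / M^2 given by
  representatives of its values.\<close>

lemma cotangent_lift:
  assumes \<phi>L: "\<And>a. a \<in> M \<Longrightarrow> \<phi> a \<in> L"
    and \<phi>_add: "\<And>a b. a \<in> M \<Longrightarrow> b \<in> M \<Longrightarrow> \<phi> (a + b) - (\<phi> a + \<phi> b) \<in> N"
    and \<phi>_mult: "\<And>c a. a \<in> M \<Longrightarrow> \<phi> (c * a) - to_fract c * \<phi> a \<in> N"
  obtains d where "derK {0} d" "\<And>x. x \<in> L \<Longrightarrow> d x \<in> L" "\<And>a. a \<in> M \<Longrightarrow> d (to_fract a) - \<phi> a \<in> N"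
proof -
  have "\<forall>j. \<exists>\<mu>. j < n \<longrightarrow> (\<exists>r s. r * \<mu> + s * pderiv \<mu> = 1) \<and> poly (map_poly \<kappa> \<mu>) (\<xi> j) \<in> M \<and>
    poly (map_poly \<kappa> (pderiv \<mu>)) (\<xi> j) \<notin> M"
    using separable_coordinate by blast
  then obtain \<mu> where \<mu>: "\<And>j. j < n \<Longrightarrow> \<exists>r s. r * \<mu> j + s * pderiv (\<mu> j) = 1"
    "\<And>j. j < n \<Longrightarrow> poly (map_poly \<kappa> (\<mu> j)) (\<xi> j) \<in> M"
    "\<And>j. j < n \<Longrightarrow> poly (map_poly \<kappa> (pderiv (\<mu> j))) (\<xi> j) \<notin> M"
    by metis
  define G where "G j = poly (map_poly const_poly (\<mu> j)) (mvar j)" for j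
  have evG: "ev (G j) = poly (map_poly \<kappa> (\<mu> j)) (\<xi> j)" for j
  proof -
    have "ev (poly (map_poly const_poly p) (mvar j)) = poly (map_poly \<kappa> p) (\<xi> j)" for p
      by (induction p) (simp_all add: map_poly_pCons \<kappa>.hom_zero ev.hom_zero ev.hom_add ev.hom_mult ev_simps)
    then show ?thesis by (simp add: G_def)
  qed
  define v where "v j = inverse (to_fract (poly (map_poly \<kappa> (pderiv (\<mu> j))) (\<xi> j))) * \<phi> (ev (G j))" for j
  have vL: "v j \<in> L" if "j < n" for j
    unfolding v_def by (intro L.mult_closed inverse_L \<phi>L) (use \<mu> that in \<open>auto simp: evG\<close>)
  note \<delta>L = \<delta>_L[of v, OF vL]
  \<comment> \<open>The defect of the candidate. It is needed only on polynomials with value in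
    \<open>M\<close>, where it is additive modulo \<open>N\<close>.\<close>
  define \<psi> where "\<psi> g = \<delta> v g - \<phi> (ev g)" for g
  have \<psi>_add: "\<psi> (g + h) \<in> N" if "\<psi> g \<in> N" "\<psi> h \<in> N" "ev g \<in> M" "ev h \<in> M" for g h
  proof -
    have "\<psi> (g + h) = (\<psi> g + \<psi> h) - (\<phi> (ev g + ev h) - (\<phi> (ev g) + \<phi> (ev h)))"
      by (simp add: \<psi>_def \<delta>_add ev.hom_add)
    then show ?thesis using that \<phi>_add by (simp add: N_diff N_add)
  qed
  have \<psi>_mult: "\<psi> (p * g) \<in> N" if "\<psi> g \<in> N" "ev g \<in> M" for p g
  proof -
    have "\<psi> (p * g) = to_fract (ev p) * \<psi> g + \<delta> v p * to_fract (ev g)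
        - (\<phi> (ev p * ev g) - to_fract (ev p) * \<phi> (ev g))"
      by (simp add: \<psi>_def \<delta>_mult ev.hom_mult algebra_simps)
    moreover have "to_fract (ev p) * \<psi> g \<in> N" "\<delta> v p * to_fract (ev g) \<in> N"
      using that \<delta>L by (auto intro!: N_mult simp only: to_fract_L to_fract_N_iff)
    ultimately show ?thesis using \<phi>_mult[OF that(2)] by (simp only: N_diff N_add)
  qed
  \<comment> \<open>On products of two such polynomials both parts vanish modulo \<open>N\<close>:
    the derivation by the product rule and \<open>\<phi>\<close> by linearity.\<close>
  have \<psi>_square: "\<psi> (p * g) \<in> N" if "ev p \<in> M" "ev g \<in> M" for p g
  proof -
    have "\<psi> (p * g) = \<delta> v g * to_fract (ev p) + \<delta> v p * to_fract (ev g)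
        - (\<phi> (ev p * ev g) - to_fract (ev p) * \<phi> (ev g)) - \<phi> (ev g) * to_fract (ev p)"
      by (simp add: \<psi>_def \<delta>_mult ev.hom_mult algebra_simps)
    moreover have "\<delta> v g * to_fract (ev p) \<in> N" "\<delta> v p * to_fract (ev g) \<in> N"
      "\<phi> (ev g) * to_fract (ev p) \<in> N"
      using that \<delta>L \<phi>L by (auto intro!: N_mult simp only: to_fract_N_iff)
    ultimately show ?thesis using \<phi>_mult[OF that(2)] by (simp only: N_diff N_add)
  qed
  have \<psi>_G: "\<psi> (G j) \<in> N" if "j < n" for j
  proof -
    have "\<delta> v (G j) = \<phi> (ev (G j))"
      unfolding G_def \<delta>_upoly[OF that]
      using notin_M_nonzero[OF \<mu>(3)[OF that]]
      by (simp add: v_def G_def)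
    then show ?thesis by (simp add: \<psi>_def)
  qed
  have \<psi>0: "\<psi> 0 \<in> N" using \<psi>_square[of 0 0] by (simp add: ev.hom_zero)
  have \<psi>: "\<psi> g \<in> N" if g: "g \<in> mpolys {..<n}" "ev g \<in> M" for g
  proof -
    \<comment> \<open>Regularity splits \<open>g\<close> into a combination of the
      \<open>G i\<close>, where the defect vanishes by the choice of \<open>v\<close>, and
      \<open>g * c * g\<close>, a product of two polynomials with value in \<open>M\<close>.\<close>
    obtain c b where cb: "g - g\<^sup>2 * c = (\<Sum>i<n. b i * G i)"
      using separable_regular[of n \<mu> g] \<mu>(1) g(1) unfolding G_def by blast
    have "\<psi> (\<Sum>i\<in>A. b i * G i) \<in> N \<and> ev (\<Sum>i\<in>A. b i * G i) \<in> M" if "A \<subseteq> {..<n}" for A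
    proof -
      have "finite A" using that finite_subset by blast
      then show ?thesis using that
      proof (induction A rule: finite_induct)
        case (insert i A)
        then have "ev (b i * G i) \<in> M" "\<psi> (b i * G i) \<in> N"
          using \<mu>(2) by (auto simp: ev.hom_mult evG intro!: mult_in \<psi>_mult \<psi>_G)
        then show ?case using insert by (auto simp: ev.hom_add intro!: \<psi>_add add_in)
      qed (simp add: \<psi>0 ev.hom_zero)
    qed
    then have "\<psi> (g - g\<^sup>2 * c) \<in> N" "ev (g - g\<^sup>2 * c) \<in> M" unfolding cb by auto
    moreover have "\<psi> (g * c * g) \<in> N" "ev (g * c * g) \<in> M"
      using g(2) by (auto simp: ev.hom_mult intro!: \<psi>_square mult_in mult_in')
    ultimately have "\<psi> ((g - g\<^sup>2 * c) + g * c * g) \<in> N" by (intro \<psi>_add)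
    then show ?thesis by (simp add: power2_eq_square mult_ac)
  qed
  \<comment> \<open>Each \<open>f i\<close> has value 0, and \<open>\<phi> 0\<close> lies in
    \<open>N\<close>. So the vanishing defect says that \<open>v\<close> solves the Jacobian
    equations modulo \<open>N\<close>, as lifting requires.\<close>
  have \<delta>N: "\<delta> v (f i) \<in> N" if "i < m" for i
  proof -
    have "\<phi> 0 \<in> N" using \<phi>_mult[of 0 0] by simp
    then show ?thesis
      using N_add[OF \<psi>[OF f_in[OF that]]] that by (fastforce simp: \<psi>_def f_zero)
  qed
  show thesis
  proof (rule lift_derivation[of v, OF vL \<delta>N])
    fix d assume d: "derK {0} d" "\<And>x. x \<in> L \<Longrightarrow> d x \<in> L"
      "\<And>j. j < n \<Longrightarrow> v j - d (to_fract (\<xi> j)) \<in> N"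
    have "d (to_fract a) - \<phi> a \<in> N" if a: "a \<in> M" for a
    proof -
      obtain g where g: "g \<in> mpolys {..<n}" "ev g = a" using surj by metis
      have "d (to_fract a) = (\<Sum>j<n. to_fract (ev (partial_deriv j g)) * d (to_fract (\<xi> j)))"
        using derK_chain[OF d(1) g(1)] g(2) by simp
      then have "d (to_fract a) - \<phi> a =
          \<psi> g - (\<Sum>j<n. to_fract (ev (partial_deriv j g)) * (v j - d (to_fract (\<xi> j))))"
        by (simp add: \<psi>_def g(2) \<delta>_def right_diff_distrib sum_subtractf)
      also have "\<dots> \<in> N" by (intro N_diff N_sum N_mult d(3) \<psi> g(1)) (use a g(2) in auto)
      finally show ?thesis .
    qed
    then show thesis using that d by blast
  qed
qed

end

section \<open>Passage to carriers\<close>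

abbreviation sub_ring :: "'b::comm_ring_1 set \<Rightarrow> 'b ring" where
  "sub_ring R \<equiv> class_ring\<lparr>carrier := R\<rparr>"

lemma cring_sub_ring:
  fixes R :: "'b::comm_ring_1 set"
  assumes "subring_set R"
  shows "cring (sub_ring R)"
proof -
  interpret subring_set R by fact
  have "abelian_group (sub_ring R)"
  proof (rule abelian_groupI)
    fix x assume "x \<in> carrier (sub_ring R)"
    then show "\<exists>y\<in>carrier (sub_ring R). y \<oplus>\<^bsub>sub_ring R\<^esub> x = \<zero>\<^bsub>sub_ring R\<^esub>"
      by (intro bexI[of _ "- x"]) auto
  qed (auto simp: ac_simps)
  moreover have "comm_monoid (sub_ring R)"
    by (rule comm_monoidI) (auto simp: ac_simps)
  ultimately show ?thesis
    by (rule cringI) (auto simp: distrib_right)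
qed

lemma ideal_of_closed:
  assumes "cring R" "T \<subseteq> carrier R" "\<zero>\<^bsub>R\<^esub> \<in> T"
    and add: "\<And>x y. x \<in> T \<Longrightarrow> y \<in> T \<Longrightarrow> x \<oplus>\<^bsub>R\<^esub> y \<in> T"
    and mult: "\<And>x y. x \<in> T \<Longrightarrow> y \<in> carrier R \<Longrightarrow> y \<otimes>\<^bsub>R\<^esub> x \<in> T"
  shows "ideal T R"
proof -
  interpret cring R by fact
  have inv: "\<ominus>\<^bsub>R\<^esub> x \<in> T" if "x \<in> T" for x
  proof -
    have "\<ominus>\<^bsub>R\<^esub> x = (\<ominus>\<^bsub>R\<^esub> \<one>\<^bsub>R\<^esub>) \<otimes>\<^bsub>R\<^esub> x" using assms(2) that by (simp add: l_minus subsetD)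
    then show ?thesis using mult[OF that] by simp
  qed
  show ?thesis
  proof (rule idealI)
    show "subgroup T (add_monoid R)"
      by (rule add.subgroupI) (use assms inv in \<open>auto simp: a_inv_def\<close>)
    show "a \<otimes>\<^bsub>R\<^esub> x \<in> T" if "a \<in> T" "x \<in> carrier R" for a x
      using mult[OF that] assms(2) that m_comm by auto
  qed (use mult ring_axioms in auto)
qed

lemma ideal_set_imp_ideal:
  fixes T :: "'b::comm_ring_1 set"
  assumes "ideal_set T" shows "ideal T class_ring"
proof -
  interpret ideal_set T by fact
  have "cring (class_ring :: 'b ring)"
    using cring_sub_ring[of "UNIV :: 'b set"] by (simp add: subring_set_def)
  then show ?thesis by (rule ideal_of_closed) (auto intro: add_in mult_in)
qed

lemma ideal_class_ring_imp_set:
  fixes T :: "'b::comm_ring_1 set"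
  assumes "ideal T class_ring" shows "ideal_set T"
proof -
  interpret ideal T class_ring by fact
  show ?thesis
  proof
    show "0 \<in> T" using zero_closed by simp
    show "x + y \<in> T" if "x \<in> T" "y \<in> T" for x y using a_closed[OF that] by simp
    show "y * x \<in> T" if "x \<in> T" for x y using I_l_closed[OF that, of y] by simp
  qed
qed

lemma maximalideal_class_ring:
  fixes M :: "'b::comm_ring_1 set"
  assumes "maximalideal M class_ring"
  shows "prime_set M" "\<And>r. r \<notin> M \<Longrightarrow> \<exists>r'. r * r' - 1 \<in> M"
proof -
  interpret maximalideal M class_ring by fact
  interpret I: ideal_set M by (rule ideal_class_ring_imp_set) (rule ideal_axioms)
  have one: "1 \<notin> M"
  proof
    assume "1 \<in> M"
    then have "M = UNIV" using I.mult_in[of 1] by auto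
    then show False using I_notcarr by simp
  qed
  show max: "\<exists>r'. r * r' - 1 \<in> M" if r: "r \<notin> M" for r
  proof -
    \<comment> \<open>This is the ideal generated by \<open>M\<close> and \<open>r\<close>.\<close>
    let ?T = "{x. \<exists>y. x - r * y \<in> M}"
    have "ideal_set ?T"
    proof
      show "0 \<in> ?T" by (auto intro: exI[of _ 0])
      show "x + y \<in> ?T" if "x \<in> ?T" "y \<in> ?T" for x y
      proof -
        obtain a b where "x - r * a \<in> M" "y - r * b \<in> M" using \<open>x \<in> ?T\<close> \<open>y \<in> ?T\<close> by auto
        then have "x + y - r * (a + b) \<in> M" using I.cong_add by (fastforce simp: distrib_left)
        then show ?thesis by blast
      qed
      show "y * x \<in> ?T" if "x \<in> ?T" for x y
      proof -
        obtain a where "x - r * a \<in> M" using \<open>x \<in> ?T\<close> by auto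
        then have "y * x - r * (y * a) \<in> M" using I.cong_mult_left[of x "r * a" y] by (simp add: mult_ac)
        then show ?thesis by blast
      qed
    qed
    then have "ideal ?T class_ring" by (rule ideal_set_imp_ideal)
    moreover have "M \<subseteq> ?T" by (auto intro: exI[of _ 0])
    ultimately have "?T = M \<or> ?T = UNIV" using I_maximal[of ?T] by simp
    moreover have "r \<in> ?T" by (auto intro: exI[of _ 1])
    ultimately have "1 \<in> ?T" using r by auto
    then obtain y where "1 - r * y \<in> M" by auto
    then show ?thesis using I.cong_sym by blast
  qed
  show "prime_set M"
  proof
    show "x \<in> M \<or> y \<in> M" if "x * y \<in> M" for x y
    proof (rule disjCI)
      assume "y \<notin> M"
      then obtain z where "y * z - 1 \<in> M" using max by blast
      then have "x * (y * z - 1) \<in> M" by (rule I.mult_in)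
      moreover have "x * y * z \<in> M" using that by (rule I.mult_in')
      ultimately have "x * y * z - x * (y * z - 1) \<in> M" by (rule I.diff_in[rotated])
      then show "x \<in> M" by (simp add: algebra_simps)
    qed
  qed (rule one)
qed

text \<open>All scalars of a coset act on the quotient in the same way because they do so on its image.\<close>

lemma quot_module_isoI:
  fixes G :: "('a, 'b, 'e) module_scheme"
  assumes G: "abelian_group G" and H: "subgroup H (add_monoid G)"
    and \<Theta>: "\<Theta> ` carrier G = carrier T"
    and \<Theta>_add: "\<And>x y. x \<in> carrier G \<Longrightarrow> y \<in> carrier G \<Longrightarrow> \<Theta> (x \<oplus>\<^bsub>G\<^esub> y) = \<Theta> x \<oplus>\<^bsub>T\<^esub> \<Theta> y"
    and \<Theta>_eq: "\<And>x y. x \<in> carrier G \<Longrightarrow> y \<in> carrier G \<Longrightarrow> \<Theta> x = \<Theta> y \<longleftrightarrow> H +>\<^bsub>G\<^esub> x = H +>\<^bsub>G\<^esub> y"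
    and smult: "\<And>C a x. C \<in> carrier R \<Longrightarrow> a \<in> C \<Longrightarrow> x \<in> carrier G \<Longrightarrow>
      a \<odot>\<^bsub>G\<^esub> x \<in> carrier G \<and> \<Theta> (a \<odot>\<^bsub>G\<^esub> x) = C \<odot>\<^bsub>T\<^esub> \<Theta> x"
    and ne: "\<And>C. C \<in> carrier R \<Longrightarrow> C \<noteq> {}"
  shows "\<exists>\<Phi>\<in>module_iso R (quot_module id G H) T. \<forall>x\<in>carrier G. \<Phi> (H +>\<^bsub>G\<^esub> x) = \<Theta> x"
proof -
  interpret abelian_group G by fact
  interpret H: abelian_subgroup H G
    by (rule abelian_subgroupI3) (use G H in \<open>auto intro: additive_subgroupI\<close>)
  have carr: "carrier (quot_module id G H) = (\<lambda>x. H +>\<^bsub>G\<^esub> x) ` carrier G"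
    by (auto simp: quot_module_def A_RCOSETS_def RCOSETS_def a_r_coset_def)
  define \<Phi> where "\<Phi> A = \<Theta> (SOME x. x \<in> carrier G \<and> H +>\<^bsub>G\<^esub> x = A)" for A
  have \<Phi>: "\<Phi> (H +>\<^bsub>G\<^esub> x) = \<Theta> x" if x: "x \<in> carrier G" for x
  proof -
    define y where "y = (SOME y. y \<in> carrier G \<and> H +>\<^bsub>G\<^esub> y = H +>\<^bsub>G\<^esub> x)"
    have "y \<in> carrier G \<and> H +>\<^bsub>G\<^esub> y = H +>\<^bsub>G\<^esub> x"
      unfolding y_def by (rule someI[of _ x]) (use x in simp)
    then show ?thesis using \<Theta>_eq x by (simp add: \<Phi>_def y_def[symmetric])
  qed
  have sm: "C \<odot>\<^bsub>quot_module id G H\<^esub> (H +>\<^bsub>G\<^esub> x) = H +>\<^bsub>G\<^esub> (a \<odot>\<^bsub>G\<^esub> x)"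
    if C: "C \<in> carrier R" "a \<in> C" and x: "x \<in> carrier G" for C a x
  proof -
    have eq: "H +>\<^bsub>G\<^esub> (b \<odot>\<^bsub>G\<^esub> y) = H +>\<^bsub>G\<^esub> (a \<odot>\<^bsub>G\<^esub> x)" if "b \<in> C" "y \<in> H +>\<^bsub>G\<^esub> x" for b y
    proof -
      have y: "y \<in> carrier G" using that(2) x H.a_subset a_r_coset_subset_G by blast
      have "H +>\<^bsub>G\<^esub> x = H +>\<^bsub>G\<^esub> y" using a_repr_independence[OF that(2) x H] .
      then have "\<Theta> x = \<Theta> y" using \<Theta>_eq x y by simp
      then show ?thesis
        using smult[OF C(1) that(1) y] smult[OF C x] \<Theta>_eq by metis
    qed
    have "C \<odot>\<^bsub>quot_module id G H\<^esub> (H +>\<^bsub>G\<^esub> x) = (\<Union>b\<in>C. \<Union>y\<in>H +>\<^bsub>G\<^esub> x. H +>\<^bsub>G\<^esub> (b \<odot>\<^bsub>G\<^esub> y))"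
      by (simp add: quot_module_def)
    also have "\<dots> = (\<Union>b\<in>C. \<Union>y\<in>H +>\<^bsub>G\<^esub> x. H +>\<^bsub>G\<^esub> (a \<odot>\<^bsub>G\<^esub> x))"
      by (intro SUP_cong refl eq)
    also have "\<dots> = H +>\<^bsub>G\<^esub> (a \<odot>\<^bsub>G\<^esub> x)"
      using C(2) H.a_rcos_self[OF x] by blast
    finally show ?thesis .
  qed
  have "\<Phi> \<in> module_hom R (quot_module id G H) T"
    unfolding LinearCombinations.module_hom_def
  proof (intro CollectI conjI allI impI)
    show "\<Phi> \<in> carrier (quot_module id G H) \<rightarrow> carrier T"
      unfolding carr using \<Phi> \<Theta> by auto
    fix A Y assume "A \<in> carrier (quot_module id G H) \<and> Y \<in> carrier (quot_module id G H)"
    then obtain x y where xy: "x \<in> carrier G" "A = H +>\<^bsub>G\<^esub> x" "y \<in> carrier G" "Y = H +>\<^bsub>G\<^esub> y"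
      unfolding carr by auto
    have "A \<oplus>\<^bsub>quot_module id G H\<^esub> Y = H +>\<^bsub>G\<^esub> (x \<oplus>\<^bsub>G\<^esub> y)"
      using H.a_rcos_sum[of x y] xy by (simp add: quot_module_def)
    then show "\<Phi> (A \<oplus>\<^bsub>quot_module id G H\<^esub> Y) = \<Phi> A \<oplus>\<^bsub>T\<^esub> \<Phi> Y"
      using xy \<Phi> \<Theta>_add by simp
  next
    fix C A assume "C \<in> carrier R \<and> A \<in> carrier (quot_module id G H)"
    then obtain a x where "C \<in> carrier R" "a \<in> C" "x \<in> carrier G" "A = H +>\<^bsub>G\<^esub> x"
      unfolding carr using ne by blast
    then show "\<Phi> (C \<odot>\<^bsub>quot_module id G H\<^esub> A) = C \<odot>\<^bsub>T\<^esub> \<Phi> A"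
      using sm smult \<Phi> by simp
  qed
  moreover have "bij_betw \<Phi> (carrier (quot_module id G H)) (carrier T)"
    unfolding bij_betw_def carr
  proof
    show "inj_on \<Phi> ((+>\<^bsub>G\<^esub>) H ` carrier G)"
      by (rule inj_onI) (auto simp: \<Phi> \<Theta>_eq)
    show "\<Phi> ` (+>\<^bsub>G\<^esub>) H ` carrier G = carrier T"
      using \<Theta> \<Phi> by (auto simp: image_image)
  qed
  ultimately show ?thesis using \<Phi> by (auto simp: module_iso_def)
qed

section \<open>The local ring, the residue field and the module of derivations as carriers\<close>

context affine_local
begin

interpretation \<kappa>: comm_ring_hom \<kappa> by (rule hom)

definition u :: "'k \<Rightarrow> 'a fract" where "u c = to_fract (\<kappa> c)"

lemma u_L [simp]: "u c \<in> L"
  by (simp add: u_def)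

lemma loc_ring_eq: "loc_ring M = sub_ring L"
  by (simp add: loc_ring_def L_def)

lemma loc_ring_simps [simp]:
  "carrier (loc_ring M) = L" "add (loc_ring M) = (+)" "mult (loc_ring M) = (*)"
  "one (loc_ring M) = 1" "zero (loc_ring M) = 0"
  by (simp_all add: loc_ring_eq)

lemma ideal_N: "ideal N (loc_ring M)"
proof (rule ideal_of_closed)
  show "cring (loc_ring M)" unfolding loc_ring_eq by (rule cring_sub_ring[OF subring_L])
qed (auto simp: N_subset_L N_add N_mult)

lemma loc_ideal_eq: "loc_ideal M = N"
proof
  interpret cring "loc_ring M" unfolding loc_ring_eq by (rule cring_sub_ring[OF subring_L])
  show "loc_ideal M \<subseteq> N"
    unfolding loc_ideal_def by (rule genideal_minimal[OF ideal_N]) (auto simp: to_fract_N_iff)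
  have M: "to_fract ` M \<subseteq> carrier (loc_ring M)" by auto
  interpret I: ideal "loc_ideal M" "loc_ring M"
    unfolding loc_ideal_def by (rule genideal_ideal[OF M])
  show "N \<subseteq> loc_ideal M"
  proof
    fix x assume "x \<in> N"
    then obtain a s where s: "s \<notin> M" "a \<in> M" "x * to_fract s = to_fract a" by (elim N_E)
    have "to_fract a \<in> loc_ideal M"
      using genideal_self[OF M] s(2) unfolding loc_ideal_def by blast
    then have "inverse (to_fract s) * to_fract a \<in> loc_ideal M"
      using I.I_l_closed[of "to_fract a" "inverse (to_fract s)"] inverse_L[OF s(1)] by simp
    moreover have "inverse (to_fract s) * to_fract a = x"
      using notin_M_nonzero[OF s(1)] by (simp add: s(3)[symmetric])
    ultimately show "x \<in> loc_ideal M" by simp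
  qed
qed

abbreviation res :: "'a fract \<Rightarrow> 'a fract set" where "res a \<equiv> N +>\<^bsub>loc_ring M\<^esub> a"

lemma res_set: "res a = {y. y - a \<in> N}"
proof -
  have "res a = (\<Union>h\<in>N. {h + a})" by (simp add: a_r_coset_def r_coset_def)
  also have "\<dots> = {y. y - a \<in> N}" by force
  finally show ?thesis .
qed

lemma res_eq_iff: "res a = res b \<longleftrightarrow> a - b \<in> N"
proof
  assume "res a = res b"
  then have "a \<in> res b" by (auto simp: res_set)
  then show "a - b \<in> N" by (simp add: res_set)
next
  assume ab: "a - b \<in> N"
  show "res a = res b"
    using N_add[OF _ ab] N_diff[OF _ ab] by (force simp: res_set)
qed

lemma residue_field_carrier: "carrier (residue_field M) = res ` L"
  by (auto simp: residue_field_def FactRing_def loc_ideal_eq A_RCOSETS_def RCOSETS_def a_r_coset_def)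

lemma residue_field_ops [simp]:
  "a \<in> L \<Longrightarrow> b \<in> L \<Longrightarrow> res a \<oplus>\<^bsub>residue_field M\<^esub> res b = res (a + b)"
  "a \<in> L \<Longrightarrow> b \<in> L \<Longrightarrow> res a \<otimes>\<^bsub>residue_field M\<^esub> res b = res (a * b)"
  using ring_hom_add[OF ideal.rcos_ring_hom[OF ideal_N], of a b]
    ring_hom_mult[OF ideal.rcos_ring_hom[OF ideal_N], of a b]
  by (simp_all add: residue_field_def loc_ideal_eq)

lemma res_rep: "C \<in> res ` L \<Longrightarrow> a \<in> C \<Longrightarrow> a \<in> L \<and> C = res a"
proof -
  assume "C \<in> res ` L" "a \<in> C"
  then obtain b where b: "b \<in> L" "C = res b" "a - b \<in> N" by (auto simp: res_set)
  then have "a - b + b \<in> L" using L.add_closed[OF N_subset_L] by blast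
  moreover have "res a = res b" using b(3) by (simp only: res_eq_iff)
  ultimately show ?thesis using b(2) by simp
qed

lemma derK_0_iff: "derK {0} d \<longleftrightarrow> (\<forall>x\<in>L. \<forall>y\<in>L. d (x + y) = d x + d y) \<and>
  (\<forall>x\<in>L. \<forall>y\<in>L. d (x * y) = x * d y + y * d x) \<and> (\<forall>c. d (u c) = 0)"
  by (auto simp: derK_def der_mod_def der_mod_axioms_def subring_L u_def)

lemma derK_N_iff: "derK N d \<longleftrightarrow> (\<forall>x\<in>L. \<forall>y\<in>L. d (x + y) - (d x + d y) \<in> N) \<and>
  (\<forall>x\<in>L. \<forall>y\<in>L. d (x * y) - (x * d y + y * d x) \<in> N) \<and> (\<forall>c. d (u c) \<in> N)"
  by (auto simp: derK_def der_mod_def der_mod_axioms_def subring_L u_def N_add N_mult)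

lemma N_mult': "x \<in> N \<Longrightarrow> y \<in> L \<Longrightarrow> x * y \<in> N"
  using N_mult[of y x] by (simp add: mult.commute)

definition Der :: "('a fract \<Rightarrow> 'a fract) set" where
  "Der = {d \<in> L \<rightarrow>\<^sub>E L. derK {0} d}"

lemma Der_add: "d \<in> Der \<Longrightarrow> x \<in> L \<Longrightarrow> y \<in> L \<Longrightarrow> d (x + y) = d x + d y"
  and Der_mult: "d \<in> Der \<Longrightarrow> x \<in> L \<Longrightarrow> y \<in> L \<Longrightarrow> d (x * y) = x * d y + y * d x"
  and Der_u: "d \<in> Der \<Longrightarrow> d (u c) = 0"
  and Der_L: "d \<in> Der \<Longrightarrow> x \<in> L \<Longrightarrow> d x \<in> L"
  by (auto simp: Der_def derK_0_iff)

lemma Der_I: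
  assumes "\<And>x. x \<in> L \<Longrightarrow> d x \<in> L" "derK {0} d"
  shows "restrict d L \<in> Der"
  using assms by (auto simp: Der_def derK_0_iff)

text \<open>Given the product rule, linearity over the base field amounts to killing constants,
  because \<open>d 1 = 0\<close>.\<close>

lemma derivations_eq: "derivations u (loc_ring M) (regular_module (loc_ring M)) = Der"
proof -
  have "(\<forall>c. \<forall>x\<in>L. d (u c * x) = u c * d x) \<longleftrightarrow> (\<forall>c. d (u c) = 0)"
    if m: "\<forall>x\<in>L. \<forall>y\<in>L. d (x * y) = x * d y + y * d x" for d :: "'a fract \<Rightarrow> 'a fract"
  proof -
    have "d (1 * 1) = d 1 + d 1" using m L.one_closed by (metis mult_1)
    then have "d 1 + 0 = d 1 + d 1" by simp
    then have d1: "d 1 = 0" by (simp only: add_left_cancel)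
    show ?thesis
    proof
      assume "\<forall>c. \<forall>x\<in>L. d (u c * x) = u c * d x"
      then have "d (u c * 1) = u c * d 1" for c using L.one_closed by blast
      then show "\<forall>c. d (u c) = 0" by (simp add: d1)
    next
      assume "\<forall>c. d (u c) = 0"
      then show "\<forall>c. \<forall>x\<in>L. d (u c * x) = u c * d x" using m by simp
    qed
  qed
  then show ?thesis
    unfolding derivations_def regular_module_def Der_def derK_0_iff by (auto simp: cong: conj_cong)
qed

lemma der_module_simps [simp]:
  "carrier (der_module u M) = Der"
  "zero (der_module u M) = (\<lambda>x\<in>L. 0)"
  "add (der_module u M) = (\<lambda>d e. \<lambda>x\<in>L. d x + e x)"
  "smult (der_module u M) = (\<lambda>c d. \<lambda>x\<in>L. c * d x)"
  unfolding der_module_def fun_module_def derivations_eq by (simp_all add: regular_module_def)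

lemma Der_ext: "d \<in> Der \<Longrightarrow> e \<in> Der \<Longrightarrow> (\<And>x. x \<in> L \<Longrightarrow> d x = e x) \<Longrightarrow> d = e"
  unfolding Der_def by (auto intro: PiE_ext)

lemma Der_restrict: "d \<in> Der \<Longrightarrow> restrict d L = d"
  by (auto simp: Der_def PiE_def extensional_restrict)

lemma Der_plus: "d \<in> Der \<Longrightarrow> e \<in> Der \<Longrightarrow> (\<lambda>x\<in>L. d x + e x) \<in> Der"
  by (rule Der_I) (auto simp: derK_0_iff Der_add Der_mult Der_u Der_L algebra_simps)

lemma Der_minus: "d \<in> Der \<Longrightarrow> e \<in> Der \<Longrightarrow> (\<lambda>x\<in>L. d x - e x) \<in> Der"
  by (rule Der_I) (auto simp: derK_0_iff Der_add Der_mult Der_u Der_L algebra_simps)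

lemma Der_smult: "c \<in> L \<Longrightarrow> d \<in> Der \<Longrightarrow> (\<lambda>x\<in>L. c * d x) \<in> Der"
  by (rule Der_I) (auto simp: derK_0_iff Der_add Der_mult Der_u Der_L algebra_simps)

lemma Der_zero: "(\<lambda>x\<in>L. 0) \<in> Der"
  by (rule Der_I) (auto simp: derK_0_iff)

lemma abelian_group_der: "abelian_group (der_module u M)"
proof (rule abelian_groupI)
  fix d assume d: "d \<in> carrier (der_module u M)"
  then have "(\<lambda>x\<in>L. (\<lambda>x\<in>L. 0) x - d x) \<in> Der" using Der_minus[OF Der_zero] by simp
  then show "\<exists>e\<in>carrier (der_module u M). e \<oplus>\<^bsub>der_module u M\<^esub> d = \<zero>\<^bsub>der_module u M\<^esub>"
    by (intro bexI) (auto intro!: restrict_ext)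
qed (auto simp: Der_plus Der_zero Der_restrict add_ac intro!: restrict_ext cong: restrict_cong)

lemma subgroup_ideal_der: "subgroup (ideal_der u M) (add_monoid (der_module u M))"
proof -
  interpret abelian_group "der_module u M" by (rule abelian_group_der)
  show ?thesis
    unfolding ideal_der_def
    by (rule group.generate_is_subgroup[OF a_group]) (auto simp: Der_smult)
qed

text \<open>The inclusion from right to left carries the content: it is the decomposition by means
  of the projection. It makes equality of cosets a pointwise congruence.\<close>

lemma ideal_der_eq: "ideal_der u M = {d \<in> Der. \<forall>x\<in>L. d x \<in> N}" (is "_ = ?H")
proof
  interpret abelian_group "der_module u M" by (rule abelian_group_der)
  have H: "subgroup ?H (add_monoid (der_module u M))"
  proof (rule add.subgroupI)
    show "?H \<noteq> {}" using Der_zero by (auto intro!: exI[of _ "\<lambda>x\<in>L. 0"])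
    show "d \<oplus>\<^bsub>der_module u M\<^esub> e \<in> ?H" if "d \<in> ?H" "e \<in> ?H" for d e
      using that by (auto simp: Der_plus N_add)
    show "\<ominus>\<^bsub>der_module u M\<^esub> d \<in> ?H" if d: "d \<in> ?H" for d
    proof -
      let ?e = "\<lambda>x\<in>L. (\<lambda>x\<in>L. 0) x - d x"
      have e: "?e \<in> Der" using Der_minus[OF Der_zero] d by simp
      have "?e \<oplus>\<^bsub>der_module u M\<^esub> d = \<zero>\<^bsub>der_module u M\<^esub>"
        by (auto intro!: restrict_ext)
      then have "\<ominus>\<^bsub>der_module u M\<^esub> d = ?e"
        using minus_equality[of ?e d] e d by simp
      then show ?thesis using e d N_uminus by auto
    qed
  qed auto
  show "ideal_der u M \<subseteq> ?H"
    unfolding ideal_der_def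
    by (rule group.generate_subgroup_incl[OF a_group _ H])
       (auto simp: Der_smult Der_L to_fract_N_iff intro!: N_mult')
  show "?H \<subseteq> ideal_der u M"
  proof
    fix d assume d: "d \<in> ?H"
    obtain a D where aD: "\<And>j. j < n \<Longrightarrow> a j \<in> M" "\<And>j. j < n \<Longrightarrow> derK {0} (D j)"
      "\<And>j x. j < n \<Longrightarrow> x \<in> L \<Longrightarrow> D j x \<in> L"
      "\<And>x. x \<in> L \<Longrightarrow> d x = (\<Sum>j<n. to_fract (a j) * D j x)"
      using derivation_in_ideal[of d] d by (auto simp: Der_def)
    have "(\<lambda>x\<in>L. \<Sum>j<k. to_fract (a j) * D j x) \<in> ideal_der u M" if "k \<le> n" for k
      using that
    proof (induction k)
      case 0
      have "(\<lambda>x\<in>L. 0) \<in> ideal_der u M" using subgroup.one_closed[OF subgroup_ideal_der] by simp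
      then show ?case by (simp only: lessThan_0 sum.empty)
    next
      case (Suc k)
      have "restrict (D k) L \<in> Der" using Suc.prems aD by (intro Der_I) auto
      then have "to_fract (a k) \<odot>\<^bsub>der_module u M\<^esub> restrict (D k) L \<in> ideal_der u M"
        unfolding ideal_der_def using Suc.prems aD(1)[of k]
        by (intro generate.incl CollectI exI[of _ "a k"] exI[of _ "restrict (D k) L"] conjI refl) simp_all
      moreover have "(\<lambda>x\<in>L. \<Sum>j<k. to_fract (a j) * D j x) \<in> ideal_der u M"
        by (rule Suc.IH) (use Suc.prems in simp)
      ultimately have "(\<lambda>x\<in>L. \<Sum>j<k. to_fract (a j) * D j x) \<oplus>\<^bsub>der_module u M\<^esub>
          (to_fract (a k) \<odot>\<^bsub>der_module u M\<^esub> restrict (D k) L) \<in> ideal_der u M"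
        using subgroup.m_closed[OF subgroup_ideal_der] by (simp only: monoid.simps)
      also have "(\<lambda>x\<in>L. \<Sum>j<k. to_fract (a j) * D j x) \<oplus>\<^bsub>der_module u M\<^esub>
          (to_fract (a k) \<odot>\<^bsub>der_module u M\<^esub> restrict (D k) L) = (\<lambda>x\<in>L. \<Sum>j<Suc k. to_fract (a j) * D j x)"
        by (auto intro!: restrict_ext)
      finally show ?case .
    qed
    from this[of n] have "(\<lambda>x\<in>L. \<Sum>j<n. to_fract (a j) * D j x) \<in> ideal_der u M" by simp
    also have "(\<lambda>x\<in>L. \<Sum>j<n. to_fract (a j) * D j x) = restrict d L"
      by (rule restrict_ext) (simp add: aD(4))
    also have "restrict d L = d" using d Der_restrict by simp
    finally show "d \<in> ideal_der u M" .
  qed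
qed

lemma der_coset_eq_iff:
  assumes d: "d \<in> Der" and e: "e \<in> Der"
  shows "ideal_der u M +>\<^bsub>der_module u M\<^esub> d = ideal_der u M +>\<^bsub>der_module u M\<^esub> e \<longleftrightarrow>
    (\<forall>x\<in>L. d x - e x \<in> N)"
proof -
  interpret abelian_group "der_module u M" by (rule abelian_group_der)
  interpret I: abelian_subgroup "ideal_der u M" "der_module u M"
    by (rule abelian_subgroupI3)
       (auto intro: additive_subgroupI subgroup_ideal_der abelian_group_der)
  have mem: "d \<in> ideal_der u M +>\<^bsub>der_module u M\<^esub> e \<longleftrightarrow> (\<forall>x\<in>L. d x - e x \<in> N)"
  proof
    assume "d \<in> ideal_der u M +>\<^bsub>der_module u M\<^esub> e"
    then obtain h where "h \<in> ideal_der u M" "d = (\<lambda>x\<in>L. h x + e x)"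
      by (auto simp: a_r_coset_def r_coset_def)
    then show "\<forall>x\<in>L. d x - e x \<in> N" by (simp add: ideal_der_eq)
  next
    assume "\<forall>x\<in>L. d x - e x \<in> N"
    then have "(\<lambda>x\<in>L. d x - e x) \<in> ideal_der u M" using Der_minus[OF d e] by (simp add: ideal_der_eq)
    moreover have "d = (\<lambda>x\<in>L. (\<lambda>x\<in>L. d x - e x) x + e x)"
      by (rule Der_ext[OF d Der_plus[OF Der_minus[OF d e] e]]) simp
    ultimately obtain h where "h \<in> ideal_der u M" "d = (\<lambda>x\<in>L. h x + e x)" by blast
    then show "d \<in> ideal_der u M +>\<^bsub>der_module u M\<^esub> e"
      unfolding a_r_coset_def r_coset_def by auto
  qed
  show ?thesis
  proof
    assume "ideal_der u M +>\<^bsub>der_module u M\<^esub> d = ideal_der u M +>\<^bsub>der_module u M\<^esub> e"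
    then show "\<forall>x\<in>L. d x - e x \<in> N" using I.a_rcos_self[of d] d mem by simp
  next
    assume "\<forall>x\<in>L. d x - e x \<in> N"
    then show "ideal_der u M +>\<^bsub>der_module u M\<^esub> d = ideal_der u M +>\<^bsub>der_module u M\<^esub> e"
      using a_repr_independence[of d "ideal_der u M" e] mem e subgroup_ideal_der by simp
  qed
qed

text \<open>Both isomorphisms of the theorem are obtained from this: a surjection from
  \<open>Der\<close>, compatible with the operations, that identifies two derivations exactly when
  they agree modulo \<open>N\<close>.\<close>

lemma der_fibre_isoI:
  assumes \<Theta>: "\<Theta> ` Der = carrier T"
    and \<Theta>_add: "\<And>d e. d \<in> Der \<Longrightarrow> e \<in> Der \<Longrightarrow> \<Theta> (\<lambda>x\<in>L. d x + e x) = \<Theta> d \<oplus>\<^bsub>T\<^esub> \<Theta> e"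
    and \<Theta>_eq: "\<And>d e. d \<in> Der \<Longrightarrow> e \<in> Der \<Longrightarrow> \<Theta> d = \<Theta> e \<longleftrightarrow> (\<forall>x\<in>L. d x - e x \<in> N)"
    and smult: "\<And>a d. a \<in> L \<Longrightarrow> d \<in> Der \<Longrightarrow> \<Theta> (\<lambda>x\<in>L. a * d x) = res a \<odot>\<^bsub>T\<^esub> \<Theta> d"
  shows "\<exists>\<Phi>\<in>module_iso (residue_field M) (der_fibre u M) T.
    \<forall>d\<in>Der. \<Phi> (ideal_der u M +>\<^bsub>der_module u M\<^esub> d) = \<Theta> d"
proof -
  have "\<exists>\<Phi>\<in>module_iso (residue_field M) (quot_module id (der_module u M) (ideal_der u M)) T.
    \<forall>d\<in>carrier (der_module u M). \<Phi> (ideal_der u M +>\<^bsub>der_module u M\<^esub> d) = \<Theta> d"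
  proof (rule quot_module_isoI[OF abelian_group_der subgroup_ideal_der])
    fix C a d assume C: "C \<in> carrier (residue_field M)" "a \<in> C" and d: "d \<in> carrier (der_module u M)"
    have "a \<in> L" "C = res a" using res_rep[of C a] C by (simp_all only: residue_field_carrier)
    then show "a \<odot>\<^bsub>der_module u M\<^esub> d \<in> carrier (der_module u M) \<and>
        \<Theta> (a \<odot>\<^bsub>der_module u M\<^esub> d) = C \<odot>\<^bsub>T\<^esub> \<Theta> d"
      using d smult Der_smult by simp
  next
    fix C assume "C \<in> carrier (residue_field M)"
    then obtain x where "C = res x" by (auto simp: residue_field_carrier)
    then have "x \<in> C" by (simp add: res_set)
    then show "C \<noteq> {}" by blast
  next
    fix d e assume "d \<in> carrier (der_module u M)" "e \<in> carrier (der_module u M)"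
    then have de: "d \<in> Der" "e \<in> Der" by simp_all
    show "\<Theta> (d \<oplus>\<^bsub>der_module u M\<^esub> e) = \<Theta> d \<oplus>\<^bsub>T\<^esub> \<Theta> e" using \<Theta>_add[OF de] by simp
    show "\<Theta> d = \<Theta> e \<longleftrightarrow> ideal_der u M +>\<^bsub>der_module u M\<^esub> d = ideal_der u M +>\<^bsub>der_module u M\<^esub> e"
      unfolding \<Theta>_eq[OF de] der_coset_eq_iff[OF de] ..
  qed (simp add: \<Theta>)
  then show ?thesis by (simp add: der_fibre_def)
qed

end

section \<open>The tangent space\<close>

context affine_local
begin

interpretation \<kappa>: comm_ring_hom \<kappa> by (rule hom)

lemma residue_module_simps [simp]:
  "carrier (residue_module M) = res ` L"
  "add (residue_module M) = add (residue_field M)"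
  "smult (residue_module M) = (\<lambda>a A. res a \<otimes>\<^bsub>residue_field M\<^esub> A)"
  by (simp_all add: residue_module_def residue_field_carrier loc_ideal_eq)

lemma tangent_space_simps [simp]:
  "carrier (tangent_space u M) = derivations u (loc_ring M) (residue_module M)"
  "add (tangent_space u M) = (\<lambda>d e. \<lambda>x\<in>L. d x \<oplus>\<^bsub>residue_field M\<^esub> e x)"
  "smult (tangent_space u M) = (\<lambda>c d. \<lambda>x\<in>L. c \<otimes>\<^bsub>residue_field M\<^esub> d x)"
  by (simp_all add: tangent_space_def fun_module_def regular_module_def)

text \<open>Representatives of the values form a derivation modulo \<open>N\<close>. Lifting its
  values at the coordinates gives a true derivation, and agreement at the coordinates implies
  agreement everywhere.\<close>

lemma tangent_lift:
  assumes D: "D \<in> derivations u (loc_ring M) (residue_module M)"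
  obtains d where "d \<in> Der" "\<And>x. x \<in> L \<Longrightarrow> D x = res (d x)"
proof -
  have DL: "D \<in> L \<rightarrow>\<^sub>E res ` L" using D by (auto simp: derivations_def)
  then have "\<forall>x\<in>L. \<exists>y. y \<in> L \<and> D x = res y" by (auto dest: PiE_mem)
  then obtain e where e: "\<And>x. x \<in> L \<Longrightarrow> e x \<in> L" "\<And>x. x \<in> L \<Longrightarrow> D x = res (e x)"
    by metis
  have add: "e (x + y) - (e x + e y) \<in> N" if "x \<in> L" "y \<in> L" for x y
  proof -
    have "D (x + y) = D x \<oplus>\<^bsub>residue_field M\<^esub> D y" using D that by (simp add: derivations_def)
    then have "res (e (x + y)) = res (e x + e y)" using that e by simp
    then show ?thesis by (simp only: res_eq_iff)
  qed
  have mult: "e (x * y) - (x * e y + y * e x) \<in> N" if "x \<in> L" "y \<in> L" for x y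
  proof -
    have "D (x * y) = (res x \<otimes>\<^bsub>residue_field M\<^esub> D y) \<oplus>\<^bsub>residue_field M\<^esub>
        (res y \<otimes>\<^bsub>residue_field M\<^esub> D x)"
      using D that by (simp add: derivations_def)
    then have "res (e (x * y)) = res (x * e y + y * e x)" using that e by simp
    then show ?thesis by (simp only: res_eq_iff)
  qed
  \<comment> \<open>The product rule for \<open>1 * 1\<close> leaves \<open>- e 1\<close>. Together
    with linearity this puts the values at constants into \<open>N\<close>.\<close>
  have "e 1 \<in> N" using N_uminus[OF mult[of 1 1]] by simp
  have "e (u c) \<in> N" for c
  proof -
    have "\<forall>c. \<forall>x\<in>L. D (u c * x) = res (u c) \<otimes>\<^bsub>residue_field M\<^esub> D x"
      using D unfolding derivations_def mem_Collect_eq loc_ring_simps residue_module_simps by blast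
    then have "D (u c * 1) = res (u c) \<otimes>\<^bsub>residue_field M\<^esub> D 1"
      using L.one_closed by blast
    then have "res (e (u c)) = res (u c * e 1)" using e by simp
    then have "e (u c) - u c * e 1 \<in> N" by (simp only: res_eq_iff)
    then show ?thesis using N_add[OF _ N_mult[OF u_L[of c] \<open>e 1 \<in> N\<close>]] by fastforce
  qed
  then have eN: "derK N e" using add mult by (simp add: derK_N_iff)
  show thesis
  proof (rule lift_derivation[of "\<lambda>j. e (to_fract (\<xi> j))"])
    show "\<delta> (\<lambda>j. e (to_fract (\<xi> j))) (f l) \<in> N" if "l < m" for l
      by (rule derK_relations[OF eN _ that]) simp
    fix d assume d: "derK {0} d" "\<And>x. x \<in> L \<Longrightarrow> d x \<in> L"
      "\<And>j. j < n \<Longrightarrow> e (to_fract (\<xi> j)) - d (to_fract (\<xi> j)) \<in> N"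
    have "e x - d x \<in> N" if "x \<in> L" for x
      by (rule derK_determined[OF derK_diff[OF eN derK_weaken[OF d(1)]] _ that]) (rule d(3))
    then show thesis
      using that[of "restrict d L"] Der_I[OF d(2,1)] e(2) by (simp add: res_eq_iff)
  qed (use e in auto)
qed

lemma tangent_iso:
  "\<exists>\<Psi>\<in>module_iso (residue_field M) (der_fibre u M) (tangent_space u M).
    \<forall>d\<in>Der. \<Psi> (ideal_der u M +>\<^bsub>der_module u M\<^esub> d) = (\<lambda>x\<in>L. res (d x))"
proof (rule der_fibre_isoI)
  have "(\<lambda>x\<in>L. res (d x)) \<in> derivations u (loc_ring M) (residue_module M)" if d: "d \<in> Der" for d
    unfolding derivations_def by (simp add: d Der_L Der_add Der_mult Der_u)
  then show "(\<lambda>d. \<lambda>x\<in>L. res (d x)) ` Der = carrier (tangent_space u M)"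
  proof (intro equalityI subsetI)
    fix D assume "D \<in> carrier (tangent_space u M)"
    then have D: "D \<in> derivations u (loc_ring M) (residue_module M)" by simp
    obtain d where d: "d \<in> Der" "\<And>x. x \<in> L \<Longrightarrow> D x = res (d x)" using tangent_lift[OF D] by blast
    have "D \<in> extensional L" using D by (auto simp: derivations_def PiE_def)
    then have "D = (\<lambda>x\<in>L. res (d x))" using d(2) by (intro extensionalityI[of _ L]) auto
    then show "D \<in> (\<lambda>d. \<lambda>x\<in>L. res (d x)) ` Der" using d(1) by blast
  qed auto
next
  fix d e assume de: "d \<in> Der" "e \<in> Der"
  show "(\<lambda>x\<in>L. res ((\<lambda>x\<in>L. d x + e x) x)) =
      (\<lambda>x\<in>L. res (d x)) \<oplus>\<^bsub>tangent_space u M\<^esub> (\<lambda>x\<in>L. res (e x))"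
    unfolding tangent_space_simps by (rule restrict_ext) (simp add: de Der_L)
  show "(\<lambda>x\<in>L. res (d x)) = (\<lambda>x\<in>L. res (e x)) \<longleftrightarrow> (\<forall>x\<in>L. d x - e x \<in> N)"
  proof
    assume eq: "(\<lambda>x\<in>L. res (d x)) = (\<lambda>x\<in>L. res (e x))"
    show "\<forall>x\<in>L. d x - e x \<in> N"
    proof
      fix x assume "x \<in> L"
      then have "res (d x) = res (e x)" using fun_cong[OF eq, of x] by simp
      then show "d x - e x \<in> N" by (simp only: res_eq_iff)
    qed
  next
    assume "\<forall>x\<in>L. d x - e x \<in> N"
    then show "(\<lambda>x\<in>L. res (d x)) = (\<lambda>x\<in>L. res (e x))" by (intro restrict_ext) (simp add: res_eq_iff)
  qed
next
  fix a d assume "a \<in> L" "d \<in> Der"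
  then show "(\<lambda>x\<in>L. res ((\<lambda>x\<in>L. a * d x) x)) = res a \<odot>\<^bsub>tangent_space u M\<^esub> (\<lambda>x\<in>L. res (d x))"
    unfolding tangent_space_simps by (intro restrict_ext) (simp add: Der_L)
qed

section \<open>The cotangent space and its dual\<close>

abbreviation W :: "'a set" where "W \<equiv> M \<cdot>\<^bsub>class_ring\<^esub> M"
abbreviation cot :: "'a \<Rightarrow> 'a set" where "cot a \<equiv> W +>\<^bsub>class_ring\<^esub> a"

lemma W_prod: "a \<in> M \<Longrightarrow> b \<in> M \<Longrightarrow> a * b \<in> W"
  using ideal_prod.prod[of a M b M class_ring] by simp

lemma ideal_set_W: "ideal_set W"
proof
  show "0 \<in> W" using W_prod[of 0 0] by simp
  show "x + y \<in> W" if "x \<in> W" "y \<in> W" for x y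
    using ideal_prod.sum[OF that] by simp
  show "y * x \<in> W" if "x \<in> W" for x y
    using that
  proof induction
    case (prod i j)
    then show ?case using W_prod[of "y * i" j] mult_in by (simp add: mult.assoc)
  next
    case (sum s t)
    then show ?case using ideal_prod.sum[of "y * s" class_ring M M "y * t"] by (simp add: distrib_left)
  qed
qed

interpretation W: ideal_set W by (rule ideal_set_W)

lemma Der_W: "d \<in> Der \<Longrightarrow> w \<in> W \<Longrightarrow> d (to_fract w) \<in> N"
proof -
  assume d: "d \<in> Der" and "w \<in> W"
  show "d (to_fract w) \<in> N"
    using \<open>w \<in> W\<close>
  proof induction
    case (prod i j)
    then show ?case using d by (simp add: Der_mult Der_L N_add N_mult' to_fract_N_iff)
  next
    case (sum s t)
    then show ?case using d by (simp add: Der_add N_add)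
  qed
qed

lemma cot_set: "cot a = {y. y - a \<in> W}"
proof -
  have "cot a = (\<Union>h\<in>W. {h + a})" by (simp add: a_r_coset_def r_coset_def)
  also have "\<dots> = {y. y - a \<in> W}" by force
  finally show ?thesis .
qed

lemma cot_eq_iff: "cot a = cot b \<longleftrightarrow> a - b \<in> W"
proof
  assume "cot a = cot b"
  then have "a \<in> cot b" by (auto simp: cot_set)
  then show "a - b \<in> W" by (simp add: cot_set)
next
  assume ab: "a - b \<in> W"
  show "cot a = cot b"
    using W.add_in[OF _ ab] W.diff_in[OF _ ab] by (force simp: cot_set)
qed

lemma cotangent_carrier: "carrier (cotangent_space M) = cot ` M"
  by (auto simp: cotangent_space_def quot_module_def regular_module_def A_RCOSETS_def RCOSETS_def
      a_r_coset_def r_coset_def)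

lemma cotangent_add: "cot a \<oplus>\<^bsub>cotangent_space M\<^esub> cot b = cot (a + b)"
proof -
  have "cot a \<oplus>\<^bsub>cotangent_space M\<^esub> cot b = (\<Union>x\<in>cot a. \<Union>y\<in>cot b. {x + y})"
    by (simp add: cotangent_space_def quot_module_def regular_module_def set_add_def set_mult_def)
  also have "\<dots> = cot (a + b)"
  proof (intro equalityI subsetI)
    fix z assume "z \<in> (\<Union>x\<in>cot a. \<Union>y\<in>cot b. {x + y})"
    then obtain x y where "z = x + y" "x - a \<in> W" "y - b \<in> W" by (auto simp: cot_set)
    then show "z \<in> cot (a + b)" using W.cong_add by (simp add: cot_set)
  next
    fix z assume z: "z \<in> cot (a + b)"
    have "z - b \<in> cot a" "b \<in> cot b" using z by (auto simp: cot_set algebra_simps)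
    then show "z \<in> (\<Union>x\<in>cot a. \<Union>y\<in>cot b. {x + y})" by force
  qed
  finally show ?thesis .
qed

text \<open>Two scalars \<open>b\<close> and \<open>c\<close> in the same residue class differ by an
  element of \<open>M\<close>, so \<open>(b - c) * a\<close> lies in \<open>W\<close> and the union
  over representatives collapses to one coset.\<close>

lemma cotangent_smult:
  assumes a: "a \<in> M"
  shows "res (to_fract c) \<odot>\<^bsub>cotangent_space M\<^esub> cot a = cot (c * a)"
proof -
  have eq: "cot (b * x) = cot (c * a)" if b: "to_fract b \<in> res (to_fract c)" and x: "x \<in> cot a" for b x
  proof -
    have "to_fract (b - c) \<in> N" using b by (simp add: res_set)
    then have "(b - c) * a \<in> W" using a W_prod by (simp only: to_fract_N_iff)
    moreover have "b * (x - a) \<in> W" using x by (intro W.mult_in) (simp add: cot_set)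
    ultimately have "b * (x - a) + (b - c) * a \<in> W" by (intro W.add_in)
    then show ?thesis unfolding cot_eq_iff by (simp add: algebra_simps)
  qed
  have "res (to_fract c) \<odot>\<^bsub>cotangent_space M\<^esub> cot a =
      (\<Union>b\<in>to_fract -` res (to_fract c). \<Union>x\<in>cot a. cot (b * x))"
    by (simp add: cotangent_space_def quot_module_def regular_module_def a_r_coset_def r_coset_def)
  also have "\<dots> = (\<Union>b\<in>to_fract -` res (to_fract c). \<Union>x\<in>cot a. cot (c * a))"
    by (intro SUP_cong refl eq) auto
  also have "\<dots> = cot (c * a)"
  proof -
    have "c \<in> to_fract -` res (to_fract c)" "a \<in> cot a" by (auto simp: res_set cot_set)
    then show ?thesis by blast
  qed
  finally show ?thesis .
qed

text \<open>A denominator outside \<open>M\<close> can be inverted modulo \<open>M\<close> within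
  the coordinate ring itself.\<close>

lemma res_surj: "x \<in> L \<Longrightarrow> \<exists>c. res x = res (to_fract c)"
proof -
  assume "x \<in> L"
  then obtain a s where s: "s \<notin> M" "x * to_fract s = to_fract a" by (elim L_E)
  obtain t where t: "s * t - 1 \<in> M" using max[OF s(1)] by blast
  have "x - to_fract (a * t) = - (x * to_fract (s * t - 1))"
    by (simp add: s(2)[symmetric] algebra_simps)
  also have "\<dots> \<in> N" using t \<open>x \<in> L\<close> by (intro N_uminus N_mult) (simp_all only: to_fract_N_iff)
  finally show ?thesis by (auto simp only: res_eq_iff)
qed

lemma dual_simps [simp]:
  "carrier (dual_module (residue_field M) (cotangent_space M)) =
    module_hom (residue_field M) (cotangent_space M) (regular_module (residue_field M)) \<inter> extensional (cot ` M)"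
  "add (dual_module (residue_field M) (cotangent_space M)) =
    (\<lambda>d e. \<lambda>x\<in>cot ` M. d x \<oplus>\<^bsub>residue_field M\<^esub> e x)"
  "smult (dual_module (residue_field M) (cotangent_space M)) =
    (\<lambda>c d. \<lambda>x\<in>cot ` M. c \<otimes>\<^bsub>residue_field M\<^esub> d x)"
  by (simp_all add: dual_module_def fun_module_def regular_module_def cotangent_carrier)

text \<open>Every residue class has a representative in the coordinate ring, so linearity over the
  residue field may be checked on such scalars.\<close>

lemma cotangent_hom_iff:
  "\<phi> \<in> module_hom (residue_field M) (cotangent_space M) (regular_module (residue_field M)) \<longleftrightarrow>
    (\<forall>a\<in>M. \<phi> (cot a) \<in> res ` L) \<and>
    (\<forall>a\<in>M. \<forall>b\<in>M. \<phi> (cot (a + b)) = \<phi> (cot a) \<oplus>\<^bsub>residue_field M\<^esub> \<phi> (cot b)) \<and>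
    (\<forall>c. \<forall>a\<in>M. \<phi> (cot (c * a)) = res (to_fract c) \<otimes>\<^bsub>residue_field M\<^esub> \<phi> (cot a))" (is "?l \<longleftrightarrow> ?r")
proof
  assume l: ?l
  note h = LinearCombinations.module_hom_closed[OF l] LinearCombinations.module_hom_add[OF l]
    LinearCombinations.module_hom_smult[OF l]
  show ?r
  proof (intro conjI ballI allI)
    fix a assume a: "a \<in> M"
    then show "\<phi> (cot a) \<in> res ` L"
      using h(1) by (auto simp: cotangent_carrier regular_module_def residue_field_carrier)
    show "\<phi> (cot (c * a)) = res (to_fract c) \<otimes>\<^bsub>residue_field M\<^esub> \<phi> (cot a)" for c
      using h(3)[of "res (to_fract c)" "cot a"] a
      by (simp add: cotangent_carrier regular_module_def residue_field_carrier cotangent_smult)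
    fix b assume "b \<in> M"
    then show "\<phi> (cot (a + b)) = \<phi> (cot a) \<oplus>\<^bsub>residue_field M\<^esub> \<phi> (cot b)"
      using h(2)[of "cot a" "cot b"] a
      by (simp add: cotangent_carrier regular_module_def cotangent_add)
  qed
next
  assume r: ?r
  show ?l
    unfolding LinearCombinations.module_hom_def
  proof (intro CollectI conjI allI impI)
    show "\<phi> \<in> carrier (cotangent_space M) \<rightarrow> carrier (regular_module (residue_field M))"
      using r by (auto simp: cotangent_carrier regular_module_def residue_field_carrier)
    fix A B assume "A \<in> carrier (cotangent_space M) \<and> B \<in> carrier (cotangent_space M)"
    then obtain a b where ab: "a \<in> M" "A = cot a" "b \<in> M" "B = cot b" by (auto simp: cotangent_carrier)
    show "\<phi> (A \<oplus>\<^bsub>cotangent_space M\<^esub> B) = \<phi> A \<oplus>\<^bsub>regular_module (residue_field M)\<^esub> \<phi> B"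
      unfolding ab(2,4) cotangent_add using r ab(1,3) by (simp add: regular_module_def)
  next
    fix C A assume "C \<in> carrier (residue_field M) \<and> A \<in> carrier (cotangent_space M)"
    then obtain x a where xa: "x \<in> L" "C = res x" "a \<in> M" "A = cot a"
      by (auto simp: cotangent_carrier residue_field_carrier)
    obtain c where c: "C = res (to_fract c)" using res_surj[OF xa(1)] xa(2) by blast
    show "\<phi> (C \<odot>\<^bsub>cotangent_space M\<^esub> A) = C \<odot>\<^bsub>regular_module (residue_field M)\<^esub> \<phi> A"
      unfolding c xa(4) cotangent_smult[OF xa(3)] using r xa(3) by (simp add: regular_module_def)
  qed
qed

text \<open>The chosen representative does not matter for \<open>d\<close> in \<open>Der\<close>,
  since the product rule sends the square of \<open>M\<close> into \<open>N\<close>.\<close>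

definition cot_map :: "('a fract \<Rightarrow> 'a fract) \<Rightarrow> 'a set \<Rightarrow> 'a fract set" where
  "cot_map d = (\<lambda>A\<in>cot ` M. res (d (to_fract (SOME a. a \<in> M \<and> cot a = A))))"

lemma cot_map_cot:
  assumes d: "d \<in> Der" and a: "a \<in> M"
  shows "cot_map d (cot a) = res (d (to_fract a))"
proof -
  define b where "b = (SOME b. b \<in> M \<and> cot b = cot a)"
  have b: "b \<in> M \<and> cot b = cot a" unfolding b_def by (rule someI[of _ a]) (use a in simp)
  then have "b - a \<in> W" by (simp only: cot_eq_iff)
  then have "d (to_fract (b - a)) \<in> N" by (rule Der_W[OF d])
  moreover have "d (to_fract b) = d (to_fract (b - a)) + d (to_fract a)"
    using Der_add[OF d, of "to_fract (b - a)" "to_fract a"] by simp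
  ultimately have "res (d (to_fract b)) = res (d (to_fract a))" by (simp only: res_eq_iff) simp
  then show ?thesis using a by (simp add: cot_map_def b_def)
qed

lemma cot_map_ext:
  assumes "\<phi> \<in> extensional (cot ` M)" "\<psi> \<in> extensional (cot ` M)" "\<And>a. a \<in> M \<Longrightarrow> \<phi> (cot a) = \<psi> (cot a)"
  shows "\<phi> = \<psi>"
  using assms by (intro extensionalityI[of _ "cot ` M"]) auto

lemma cot_map_extensional: "cot_map d \<in> extensional (cot ` M)"
  by (simp add: cot_map_def)

lemma cotangent_iso:
  "\<exists>\<Phi>\<in>module_iso (residue_field M) (der_fibre u M) (dual_module (residue_field M) (cotangent_space M)).
    \<forall>d\<in>Der. \<Phi> (ideal_der u M +>\<^bsub>der_module u M\<^esub> d) = cot_map d"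
proof (rule der_fibre_isoI)
  let ?T = "dual_module (residue_field M) (cotangent_space M)"
  have in_dual: "cot_map d \<in> carrier ?T" if d: "d \<in> Der" for d
  proof -
    have "cot_map d \<in> module_hom (residue_field M) (cotangent_space M) (regular_module (residue_field M))"
      unfolding cotangent_hom_iff
    proof (intro conjI ballI allI)
      fix a assume a: "a \<in> M"
      show "cot_map d (cot a) \<in> res ` L" using a d by (simp add: cot_map_cot Der_L)
      show "cot_map d (cot (a + b)) = cot_map d (cot a) \<oplus>\<^bsub>residue_field M\<^esub> cot_map d (cot b)"
        if b: "b \<in> M" for b
        using a b d add_in[OF a b] by (simp add: cot_map_cot Der_L Der_add)
      fix c
      \<comment> \<open>The second term of the product rule has a factor in \<open>M\<close>, so on
        residue classes only linearity remains.\<close>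
      have "res (to_fract c * d (to_fract a) + to_fract a * d (to_fract c)) = res (to_fract c * d (to_fract a))"
        unfolding res_eq_iff using a d by (simp add: N_mult' Der_L to_fract_N_iff)
      then show "cot_map d (cot (c * a)) = res (to_fract c) \<otimes>\<^bsub>residue_field M\<^esub> cot_map d (cot a)"
        using a d mult_in[OF a, of c] by (simp add: cot_map_cot Der_L Der_mult)
    qed
    then show ?thesis using cot_map_extensional by simp
  qed
  show "cot_map ` Der = carrier ?T"
  proof (intro equalityI subsetI)
    fix \<phi> assume "\<phi> \<in> carrier ?T"
    then have ext: "\<phi> \<in> extensional (cot ` M)" and \<phi>: "\<And>a. a \<in> M \<Longrightarrow> \<phi> (cot a) \<in> res ` L"
      "\<And>a b. a \<in> M \<Longrightarrow> b \<in> M \<Longrightarrow> \<phi> (cot (a + b)) = \<phi> (cot a) \<oplus>\<^bsub>residue_field M\<^esub> \<phi> (cot b)"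
      "\<And>c a. a \<in> M \<Longrightarrow> \<phi> (cot (c * a)) = res (to_fract c) \<otimes>\<^bsub>residue_field M\<^esub> \<phi> (cot a)"
      unfolding dual_simps Int_iff cotangent_hom_iff by blast+
    have "\<forall>a\<in>M. \<exists>y. y \<in> L \<and> \<phi> (cot a) = res y" using \<phi>(1) by blast
    then obtain p where p: "\<And>a. a \<in> M \<Longrightarrow> p a \<in> L" "\<And>a. a \<in> M \<Longrightarrow> \<phi> (cot a) = res (p a)" by metis
    show "\<phi> \<in> cot_map ` Der"
    proof (rule cotangent_lift[of p])
      show "p (a + b) - (p a + p b) \<in> N" if ab: "a \<in> M" "b \<in> M" for a b
      proof -
        have "res (p (a + b)) = res (p a + p b)"
          using \<phi>(2)[OF ab] p ab add_in[OF ab] by simp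
        then show ?thesis by (simp only: res_eq_iff)
      qed
      show "p (c * a) - to_fract c * p a \<in> N" if a: "a \<in> M" for c a
      proof -
        have "res (p (c * a)) = res (to_fract c * p a)"
          using \<phi>(3)[OF a, of c] p a mult_in[OF a, of c] by simp
        then show ?thesis by (simp only: res_eq_iff)
      qed
      fix d assume d: "derK {0} d" "\<And>x. x \<in> L \<Longrightarrow> d x \<in> L" "\<And>a. a \<in> M \<Longrightarrow> d (to_fract a) - p a \<in> N"
      have dD: "restrict d L \<in> Der" by (rule Der_I[OF d(2,1)])
      have "\<phi> (cot a) = cot_map (restrict d L) (cot a)" if a: "a \<in> M" for a
      proof -
        have "res (d (to_fract a)) = res (p a)" using d(3)[OF a] by (simp only: res_eq_iff)
        then show ?thesis unfolding cot_map_cot[OF dD a] p(2)[OF a] by simp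
      qed
      then have "\<phi> = cot_map (restrict d L)" by (rule cot_map_ext[OF ext cot_map_extensional])
      then show "\<phi> \<in> cot_map ` Der" using dD by blast
    qed (rule p(1))
  qed (use in_dual in blast)
  fix d e assume de: "d \<in> Der" "e \<in> Der"
  have "cot_map d \<oplus>\<^bsub>?T\<^esub> cot_map e = (\<lambda>x\<in>cot ` M. cot_map d x \<oplus>\<^bsub>residue_field M\<^esub> cot_map e x)"
    by simp
  moreover have "cot_map (\<lambda>x\<in>L. d x + e x) = (\<lambda>x\<in>cot ` M. cot_map d x \<oplus>\<^bsub>residue_field M\<^esub> cot_map e x)"
  proof (rule cot_map_ext[OF cot_map_extensional])
    fix a assume "a \<in> M"
    then show "cot_map (\<lambda>x\<in>L. d x + e x) (cot a) =
        (\<lambda>x\<in>cot ` M. cot_map d x \<oplus>\<^bsub>residue_field M\<^esub> cot_map e x) (cot a)"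
      by (simp add: cot_map_cot[OF Der_plus[OF de]] cot_map_cot de Der_L)
  qed simp
  ultimately show "cot_map (\<lambda>x\<in>L. d x + e x) = cot_map d \<oplus>\<^bsub>?T\<^esub> cot_map e" by (simp only:)
  show "cot_map d = cot_map e \<longleftrightarrow> (\<forall>x\<in>L. d x - e x \<in> N)"
  proof
    assume eq: "cot_map d = cot_map e"
    have z: "d (to_fract a) - e (to_fract a) \<in> N" if a: "a \<in> M" for a
    proof -
      have "res (d (to_fract a)) = res (e (to_fract a))"
        using cot_map_cot[OF de(1) a] cot_map_cot[OF de(2) a] eq by simp
      then show ?thesis by (simp only: res_eq_iff)
    qed
    \<comment> \<open>The difference is regarded as a derivation into the residue field; it vanishes
      on \<open>M\<close>, hence everywhere.\<close>
    have "derK N d" "derK N e" using de derK_weaken by (auto simp: Der_def)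
    then have "derK N (\<lambda>x. d x - e x)" by (rule derK_diff)
    then show "\<forall>x\<in>L. d x - e x \<in> N"
      using derK_vanishing_on_ideal[of "\<lambda>x. d x - e x"] z by blast
  next
    assume "\<forall>x\<in>L. d x - e x \<in> N"
    then have "cot_map d (cot a) = cot_map e (cot a)" if "a \<in> M" for a
      unfolding cot_map_cot[OF de(1) that] cot_map_cot[OF de(2) that] res_eq_iff by simp
    then show "cot_map d = cot_map e" by (rule cot_map_ext[OF cot_map_extensional cot_map_extensional])
  qed
next
  let ?T = "dual_module (residue_field M) (cotangent_space M)"
  fix x d assume x: "x \<in> L" and d: "d \<in> Der"
  have "res x \<odot>\<^bsub>?T\<^esub> cot_map d = (\<lambda>A\<in>cot ` M. res x \<otimes>\<^bsub>residue_field M\<^esub> cot_map d A)" by simp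
  moreover have "cot_map (\<lambda>y\<in>L. x * d y) = (\<lambda>A\<in>cot ` M. res x \<otimes>\<^bsub>residue_field M\<^esub> cot_map d A)"
  proof (rule cot_map_ext[OF cot_map_extensional])
    fix a assume "a \<in> M"
    then show "cot_map (\<lambda>y\<in>L. x * d y) (cot a) =
        (\<lambda>A\<in>cot ` M. res x \<otimes>\<^bsub>residue_field M\<^esub> cot_map d A) (cot a)"
      by (simp add: cot_map_cot[OF Der_smult[OF x d]] cot_map_cot d x Der_L)
  qed simp
  ultimately show "cot_map (\<lambda>y\<in>L. x * d y) = res x \<odot>\<^bsub>?T\<^esub> cot_map d" by (simp only:)
qed

end

section \<open>From the coset model of the coordinate ring to the abstract setting\<close>

lemma quot_proj_hom:
  fixes I :: "'k::field_char_0 mpoly set" and h :: "'k mpoly set \<Rightarrow> 'a::idom"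
  assumes I: "primeideal I (poly_ring n)" and h: "h \<in> ring_iso (poly_ring n Quot I) class_ring"
  shows "quot_proj n I h 1 = 1"
    and "\<And>g k. g \<in> mpolys {..<n} \<Longrightarrow> k \<in> mpolys {..<n} \<Longrightarrow>
      quot_proj n I h (g + k) = quot_proj n I h g + quot_proj n I h k"
    and "\<And>g k. g \<in> mpolys {..<n} \<Longrightarrow> k \<in> mpolys {..<n} \<Longrightarrow>
      quot_proj n I h (g * k) = quot_proj n I h g * quot_proj n I h k"
    and "\<And>g. g \<in> mpolys {..<n} \<Longrightarrow> quot_proj n I h g = 0 \<longleftrightarrow> g \<in> I"
    and "\<And>a. \<exists>g\<in>mpolys {..<n}. quot_proj n I h g = a"
proof -
  interpret primeideal I "poly_ring n" by (rule I)
  have R: "poly_ring n = sub_ring (mpolys {..<n} :: 'k mpoly set)"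
    by (simp add: poly_ring_def mpolys_def)
  have R_simps: "carrier (poly_ring n) = (mpolys {..<n} :: 'k mpoly set)"
    "add (poly_ring n) = ((+) :: 'k mpoly \<Rightarrow> _)" "mult (poly_ring n) = ((*) :: 'k mpoly \<Rightarrow> _)"
    "one (poly_ring n) = (1 :: 'k mpoly)" "zero (poly_ring n) = (0 :: 'k mpoly)"
    by (simp_all add: R)
  interpret P: subring_set "mpolys {..<n} :: 'k mpoly set" by (rule subring_mpolys)
  let ?p = "quot_proj n I h"
  have "h \<in> Ring.ring_hom (poly_ring n Quot I) class_ring" using h unfolding ring_iso_def by blast
  then have "h \<circ> (+>\<^bsub>poly_ring n\<^esub>) I \<in> Ring.ring_hom (poly_ring n) class_ring"
    by (rule ring_hom_trans[OF rcos_ring_hom])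
  then have hom: "?p \<in> Ring.ring_hom (poly_ring n) class_ring"
    by (simp add: quot_proj_def[abs_def] comp_def)
  show "?p 1 = 1" using ring_hom_one[OF hom] by (simp add: R_simps)
  show add: "?p (g + k) = ?p g + ?p k" if "g \<in> mpolys {..<n}" "k \<in> mpolys {..<n}" for g k
    using ring_hom_add[OF hom, of g k] that by (simp add: R_simps)
  show "?p (g * k) = ?p g * ?p k" if "g \<in> mpolys {..<n}" "k \<in> mpolys {..<n}" for g k
    using ring_hom_mult[OF hom, of g k] that by (simp add: R_simps)
  have bij: "bij_betw h (carrier (poly_ring n Quot I)) UNIV"
    using h by (simp add: ring_iso_def)
  have carr: "carrier (poly_ring n Quot I) = (\<lambda>g. I +>\<^bsub>poly_ring n\<^esub> g) ` mpolys {..<n}"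
    by (auto simp: FactRing_def A_RCOSETS_def RCOSETS_def a_r_coset_def R_simps)
  show "\<exists>g\<in>mpolys {..<n}. ?p g = a" for a
  proof -
    have "a \<in> h ` carrier (poly_ring n Quot I)" using bij by (simp add: bij_betw_def)
    then show ?thesis unfolding carr quot_proj_def by auto
  qed
  have sub: "subgroup I (add_monoid (poly_ring n))" by (rule a_subgroup)
  show "?p g = 0 \<longleftrightarrow> g \<in> I" if g: "g \<in> mpolys {..<n}" for g
  proof -
    have "?p 0 + ?p 0 = ?p 0" using add[of 0 0] by simp
    then have "?p 0 = 0" by (simp only: add_cancel_left_left)
    then have "?p g = 0 \<longleftrightarrow> h (I +>\<^bsub>poly_ring n\<^esub> g) = h (I +>\<^bsub>poly_ring n\<^esub> 0)"
      by (simp add: quot_proj_def)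
    also have "\<dots> \<longleftrightarrow> I +>\<^bsub>poly_ring n\<^esub> g = I +>\<^bsub>poly_ring n\<^esub> 0"
      using bij g unfolding bij_betw_def carr by (intro inj_on_eq_iff) auto
    also have "I +>\<^bsub>poly_ring n\<^esub> 0 = I"
      using a_coset_join2[of 0 I] sub subgroup.one_closed[OF sub] by (simp add: R_simps)
    also have "I +>\<^bsub>poly_ring n\<^esub> g = I \<longleftrightarrow> g \<in> I"
      using a_coset_join2[of g I] a_rcos_self[of g] sub g by (auto simp: R_simps)
    finally show ?thesis .
  qed
qed

lemma genideal_poly_ring:
  fixes f :: "nat \<Rightarrow> 'k::comm_ring_1 mpoly"
  assumes f: "\<And>i. i < m \<Longrightarrow> f i \<in> mpolys {..<n}"
    and g: "g \<in> Idl\<^bsub>poly_ring n\<^esub> (f ` {..<m})"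
  shows "\<exists>b. g = (\<Sum>i<m. b i * f i)"
proof -
  have R: "poly_ring n = sub_ring (mpolys {..<n} :: 'k mpoly set)"
    by (simp add: poly_ring_def mpolys_def)
  interpret P: subring_set "mpolys {..<n} :: 'k mpoly set" by (rule subring_mpolys)
  interpret cring "sub_ring (mpolys {..<n} :: 'k mpoly set)"
    by (rule cring_sub_ring[OF subring_mpolys])
  let ?T = "{\<Sum>i<m. b i * f i | b. \<forall>i<m. b i \<in> mpolys {..<n}}"
  have "ideal ?T (sub_ring (mpolys {..<n} :: 'k mpoly set))"
  proof (rule ideal_of_closed)
    show "?T \<subseteq> carrier (sub_ring (mpolys {..<n}))"
      by (auto intro!: P.sum_closed P.mult_closed f)
    show "\<zero>\<^bsub>sub_ring (mpolys {..<n} :: 'k mpoly set)\<^esub> \<in> ?T" by (auto intro!: exI[of _ "\<lambda>_. 0"])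
    fix x y assume "x \<in> ?T"
    then obtain b where b: "x = (\<Sum>i<m. b i * f i)" "\<forall>i<m. b i \<in> mpolys {..<n}" by auto
    {
      assume "y \<in> ?T"
      then obtain c where c: "y = (\<Sum>i<m. c i * f i)" "\<forall>i<m. c i \<in> mpolys {..<n}" by auto
      have "x + y = (\<Sum>i<m. (b i + c i) * f i)" by (simp add: b(1) c(1) distrib_right sum.distrib)
      then show "x \<oplus>\<^bsub>sub_ring (mpolys {..<n} :: 'k mpoly set)\<^esub> y \<in> ?T"
        using b(2) c(2) by (auto intro!: exI[of _ "\<lambda>i. b i + c i"])
    next
      assume y: "y \<in> carrier (sub_ring (mpolys {..<n} :: 'k mpoly set))"
      have "y * x = (\<Sum>i<m. (y * b i) * f i)" by (simp add: b(1) sum_distrib_left mult.assoc)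
      then show "y \<otimes>\<^bsub>sub_ring (mpolys {..<n} :: 'k mpoly set)\<^esub> x \<in> ?T"
        using b(2) y by (auto intro!: exI[of _ "\<lambda>i. y * b i"])
    }
  qed (rule is_cring)
  moreover have "f ` {..<m} \<subseteq> ?T"
  proof
    fix x assume "x \<in> f ` {..<m}"
    then obtain j where j: "j < m" "x = f j" by auto
    then have "x = (\<Sum>i<m. (if i = j then 1 else 0) * f i)" by (simp add: mult_delta_left)
    then show "x \<in> ?T" by (intro CollectI exI[of _ "\<lambda>i. if i = j then 1 else 0"]) auto
  qed
  ultimately have "Idl\<^bsub>sub_ring (mpolys {..<n})\<^esub> (f ` {..<m}) \<subseteq> ?T" by (rule genideal_minimal)
  then show ?thesis using g unfolding R by auto
qed

theorem corollary2p17: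
  fixes n m :: nat
    and f :: "nat \<Rightarrow> 'k::field_char_0 mpoly"
    and I :: "'k mpoly set"
    and h :: "'k mpoly set \<Rightarrow> 'a::idom"
    and M :: "'a set"
    and u :: "'k \<Rightarrow> 'a fract"
    and J :: "'a mat"
  assumes "\<And>i. i < m \<Longrightarrow> f i \<in> carrier (poly_ring n)"
    and "I = Idl\<^bsub>poly_ring n\<^esub> (f ` {..<m})"
    and "primeideal I (poly_ring n)"
    and "\<not> maximalideal I (poly_ring n)"
    and "h \<in> ring_iso (poly_ring n Quot I) class_ring"
    and "u = (\<lambda>c. to_fract (quot_proj n I h (const_poly c)))"
    and "J = jacobi_mat (quot_proj n I h) m n f"
    and "maximalideal M class_ring"
    and "\<not> minors_ideal (frac_rank J) J \<subseteq> M"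
  shows "(\<exists>\<Phi> \<in> module_iso (residue_field M) (der_fibre u M)
              (dual_module (residue_field M) (cotangent_space M)).
            \<forall>d\<in>carrier (der_module u M). \<forall>a\<in>M.
              \<Phi> (ideal_der u M +>\<^bsub>der_module u M\<^esub> d) ((M \<cdot>\<^bsub>class_ring\<^esub> M) +>\<^bsub>class_ring\<^esub> a)
                = loc_ideal M +>\<^bsub>loc_ring M\<^esub> d (to_fract a))
       \<and> (\<exists>\<Psi> \<in> module_iso (residue_field M) (der_fibre u M) (tangent_space u M).
            \<forall>d\<in>carrier (der_module u M). \<forall>x\<in>carrier (loc_ring M).
              \<Psi> (ideal_der u M +>\<^bsub>der_module u M\<^esub> d) x
                = loc_ideal M +>\<^bsub>loc_ring M\<^esub> d x)"
proof -
  let ?p = "quot_proj n I h"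
  note fin = assms(1) and prime = assms(3) and iso = assms(5)
  note p = quot_proj_hom[OF prime iso]
  have carr: "carrier (poly_ring n) = (mpolys {..<n} :: 'k mpoly set)"
    by (simp add: poly_ring_def mpolys_def)
  have f_in: "f i \<in> mpolys {..<n}" if "i < m" for i using fin[OF that] carr by simp
  have f_I: "f i \<in> I" if "i < m" for i
  proof -
    interpret primeideal I "poly_ring n" by (rule prime)
    show ?thesis using genideal_self[of "f ` {..<m}"] fin that unfolding assms(2) by auto
  qed
  define \<kappa> where "\<kappa> c = ?p (const_poly c)" for c
  define \<xi> where "\<xi> i = ?p (mvar i)" for i
  have "(0 :: 'k mpoly) \<in> mpolys {..<n}" using const_poly_mpolys[of 0 "{..<n}"] by simp
  then have "?p (0 + 0) = ?p 0 + ?p 0" by (intro p(2))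
  then have p0: "?p 0 = 0" by (simp only: add_0_left add_cancel_left_left add_cancel_right_right)
  have hom: "comm_ring_hom \<kappa>"
    by unfold_locales (simp_all add: \<kappa>_def p p0)
  have ev: "mpoly_eval \<kappa> \<xi> g = ?p g" if "g \<in> mpolys {..<n}" for g
    using that
    by (induction g rule: mpoly_induct)
       (simp_all add: mpoly_eval_const[OF hom] mpoly_eval_var[OF hom] mpoly_eval_add[OF hom]
         mpoly_eval_mult[OF hom] p flip: \<kappa>_def \<xi>_def)
  have J: "J \<in> carrier_mat m n" and J_ij: "\<And>i j. i < m \<Longrightarrow> j < n \<Longrightarrow>
      J $$ (i, j) = mpoly_eval \<kappa> \<xi> (partial_deriv j (f i))"
    using f_in by (simp_all add: assms(7) jacobi_mat_def ev partial_deriv_mpolys)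
  interpret \<kappa>: comm_ring_hom \<kappa> by (rule hom)
  interpret M: prime_set M by (rule maximalideal_class_ring(1)[OF assms(8)])
  have M_ideal: "ideal M class_ring" using assms(8) by (rule maximalideal.axioms(1))
  obtain S T where S: "S \<subseteq> {..<m}" "card S = frac_rank J" and T: "T \<subseteq> {..<n}" "card T = frac_rank J"
    and minor: "det (submatrix J S T) \<notin> M"
  proof -
    \<comment> \<open>If \<open>M\<close> contained all the generating minors, it would contain the
      ideal they generate; so one of them lies outside \<open>M\<close>.\<close>
    have "\<not> {det (submatrix J S T) | S T. S \<subseteq> {..<dim_row J} \<and> T \<subseteq> {..<dim_col J} \<and>
        card S = frac_rank J \<and> card T = frac_rank J} \<subseteq> M"
      using ring.genideal_minimal[OF ideal.axioms(2)[OF M_ideal] M_ideal] assms(9)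
      unfolding minors_ideal_def by blast
    then show thesis using that J by auto
  qed
  then have "det (submatrix J S T) \<noteq> 0" by auto
  then obtain B where B: "\<And>i j. i < m \<Longrightarrow> j < n \<Longrightarrow>
    (\<Sum>k<n. \<Sum>l<m. J $$ (i, k) * B k l * J $$ (l, j)) = det (submatrix J S T) * J $$ (i, j)"
    using generalized_inverse[OF J _ S T] by blast
  \<comment> \<open>On polynomials in the first \<open>n\<close> variables evaluation agrees with
    the projection, so each property of the quotient becomes one of
    \<open>mpoly_eval\<close>.\<close>
  interpret affine_local M n m \<kappa> \<xi> f B "det (submatrix J S T)"
  proof
    show "\<exists>r'. r * r' - 1 \<in> M" if "r \<notin> M" for r
      by (rule maximalideal_class_ring(2)[OF assms(8) that])
    show "\<exists>g\<in>mpolys {..<n}. mpoly_eval \<kappa> \<xi> g = a" for a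
      using p(5)[of a] ev by metis
    show "mpoly_eval \<kappa> \<xi> (f i) = 0" if "i < m" for i
      using p(4)[OF f_in[OF that]] f_I[OF that] ev[OF f_in[OF that]] by simp
    show "\<exists>b. g = (\<Sum>i<m. b i * f i)" if "g \<in> mpolys {..<n}" "mpoly_eval \<kappa> \<xi> g = 0" for g
    proof (rule genideal_poly_ring[OF f_in])
      show "g \<in> Idl\<^bsub>poly_ring n\<^esub> (f ` {..<m})"
        using p(4)[OF that(1)] ev[OF that(1)] that(2) by (simp add: assms(2)[symmetric])
    qed
    show "(\<Sum>k<n. \<Sum>l<m. mpoly_eval \<kappa> \<xi> (partial_deriv k (f i)) * B k l * mpoly_eval \<kappa> \<xi> (partial_deriv j (f l)))
      = det (submatrix J S T) * mpoly_eval \<kappa> \<xi> (partial_deriv j (f i))" if "i < m" "j < n" for i j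
      using B[OF that] that by (simp add: J_ij)
  qed (use \<kappa>.hom_zero \<kappa>.hom_one \<kappa>.hom_add \<kappa>.hom_mult f_in minor in auto)
  have u: "u = affine_local.u \<kappa>"
    using affine_local_axioms by (simp add: assms(6) \<kappa>_def affine_local.u_def fun_eq_iff)
  note simps = der_module_simps(1)[folded u] loc_ideal_eq loc_ring_simps(1)
  obtain \<Phi> where \<Phi>: "\<Phi> \<in> module_iso (residue_field M) (der_fibre u M) (dual_module (residue_field M) (cotangent_space M))"
    "\<And>d. d \<in> Der \<Longrightarrow> \<Phi> (ideal_der u M +>\<^bsub>der_module u M\<^esub> d) = cot_map d"
    using cotangent_iso[folded u] by blast
  obtain \<Psi> where \<Psi>: "\<Psi> \<in> module_iso (residue_field M) (der_fibre u M) (tangent_space u M)"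
    "\<And>d. d \<in> Der \<Longrightarrow> \<Psi> (ideal_der u M +>\<^bsub>der_module u M\<^esub> d) = (\<lambda>x\<in>L. res (d x))"
    using tangent_iso[folded u] by blast
  show ?thesis
    unfolding simps
    by (intro conjI bexI[OF _ \<Phi>(1)] bexI[OF _ \<Psi>(1)] ballI) (simp_all add: \<Phi>(2) \<Psi>(2) cot_map_cot)
qed

end
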